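(* Let $N\ge 2$. The chiral cluster seeds $\mathcal Q_N^{\mathrm{sub}(M)}$ ($M=0,\dots,N$) and the currents $G_M^\pm(z)$ (hence the subalgebras they generate) are related by mutations as follows. (1) For $M\neq 0$, the mutation of $\mathcal Q_N^{\mathrm{sub}(M)}$ at the vertex $M$, followed by gauging the vertex $M$ by $qq_3$, produces the quiver $\mathcal Q_N^{\mathrm{sub}(M-1)}$, and the currents $G^\pm_M(z)$ are mapped to the currents $G^\pm_{M-1}(z)$ (i.e. $G_M^\pm(z)$, re-expressed through the new vertex operators, is given by the formula for $G_{M-1}^\pm(z)$). (2) For $M\neq N$, the mutation of $\mathcal Q_N^{\mathrm{sub}(M)}$ at the vertex $M+1$, followed by gauging the vertex $M+1$ by $qq_1$, produces the quiver $\mathcal Q_N^{\mathrm{sub}(M+1)}$, and the currents $G^\pm_M(z)$ are mapped to the currents $G^\pm_{M+1}(z)$.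
   Context: **Parameters.** $q_1,q_2,q_3\in\mathbb C^\times$ satisfy $q_1q_2q_3=1$ and are otherwise generic ($q_1^aq_2^bq_3^c=1$ for integers only if $a=b=c$); $q=q_2^{1/2}$ is a fixed square root. $f^{[n]}$ denotes the expression $f$ with $q$, the $q_c$ and all arrow parameters replaced by their $n$-th powers. $\delta(x)=\sum_{n\in\mathbb Z}x^n$. **Decorated quivers and seeds.** A decorated quiver has a finite vertex set $I$, each vertex being unfrozen, frozen of type $+$ or frozen of type $-$; each arrow $a$ carries a label $\kappa_a\in\mathbb C^\times$; loops and opposite arrows are allowed. Put $\epsilon_{ii}=0$, $\epsilon_{ij}=\#(i\to j)-\#(j\to i)$ for $i\ne j$, and $C_{ij}=(q-q^{-1})c_{ij}$ with $c_{ii}=(q-q^{-1})-\sum_{\ell:i\to i}(q\kappa_\ell-q^{-1}\kappa_\ell^{-1})$ for $i$ unfrozen, $c_{ii}=\mp q^{\mp1}$ for $i$ frozen of type $\pm$ (without loops), $c_{ij}=\sum_{a:i\to j}q^{-1}\kappa_a^{-1}-\sum_{a:j\to i}q\kappa_a$ for $i\neq j$. The algebra $\mathcal A_{\mathcal Q}$ is the (suitably completed) algebra generated by $X_i^{\pm1}$, $x_{i,n}$ ($i\in I$, $n\in\mathbb Z\setminus\{0\}$) with $X_iX_j=q^{2\epsilon_{ij}}X_jX_i$, $[X_i,x_{j,n}]=0$, $[x_{i,n},x_{j,m}]=\frac{\delta_{n+m,0}}{n}C_{ij}^{[n]}$ for $n>0$ (modes with indices of the same sign commute). Vertex operators: $X_i(z)=X_i\,e^{\sum_{n>0}z^nx_{i,-n}}e^{\sum_{n>0}z^{-n}x_{i,n}}$.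 Normal ordering $:\ :$ puts $x_{i,n}$, $n>0$, to the right, and on zero modes is defined by $X_i:\prod_jX_j^{n_j}:=q^{\sum_j\epsilon_{ij}n_j}:X_i\prod_jX_j^{n_j}:$. Pairs of opposite arrows between the same vertices (or pairs of loops at one vertex) with labels $\kappa_1\kappa_2=q^{-2}$ contribute nothing to $C,\epsilon$ and are deleted. **Gauging** a vertex $i$ by $\alpha$: labels of arrows into $i$ are multiplied by $\alpha$, labels of arrows out of $i$ by $\alpha^{-1}$, and $X_i(z)$ is replaced by $X_i(z/\alpha)$. **Mutation** at an unfrozen vertex $k$ without loops. On quivers: (i) reverse all arrows at $k$, replacing their labels $\kappa\mapsto q^{-1}\kappa^{-1}$; (ii) then, for each pair of (new) arrows $i\to k$, $k\to j$ with labels $\kappa_1,\kappa_2$, add an arrow $j\to i$ with label $q^{-2}\kappa_1^{-1}\kappa_2^{-1}$; (iii) delete opposite pairs of arrows, and pairs of loops, whose labels satisfy $\kappa_1\kappa_2=q^{-2}$. On vertex operators: introduce fermions $\Psi(z),\Psi^*(z)$ with $\{\Psi(z),\Psi(w)\}=\{\Psi^*(z),\Psi^*(w)\}=0$, $\{\Psi(z),\Psi^*(w)\}=\delta(z/w)$ such that $X_k(z)=-:\Psi(q^{-1}z)\Psi^*(qz):$ and, for $i\ne k$, $X_i(z)=:\prod_{a:i\to k}\Psi(q\kappa_az)\prod_{b:k\to i}\Psi^*(q^{-1}\kappa_b^{-1}z):V_i(z)$ with $V_i$ commuting with $\Psi,\Psi^*$ (zero modes being extended so that this holds). Let $\tilde\Psi,\tilde\Psi^*$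 be new fermions with $\tilde\Psi^*(z)=\Psi(qz)-\Psi(q^{-1}z)$, $\Psi^*(z)=\tilde\Psi(q^{-1}z)-\tilde\Psi(qz)$. The mutated vertex operators are $\tilde X_k(z)=-:\tilde\Psi(q^{-1}z)\tilde\Psi^*(qz):$ and $\tilde X_i(z)=:\prod_{a:i\to k}\tilde\Psi^*(\kappa_az)\prod_{b:k\to i}(-\tilde\Psi(\kappa_b^{-1}z)):V_i(z)$ (arrows and labels of the original quiver). Currents are re-expressed by substituting the fermion transformation outside normal-ordering signs. **The quivers $\mathcal Q_N^{\mathrm{sub}(M)}$.** Vertices: frozen $0$ of type $-$, frozen $N+1$ of type $+$, unfrozen $1,\dots,N$. $M=0$: for $i=1,\dots,N-1$ arrows $i\to i+1$ (label $1$) and $i+1\to i$ (label $q_3$); a loop with label $q_1$ at each $i=2,\dots,N$ (none at $1$); $1\to0$ (label $q_1$); $N+1\to1$ (label $1$); $N-1$ arrows $0\to N+1$ with labels $q_3,1,q_3^{-1},\dots,q_3^{3-N}$. $1\le M\le N-1$: loops with label $q_1$ at $i\in\{1,\dots,M-1\}\cup\{M+2,\dots,N\}$; for $i\in\{1,\dots,M-1\}\cup\{M+1,\dots,N-1\}$ arrows $i\to i+1$ (label $1$), $i+1\to i$ (label $q_3$); $M\to M+1$ (label $1$), $M+1\to M$ (label $q_1$); $0\to M$ (label $q_3^{1-M}$); $M+1\to0$ (label $q^{-2}q_3^{M-1}$); $M\to N+1$ (label $q_3$); $N+1\to M+1$ (label $1$); $N-M-1$ arrows $0\to N+1$ with labels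 $q_3^{1-M},q_3^{-M},\dots,q_3^{3-N}$ (none if $M=N-1$). $M=N$: loops with label $q_1$ at $1,\dots,N-1$; $i\to i+1$ (label $1$), $i+1\to i$ (label $q_3$) for $i=1,\dots,N-1$; $0\to N$ (label $q_3^{1-N}$); $N\to N+1$ (label $q_3$); $N+1\to0$ (label $q^{-2}q_3^{N-2}$). **The currents.** With $T$ the shift operator, $Tz=q_3zT$, $T\cdot1=1$, $$G^+_M(z)=:X_{N+1}(z)\bigl(1+X_{M+1}(z)\cdots X_N(z)T\bigr)\bigl(1+X_{M+1}(z)\cdots X_{N-1}(z)T\bigr)\cdots\bigl(1+X_{M+1}(z)T\bigr)\cdot1:,$$ $$G^-_M(z)=:X_0(z)\bigl(1+X_1(z)X_2(q_3^{-1}z)\cdots X_M(q_3^{1-M}z)T\bigr)\bigl(1+X_2(q_3^{-1}z)\cdots X_M(q_3^{1-M}z)T\bigr)\cdots\bigl(1+X_M(q_3^{1-M}z)T\bigr)\cdot1:,$$ where empty products of factors are $1$, so $G_N^+(z)=X_{N+1}(z)$ and $G_0^-(z)=X_0(z)$. *)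

theory Defs
  imports Complex_Main "HOL-Library.Multiset" "HOL-Library.Groups_Big_Fun"
begin

section \<open>Decorated quivers\<close>

datatype vertex_kind = Unfrozen | Frozen_plus | Frozen_minus

text \<open>An arrow is a triple (source, target, label).  Arrows form a multiset, so equality of the
  \<open>arrows\<close> components is equality of quivers up to renaming of arrows (the vertices being fixed).\<close>

record 'v quiver =
  verts :: "'v set"
  kind :: "'v \<Rightarrow> vertex_kind"
  arrows :: "('v \<times> 'v \<times> complex) multiset"

definition labels :: "'v quiver \<Rightarrow> 'v \<Rightarrow> 'v \<Rightarrow> complex multiset" where
  "labels Q i j = image_mset (\<lambda>(s, t, \<kappa>). \<kappa>) (filter_mset (\<lambda>(s, t, \<kappa>). s = i \<and> t = j) (arrows Q))"

definition decorated_quiver :: "'v quiver \<Rightarrow> bool" where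
  "decorated_quiver Q \<longleftrightarrow> finite (verts Q) \<and>
     (\<forall>(i, j, \<kappa>) \<in># arrows Q. i \<in> verts Q \<and> j \<in> verts Q \<and> \<kappa> \<noteq> 0 \<and> (i = j \<longrightarrow> kind Q i = Unfrozen))"

definition mutable_at :: "'v quiver \<Rightarrow> 'v \<Rightarrow> bool" where
  "mutable_at Q k \<longleftrightarrow> k \<in> verts Q \<and> kind Q k = Unfrozen \<and> labels Q k k = {#}"

definition eps :: "'v quiver \<Rightarrow> 'v \<Rightarrow> 'v \<Rightarrow> int" where
  "eps Q i j = (if i = j then 0 else int (size (labels Q i j)) - int (size (labels Q j i)))"

text \<open>\<open>c_entry q Q n i j\<close> and \<open>C_entry q Q n i j\<close> are \<open>c\<^sub>i\<^sub>j\<close> and \<open>C\<^sub>i\<^sub>j\<close> with \<open>q\<close> and all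
  labels replaced by their \<open>n\<close>-th powers.\<close>

definition c_entry :: "complex \<Rightarrow> 'v quiver \<Rightarrow> int \<Rightarrow> 'v \<Rightarrow> 'v \<Rightarrow> complex" where
  "c_entry q Q n i j =
     (if i = j then
        (case kind Q i of
           Unfrozen \<Rightarrow> (q powi n - q powi (-n))
                         - (\<Sum>\<kappa>\<in>#labels Q i i. q powi n * \<kappa> powi n - q powi (-n) * \<kappa> powi (-n))
         | Frozen_plus \<Rightarrow> - (q powi (-n))
         | Frozen_minus \<Rightarrow> q powi n)
      else (\<Sum>\<kappa>\<in>#labels Q i j. q powi (-n) * \<kappa> powi (-n)) - (\<Sum>\<kappa>\<in>#labels Q j i. q powi n * \<kappa> powi n))"

definition C_entry :: "complex \<Rightarrow> 'v quiver \<Rightarrow> int \<Rightarrow> 'v \<Rightarrow> 'v \<Rightarrow> complex" where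
  "C_entry q Q n i j = (q powi n - q powi (-n)) * c_entry q Q n i j"

definition quiver_gauge :: "'v \<Rightarrow> complex \<Rightarrow> 'v quiver \<Rightarrow> 'v quiver" where
  "quiver_gauge i \<alpha> Q = Q\<lparr>arrows := image_mset
     (\<lambda>(s, t, \<kappa>). (s, t, \<kappa> * (if t = i then \<alpha> else 1) * (if s = i then inverse \<alpha> else 1))) (arrows Q)\<rparr>"

definition flip_arrows :: "complex \<Rightarrow> 'v \<Rightarrow> ('v \<times> 'v \<times> complex) multiset \<Rightarrow> ('v \<times> 'v \<times> complex) multiset" where
  "flip_arrows q k A = image_mset
     (\<lambda>(s, t, \<kappa>). if s = k \<or> t = k then (t, s, inverse (q * \<kappa>)) else (s, t, \<kappa>)) A"

definition composite_arrows :: "complex \<Rightarrow> 'v \<Rightarrow> ('v \<times> 'v \<times> complex) multiset \<Rightarrow> ('v \<times> 'v \<times> complex) multiset" where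
  "composite_arrows q k A =
     (\<Sum>(i, _, \<kappa>\<^sub>1)\<in>#filter_mset (\<lambda>(s, t, \<kappa>). t = k) A.
        image_mset (\<lambda>(_, j, \<kappa>\<^sub>2). (j, i, inverse (q ^ 2 * \<kappa>\<^sub>1 * \<kappa>\<^sub>2)))
          (filter_mset (\<lambda>(s, t, \<kappa>). s = k) A))"

text \<open>Deletion of pairs of arrows \<open>a\<close>, \<open>opp_arrow q a\<close> until none is left.  The multiplicity of
  \<open>a\<close> drops to \<open>count A a - count A (opp_arrow q a)\<close> (truncated), except for a loop with
  \<open>\<kappa>\<^sup>2 = q\<^sup>-\<^sup>2\<close>: such a loop is its own partner, and its multiplicity is reduced modulo 2.\<close>

definition opp_arrow :: "complex \<Rightarrow> 'v \<times> 'v \<times> complex \<Rightarrow> 'v \<times> 'v \<times> complex" where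
  "opp_arrow q = (\<lambda>(i, j, \<kappa>). (j, i, inverse (q ^ 2 * \<kappa>)))"

definition delete_pairs :: "complex \<Rightarrow> ('v \<times> 'v \<times> complex) multiset \<Rightarrow> ('v \<times> 'v \<times> complex) multiset" where
  "delete_pairs q A = (A - image_mset (opp_arrow q) A)
     + mset_set {a \<in> set_mset A. opp_arrow q a = a \<and> odd (count A a)}"

definition quiver_mutation :: "complex \<Rightarrow> 'v \<Rightarrow> 'v quiver \<Rightarrow> 'v quiver" where
  "quiver_mutation q k Q = Q\<lparr>arrows :=
     (let A = flip_arrows q k (arrows Q) in delete_pairs q (A + composite_arrows q k A))\<rparr>"


section \<open>Vertex operators on smooth modules\<close>

text \<open>The completed algebra is made concrete by its action on complex vector spaces
  (type \<open>'w\<close> with scalar multiplication \<open>sc\<close>) on which, applied to any given vector, all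
  products of positive modes of sufficiently large total degree vanish.  A formal distribution is
  the family of its coefficients, each an operator.\<close>

definition commutes :: "('w \<Rightarrow> 'w) \<Rightarrow> ('w \<Rightarrow> 'w) \<Rightarrow> bool" where
  "commutes f g \<longleftrightarrow> (\<forall>w. f (g w) = g (f w))"

definition smooth_on :: "'w set \<Rightarrow> 'i set \<Rightarrow> ('i \<Rightarrow> int \<Rightarrow> 'w \<Rightarrow> 'w::zero) \<Rightarrow> bool" where
  "smooth_on S I a \<longleftrightarrow> (\<forall>w\<in>S. \<exists>K. \<forall>l. (\<forall>(i, n)\<in>set l. i \<in> I \<and> 0 < n) \<longrightarrow>
      K < (\<Sum>(i, n)\<leftarrow>l. n) \<longrightarrow> foldr (\<lambda>(i, n). a i n) l w = 0)"

text \<open>\<open>exp_coeff sc a n\<close> is the coefficient of \<open>z\<^sup>n\<close> in \<open>exp (\<Sum>\<^sub>m\<^sub>>\<^sub>0 z\<^sup>m a\<^sub>m)\<close>; \<open>pow_coeff a k n\<close> that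
  in the \<open>k\<close>-th power of the exponent.  \<open>osc_coeff sc a n\<close> is the coefficient of \<open>z\<^sup>n\<close> (\<open>n\<close> any
  integer) in \<open>exp (\<Sum>\<^sub>m\<^sub>>\<^sub>0 z\<^sup>m a\<^sub>-\<^sub>m) exp (\<Sum>\<^sub>m\<^sub>>\<^sub>0 z\<^sup>-\<^sup>m a\<^sub>m)\<close>, a finite sum on each vector of a
  smooth module.\<close>

fun pow_coeff :: "(nat \<Rightarrow> 'w \<Rightarrow> 'w) \<Rightarrow> nat \<Rightarrow> nat \<Rightarrow> 'w \<Rightarrow> 'w::ab_group_add" where
  "pow_coeff a 0 n w = (if n = 0 then w else 0)"
| "pow_coeff a (Suc k) n w = (\<Sum>m=1..n. a m (pow_coeff a k (n - m) w))"

definition exp_coeff ::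
  "(complex \<Rightarrow> 'w \<Rightarrow> 'w) \<Rightarrow> (nat \<Rightarrow> 'w \<Rightarrow> 'w) \<Rightarrow> nat \<Rightarrow> 'w \<Rightarrow> 'w::ab_group_add" where
  "exp_coeff sc a n w = (\<Sum>k\<le>n. sc (1 / fact k) (pow_coeff a k n w))"

definition osc_coeff ::
  "(complex \<Rightarrow> 'w \<Rightarrow> 'w) \<Rightarrow> (int \<Rightarrow> 'w \<Rightarrow> 'w) \<Rightarrow> int \<Rightarrow> 'w \<Rightarrow> 'w::ab_group_add" where
  "osc_coeff sc a n w = Sum_any (\<lambda>k::nat. if 0 \<le> n + int k
      then exp_coeff sc (\<lambda>m. a (- int m)) (nat (n + int k)) (exp_coeff sc (\<lambda>m. a (int m)) k w)
      else 0)"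


section \<open>Chiral seeds\<close>

record ('v, 'w) seed =
  quiv :: "'v quiver"
  zmode :: "'v \<Rightarrow> 'w \<Rightarrow> 'w"
  modes :: "'v \<Rightarrow> int \<Rightarrow> 'w \<Rightarrow> 'w"

text \<open>\<open>zmode \<Sigma> i\<close> and \<open>modes \<Sigma> i n\<close> (\<open>n \<noteq> 0\<close>) make the subspace \<open>S\<close> a smooth module over
  \<open>\<A>\<^sub>Q\<close>, \<open>Q = quiv \<Sigma>\<close>.  Only a subspace, because the fermions used for mutation act on
  a space with more zero modes.\<close>

definition chiral_seed ::
  "(complex \<Rightarrow> 'w \<Rightarrow> 'w) \<Rightarrow> complex \<Rightarrow> 'w set \<Rightarrow> ('v, 'w::ab_group_add) seed \<Rightarrow> bool" where
  "chiral_seed sc q S \<Sigma> \<longleftrightarrow>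
     (let Q = quiv \<Sigma>; I = verts (quiv \<Sigma>); X = zmode \<Sigma>; x = modes \<Sigma> in
      decorated_quiver Q \<and> module.subspace sc S \<and>
      (\<forall>i\<in>I. Vector_Spaces.linear sc sc (X i) \<and> bij_betw (X i) S S) \<and>
      (\<forall>i\<in>I. \<forall>n. n \<noteq> 0 \<longrightarrow> Vector_Spaces.linear sc sc (x i n) \<and> x i n ` S \<subseteq> S) \<and>
      (\<forall>i\<in>I. \<forall>j\<in>I. \<forall>w\<in>S. X i (X j w) = sc (q powi (2 * eps Q i j)) (X j (X i w))) \<and>
      (\<forall>i\<in>I. \<forall>j\<in>I. \<forall>n. \<forall>w\<in>S. n \<noteq> 0 \<longrightarrow> X i (x j n w) = x j n (X i w)) \<and>
      (\<forall>i\<in>I. \<forall>j\<in>I. \<forall>n m. \<forall>w\<in>S. 0 < n \<and> m \<noteq> 0 \<longrightarrow>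
         x i n (x j m w) - x j m (x i n w) = (if n + m = 0 then sc (C_entry q Q n i j / of_int n) w else 0)) \<and>
      (\<forall>i\<in>I. \<forall>j\<in>I. \<forall>n m. \<forall>w\<in>S. n < 0 \<and> m < 0 \<longrightarrow> x i n (x j m w) = x j m (x i n w)) \<and>
      smooth_on S I x)"

text \<open>A list \<open>[(i\<^sub>1, c\<^sub>1), \<dots>]\<close> stands for \<open>:X\<^bsub>i\<^sub>1\<^esub>(c\<^sub>1 z) \<cdots>:\<close> and a list of such lists for their sum;
  in a module over \<open>\<A>\<^sub>Q\<close> the order inside a monomial is immaterial.\<close>

type_synonym 'v monomial = "('v \<times> complex) list"

fun weyl_product ::
  "(complex \<Rightarrow> 'w \<Rightarrow> 'w) \<Rightarrow> complex \<Rightarrow> 'v quiver \<Rightarrow> ('v \<Rightarrow> 'w \<Rightarrow> 'w) \<Rightarrow> 'v list \<Rightarrow> 'w \<Rightarrow> 'w" where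
  "weyl_product sc q Q X [] w = w"
| "weyl_product sc q Q X (i # l) w =
     sc (q powi (- (\<Sum>j\<leftarrow>l. eps Q i j))) (X i (weyl_product sc q Q X l w))"

definition normal_ordered ::
  "(complex \<Rightarrow> 'w \<Rightarrow> 'w) \<Rightarrow> complex \<Rightarrow> ('v, 'w::ab_group_add) seed \<Rightarrow> 'v monomial \<Rightarrow> int \<Rightarrow> 'w \<Rightarrow> 'w" where
  "normal_ordered sc q \<Sigma> l n w =
     weyl_product sc q (quiv \<Sigma>) (zmode \<Sigma>) (map fst l)
       (osc_coeff sc (\<lambda>m u. \<Sum>(i, c)\<leftarrow>l. sc (c powi (-m)) (modes \<Sigma> i m u)) n w)"

definition current ::
  "(complex \<Rightarrow> 'w \<Rightarrow> 'w) \<Rightarrow> complex \<Rightarrow> ('v, 'w::ab_group_add) seed \<Rightarrow> 'v monomial list \<Rightarrow> int \<Rightarrow> 'w \<Rightarrow> 'w" where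
  "current sc q \<Sigma> G n w = (\<Sum>l\<leftarrow>G. normal_ordered sc q \<Sigma> l n w)"

text \<open>Replacing \<open>X\<^sub>i(z)\<close> by \<open>X\<^sub>i(z/\<alpha>)\<close> multiplies \<open>x\<^bsub>i,n\<^esub>\<close> by \<open>\<alpha>\<^sup>n\<close>.\<close>

definition seed_gauge ::
  "(complex \<Rightarrow> 'w \<Rightarrow> 'w) \<Rightarrow> 'v \<Rightarrow> complex \<Rightarrow> ('v, 'w) seed \<Rightarrow> ('v, 'w) seed" where
  "seed_gauge sc i \<alpha> \<Sigma> = \<Sigma>\<lparr>quiv := quiver_gauge i \<alpha> (quiv \<Sigma>),
     modes := (\<lambda>j n w. if j = i then sc (\<alpha> powi n) (modes \<Sigma> j n w) else modes \<Sigma> j n w)\<rparr>"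


section \<open>Fermions\<close>

text \<open>Normal ordering of fermions refers to their realization as vertex operators
  \<open>\<Psi>(z) = E z\<^bsup>J+1/2\<^esup> exp (\<Sum>\<^sub>n\<^sub>>\<^sub>0 z\<^sup>n h\<^sub>-\<^sub>n / n) exp (- \<Sum>\<^sub>n\<^sub>>\<^sub>0 z\<^sup>-\<^sup>n h\<^sub>n / n)\<close>,
  \<open>\<Psi>\<^sup>*(z) = E\<^sup>-\<^sup>1 z\<^bsup>-J+1/2\<^esup> exp (- \<Sum>\<^sub>n\<^sub>>\<^sub>0 z\<^sup>n h\<^sub>-\<^sub>n / n) exp (\<Sum>\<^sub>n\<^sub>>\<^sub>0 z\<^sup>-\<^sup>n h\<^sub>n / n)\<close>,
  with \<open>[h\<^sub>n, h\<^sub>m] = n \<delta>\<^bsub>n+m,0\<^esub>\<close> and \<open>J E = E (J + 1)\<close>.  Here \<open>E = raising F\<close>, \<open>h = fosc F\<close>, and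
  \<open>J\<close> has the eigenvalues \<open>offset F + n\<close> (\<open>n\<close> integer), with eigenprojections \<open>charge F n\<close>.

  The offset is a parameter because fermions in integral powers of \<open>z\<close> are incompatible with
  \<open>\<Psi>'\<^sup>*(z) = \<Psi>(qz) - \<Psi>(q\<^sup>-\<^sup>1z)\<close>: the zero mode of the right-hand side would vanish.  In terms of
  \<open>X\<^sub>k = - q\<^bsup>-2J\<^esup>\<close>: the spectrum of \<open>- X\<^sub>k\<close> has to avoid the odd powers of \<open>q\<close>.
  So fields may have complex exponents, and for \<open>(cz)\<^sup>r\<close> a branch \<open>lg\<close> of the logarithm is fixed that
  is additive on a group \<open>\<Gamma>\<close> of scale factors.\<close>

record 'w fermion =
  raising :: "'w \<Rightarrow> 'w"
  charge :: "int \<Rightarrow> 'w \<Rightarrow> 'w"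
  offset :: complex
  fosc :: "int \<Rightarrow> 'w \<Rightarrow> 'w"

definition log_branch :: "complex set \<Rightarrow> (complex \<Rightarrow> complex) \<Rightarrow> bool" where
  "log_branch \<Gamma> lg \<longleftrightarrow> 1 \<in> \<Gamma> \<and> 0 \<notin> \<Gamma> \<and> (\<forall>a\<in>\<Gamma>. inverse a \<in> \<Gamma> \<and> exp (lg a) = a) \<and>
     (\<forall>a\<in>\<Gamma>. \<forall>b\<in>\<Gamma>. a * b \<in> \<Gamma> \<and> lg (a * b) = lg a + lg b)"

definition cpow :: "(complex \<Rightarrow> complex) \<Rightarrow> complex \<Rightarrow> complex \<Rightarrow> complex" where
  "cpow lg c r = exp (r * lg c)"

definition raising_power :: "'w fermion \<Rightarrow> int \<Rightarrow> 'w \<Rightarrow> 'w" where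
  "raising_power F m = (if 0 \<le> m then raising F ^^ nat m else inv (raising F) ^^ nat (- m))"

text \<open>\<open>nord_zero sc lg F A B r\<close> is the coefficient of \<open>z\<^sup>r\<close> in the zero mode factor of
  \<open>:\<Prod>\<^sub>a\<^sub>\<in>\<^sub>A \<Psi>(az) \<Prod>\<^sub>b\<^sub>\<in>\<^sub>B \<Psi>\<^sup>*(bz):\<close>, which in the symmetric ordering used for zero modes is
  \<open>E\<^sup>m (\<Prod>A / \<Prod>B)\<^bsup>J+m/2\<^esup> z\<^bsup>m(J+m/2)\<^esup>\<close>, \<open>m = |A| - |B|\<close>.  \<open>nord_modes\<close> are its oscillators:
  the exponentials in this product are \<open>exp (\<Sum>\<^sub>n\<^sub>>\<^sub>0 z\<^sup>n a\<^sub>-\<^sub>n) exp (\<Sum>\<^sub>n\<^sub>>\<^sub>0 z\<^sup>-\<^sup>n a\<^sub>n)\<close>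
  with \<open>a\<^sub>n = nord_modes sc F A B n\<close>.\<close>

definition nord_zero ::
  "(complex \<Rightarrow> 'w \<Rightarrow> 'w) \<Rightarrow> (complex \<Rightarrow> complex) \<Rightarrow> 'w fermion \<Rightarrow> complex multiset \<Rightarrow> complex multiset
    \<Rightarrow> complex \<Rightarrow> 'w \<Rightarrow> 'w::ab_group_add" where
  "nord_zero sc lg F A B r w =
     (let m = int (size A) - int (size B) in
      Sum_any (\<lambda>n::int. let e = offset F + of_int n + of_int m / 2 in
        if r = of_int m * e
        then sc (cpow lg (prod_mset A / prod_mset B) e) (raising_power F m (charge F n w)) else 0))"

definition nord_modes ::
  "(complex \<Rightarrow> 'w \<Rightarrow> 'w) \<Rightarrow> 'w fermion \<Rightarrow> complex multiset \<Rightarrow> complex multiset \<Rightarrow> int \<Rightarrow> 'w \<Rightarrow> 'w" where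
  "nord_modes sc F A B n w =
     sc (- (((\<Sum>c\<in>#A. c powi (-n)) - (\<Sum>c\<in>#B. c powi (-n))) / of_int n)) (fosc F n w)"

definition nord_field ::
  "(complex \<Rightarrow> 'w \<Rightarrow> 'w) \<Rightarrow> (complex \<Rightarrow> complex) \<Rightarrow> 'w fermion \<Rightarrow> complex multiset \<Rightarrow> complex multiset
    \<Rightarrow> complex \<Rightarrow> 'w \<Rightarrow> 'w::ab_group_add" where
  "nord_field sc lg F A B r w = Sum_any (\<lambda>n::int.
     nord_zero sc lg F A B (r - of_int n) (osc_coeff sc (nord_modes sc F A B) n w))"

definition psi ::
  "(complex \<Rightarrow> 'w \<Rightarrow> 'w) \<Rightarrow> (complex \<Rightarrow> complex) \<Rightarrow> 'w fermion \<Rightarrow> complex \<Rightarrow> 'w \<Rightarrow> 'w::ab_group_add" where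
  "psi sc lg F = nord_field sc lg F {#1#} {#}"

definition psi_star ::
  "(complex \<Rightarrow> 'w \<Rightarrow> 'w) \<Rightarrow> (complex \<Rightarrow> complex) \<Rightarrow> 'w fermion \<Rightarrow> complex \<Rightarrow> 'w \<Rightarrow> 'w::ab_group_add" where
  "psi_star sc lg F = nord_field sc lg F {#} {#1#}"

text \<open>The last three lines are \<open>{\<Psi>(z), \<Psi>(w)} = {\<Psi>\<^sup>*(z), \<Psi>\<^sup>*(w)} = 0\<close> and
  \<open>{\<Psi>(z), \<Psi>\<^sup>*(w)} = \<delta>(z/w)\<close> in modes, where the sum in \<open>\<delta>\<close> runs over the exponents occurring
  in \<open>\<Psi>\<close>.\<close>

definition fermions ::
  "(complex \<Rightarrow> 'w \<Rightarrow> 'w) \<Rightarrow> (complex \<Rightarrow> complex) \<Rightarrow> 'w::ab_group_add fermion \<Rightarrow> bool" where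
  "fermions sc lg F \<longleftrightarrow>
     Vector_Spaces.linear sc sc (raising F) \<and> bij (raising F) \<and>
     (\<forall>n. Vector_Spaces.linear sc sc (charge F n)) \<and>
     (\<forall>n m w. charge F n (charge F m w) = (if n = m then charge F m w else 0)) \<and>
     (\<forall>w. finite {n. charge F n w \<noteq> 0} \<and> Sum_any (\<lambda>n. charge F n w) = w) \<and>
     (\<forall>n w. raising F (charge F n w) = charge F (n + 1) (raising F w)) \<and>
     (\<forall>n. n \<noteq> 0 \<longrightarrow> Vector_Spaces.linear sc sc (fosc F n) \<and> commutes (fosc F n) (raising F) \<and>
        (\<forall>m. commutes (fosc F n) (charge F m))) \<and>
     (\<forall>n m w. n \<noteq> 0 \<and> m \<noteq> 0 \<longrightarrow>
        fosc F n (fosc F m w) - fosc F m (fosc F n w) = (if n + m = 0 then sc (of_int n) w else 0)) \<and>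
     smooth_on UNIV {()} (\<lambda>_. fosc F) \<and>
     (\<forall>r t w. psi sc lg F r (psi sc lg F t w) + psi sc lg F t (psi sc lg F r w) = 0) \<and>
     (\<forall>r t w. psi_star sc lg F r (psi_star sc lg F t w) + psi_star sc lg F t (psi_star sc lg F r w) = 0) \<and>
     (\<forall>r t w. psi sc lg F r (psi_star sc lg F t w) + psi_star sc lg F t (psi sc lg F r w) =
        (if r + t = 0 \<and> r - (offset F + 1 / 2) \<in> \<int> then w else 0))"

definition commutes_with_fermions :: "'w fermion \<Rightarrow> ('w \<Rightarrow> 'w) \<Rightarrow> bool" where
  "commutes_with_fermions F f \<longleftrightarrow> commutes f (raising F) \<and> (\<forall>n. commutes f (charge F n)) \<and>
     (\<forall>n. n \<noteq> 0 \<longrightarrow> commutes f (fosc F n))"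


section \<open>Mutation of seeds\<close>

text \<open>\<open>field_times Y V\<close> is the product \<open>Y(z) V(z)\<close>.\<close>

definition field_times :: "(complex \<Rightarrow> 'w \<Rightarrow> 'w) \<Rightarrow> (complex \<Rightarrow> 'w \<Rightarrow> 'w) \<Rightarrow> complex \<Rightarrow> 'w \<Rightarrow> 'w::ab_group_add" where
  "field_times Y V r w = Sum_any (\<lambda>t. Y t (V (r - t) w))"

text \<open>\<open>vertex_eq S X x Z a\<close>: on \<open>S\<close>, the vertex operators with zero mode \<open>X\<close> and oscillators \<open>x\<close>,
  respectively with zero mode factor \<open>Z(z)\<close> and oscillators \<open>a\<close>, coincide.\<close>

definition vertex_eq ::
  "'w set \<Rightarrow> ('w \<Rightarrow> 'w) \<Rightarrow> (int \<Rightarrow> 'w \<Rightarrow> 'w) \<Rightarrow> (complex \<Rightarrow> 'w \<Rightarrow> 'w) \<Rightarrow> (int \<Rightarrow> 'w \<Rightarrow> 'w::zero) \<Rightarrow> bool" where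
  "vertex_eq S X x Z a \<longleftrightarrow>
     (\<forall>w\<in>S. (\<forall>r. Z r w = (if r = 0 then X w else 0)) \<and> (\<forall>n. n \<noteq> 0 \<longrightarrow> x n w = a n w))"

text \<open>\<open>\<Sigma>'\<close> is obtained from \<open>\<Sigma>\<close> by mutation at \<open>k\<close>, by means of fermions \<open>F\<close> (giving \<open>\<Psi>\<close>,
  \<open>\<Psi>\<^sup>*\<close>), \<open>F'\<close> (giving the new fermions) and the vertex operators
  \<open>V\<^sub>i(z) = V0\<^sub>i(z) exp (\<Sum>\<^sub>n\<^sub>>\<^sub>0 z\<^sup>n v\<^bsub>i,-n\<^esub>) exp (\<Sum>\<^sub>n\<^sub>>\<^sub>0 z\<^sup>-\<^sup>n v\<^bsub>i,n\<^esub>)\<close>.  The zero mode factor of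
  \<open>V\<^sub>i\<close> depends on \<open>z\<close>: on \<open>S\<close> it has to cancel the power of \<open>z\<close> coming from the
  fermions, while it commutes with them on the whole space.\<close>

definition seed_mutation ::
  "(complex \<Rightarrow> 'w \<Rightarrow> 'w) \<Rightarrow> complex \<Rightarrow> 'w set \<Rightarrow> 'v \<Rightarrow> ('v, 'w::ab_group_add) seed \<Rightarrow> ('v, 'w) seed \<Rightarrow> bool" where
  "seed_mutation sc q S k \<Sigma> \<Sigma>' \<longleftrightarrow>
     quiv \<Sigma>' = quiver_mutation q k (quiv \<Sigma>) \<and>
     (\<forall>i\<in>verts (quiv \<Sigma>). zmode \<Sigma>' i ` S \<subseteq> S \<and> (\<forall>n. n \<noteq> 0 \<longrightarrow> modes \<Sigma>' i n ` S \<subseteq> S)) \<and>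
     (\<exists>\<Gamma> lg F F' V0 v.
        log_branch \<Gamma> lg \<and> q \<in> \<Gamma> \<and> (\<forall>(i, j, \<kappa>)\<in>#arrows (quiv \<Sigma>). \<kappa> \<in> \<Gamma>) \<and>
        fermions sc lg F \<and> fermions sc lg F' \<and>
        (\<forall>r w. psi_star sc lg F' r w =
           sc (cpow lg q r) (psi sc lg F r w) - sc (cpow lg (inverse q) r) (psi sc lg F r w)) \<and>
        (\<forall>r w. psi_star sc lg F r w =
           sc (cpow lg (inverse q) r) (psi sc lg F' r w) - sc (cpow lg q r) (psi sc lg F' r w)) \<and>
        (\<forall>i\<in>verts (quiv \<Sigma>) - {k}.
           (\<forall>r. Vector_Spaces.linear sc sc (V0 i r) \<and>
              commutes_with_fermions F (V0 i r) \<and> commutes_with_fermions F' (V0 i r)) \<and>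
           (\<forall>w. finite {r. V0 i r w \<noteq> 0}) \<and>
           (\<forall>n. n \<noteq> 0 \<longrightarrow> Vector_Spaces.linear sc sc (v i n) \<and>
              commutes_with_fermions F (v i n) \<and> commutes_with_fermions F' (v i n))) \<and>
        smooth_on UNIV (verts (quiv \<Sigma>) - {k}) v \<and>
        vertex_eq S (zmode \<Sigma> k) (modes \<Sigma> k)
          (\<lambda>r w. - nord_zero sc lg F {#inverse q#} {#q#} r w) (nord_modes sc F {#inverse q#} {#q#}) \<and>
        vertex_eq S (zmode \<Sigma>' k) (modes \<Sigma>' k)
          (\<lambda>r w. - nord_zero sc lg F' {#inverse q#} {#q#} r w) (nord_modes sc F' {#inverse q#} {#q#}) \<and>
        (\<forall>i\<in>verts (quiv \<Sigma>) - {k}.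
           (let K = labels (quiv \<Sigma>) i k; L = labels (quiv \<Sigma>) k i;
                A = image_mset (\<lambda>\<kappa>. q * \<kappa>) K; B = image_mset (\<lambda>\<kappa>. inverse q * inverse \<kappa>) L;
                A' = image_mset inverse L; B' = K in
            vertex_eq S (zmode \<Sigma> i) (modes \<Sigma> i)
              (field_times (nord_zero sc lg F A B) (V0 i))
              (\<lambda>n w. nord_modes sc F A B n w + v i n w) \<and>
            vertex_eq S (zmode \<Sigma>' i) (modes \<Sigma>' i)
              (field_times (\<lambda>r w. sc ((- 1) ^ size L) (nord_zero sc lg F' A' B' r w)) (V0 i))
              (\<lambda>n w. nord_modes sc F' A' B' n w + v i n w))))"


section \<open>The quivers and the currents\<close>

definition sub_quiver :: "complex \<Rightarrow> complex \<Rightarrow> complex \<Rightarrow> nat \<Rightarrow> nat \<Rightarrow> nat quiver" where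
  "sub_quiver q q1 q3 N M =
     \<lparr>verts = {0..N+1},
      kind = (\<lambda>i. if i = 0 then Frozen_minus else if i = N+1 then Frozen_plus else Unfrozen),
      arrows = mset
       (if M = 0 then
          map (\<lambda>i. (i, i+1, 1)) [1..<N] @ map (\<lambda>i. (i+1, i, q3)) [1..<N] @
          map (\<lambda>i. (i, i, q1)) [2..<N+1] @
          [(1, 0, q1), (N+1, 1, 1)] @
          map (\<lambda>t. (0, N+1, q3 powi (1 - int t))) [0..<N-1]
        else if M < N then
          map (\<lambda>i. (i, i, q1)) ([1..<M] @ [M+2..<N+1]) @
          map (\<lambda>i. (i, i+1, 1)) ([1..<M] @ [M+1..<N]) @
          map (\<lambda>i. (i+1, i, q3)) ([1..<M] @ [M+1..<N]) @
          [(M, M+1, 1), (M+1, M, q1), (0, M, q3 powi (1 - int M)),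
           (M+1, 0, q powi (-2) * q3 powi (int M - 1)), (M, N+1, q3), (N+1, M+1, 1)] @
          map (\<lambda>t. (0, N+1, q3 powi (1 - int M - int t))) [0..<N-M-1]
        else
          map (\<lambda>i. (i, i, q1)) [1..<N] @
          map (\<lambda>i. (i, i+1, 1)) [1..<N] @ map (\<lambda>i. (i+1, i, q3)) [1..<N] @
          [(0, N, q3 powi (1 - int N)), (N, N+1, q3), (N+1, 0, q powi (-2) * q3 powi (int N - 2))])\<rparr>"

text \<open>\<open>one_plus q3 A G\<close> is \<open>(1 + A T) G\<close>, where moving \<open>T\<close> to the right through \<open>G\<close> replaces \<open>z\<close>
  by \<open>q\<^sub>3 z\<close>.\<close>

definition one_plus :: "complex \<Rightarrow> 'v monomial \<Rightarrow> 'v monomial list \<Rightarrow> 'v monomial list" where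
  "one_plus q3 A G = G @ map (\<lambda>l. A @ map (\<lambda>(i, c). (i, q3 * c)) l) G"

definition G_plus :: "complex \<Rightarrow> nat \<Rightarrow> nat \<Rightarrow> nat monomial list" where
  "G_plus q3 N M = map (\<lambda>l. (N+1, 1) # l)
     (foldr (\<lambda>j. one_plus q3 (map (\<lambda>i. (i, 1)) [M+1..<j+1])) (rev [M+1..<N+1]) [[]])"

definition G_minus :: "complex \<Rightarrow> nat \<Rightarrow> nat monomial list" where
  "G_minus q3 M = map (\<lambda>l. (0, 1) # l)
     (foldr (\<lambda>j. one_plus q3 (map (\<lambda>i. (i, q3 powi (1 - int i))) [j..<M+1])) [1..<M+1] [[]])"

end

(*
  Quivers.  The arrows at the mutated vertex k and the composite arrows created by the mutation
  are matched with the arrows of the neighbouring quiver; what is left over consists of opposite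
  pairs, which the mutation deletes.

  Currents.  After bosonization every normally ordered monomial in the X_i(z) is a normally
  ordered product of fermions times a part coming from the V_i, and this second part, with all
  phases, depends only on the factors at vertices other than k.  It is the same for the old and
  for the new fermions, because the two charges are opposite on the seed space.  In each monomial
  of a current the fermions telescope to a single one, and the monomials that can be multiplied by
  X_k pair up with their multiples.  The sum of a pair is Psi(q c z) - Psi(q^-1 c z), or
  - (Psi~(q c z) - Psi~(q^-1 c z)) for the new fermions, hence by the transformation of the
  fermions a single monomial Psi~*(c z), or Psi*(c z), on the other side of the mutation.
*)

theory Submission
  imports Defs
begin

section \<open>Quiver mutation\<close>

text \<open>Parts (1) and (2) are treated together: with \<open>k\<close> the mutated vertex, both
  concern the quivers with indices \<open>k\<close> and \<open>k - 1\<close>, and q^2 q1 q3 = 1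
  makes the gauging constants q q3 and q q1 inverse to each other. The constant q q3 is forced by
  the arrow from \<open>k\<close> to \<open>N + 1\<close>: its label q3 flips to 1/(q q3), where the
  other quiver has 1.

  The obstacle for the currents is that the fermions act on a space that may be larger than the seed
  space \<open>S\<close> and need not preserve it. So operator identities are reduced to vectors of
  \<open>S\<close> of a single charge J, on which the fermionic zero modes are explicit. This
  requires that charge components of vectors of \<open>S\<close> stay in \<open>S\<close>, which
  holds because X_k acts on them with distinct eigenvalues (q is no root of unity), and that the new
  charge is minus the old one, which is read off from a vertex \<open>i\<close> with nonzero
  \<open>eps\<close> between \<open>i\<close> and \<open>k\<close>. The ordering phases agree before
  and after because the change of \<open>eps\<close> under mutation compensates the powers of q by
  which the arguments of old and new fermions differ.\<close>

lemma opp_arrow_opp_arrow [simp]: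
  assumes "q \<noteq> 0"
  shows "opp_arrow q (opp_arrow q a) = a"
  using assms by (cases a) (simp add: opp_arrow_def field_simps)

lemma count_image_opp_arrow:
  assumes "q \<noteq> 0"
  shows "count (image_mset (opp_arrow q) A) a = count A (opp_arrow q a)"
proof -
  have "opp_arrow q x = a \<longleftrightarrow> x = opp_arrow q a" for x
    using assms opp_arrow_opp_arrow[of q] by force
  then have "opp_arrow q -` {a} = {opp_arrow q a}"
    by auto
  then show ?thesis
    by (cases "opp_arrow q a \<in># A") (auto simp: count_image_mset not_in_iff)
qed

lemma count_delete_pairs:
  assumes "q \<noteq> 0"
  shows "count (delete_pairs q A) a =
    count A a - count A (opp_arrow q a) + of_bool (opp_arrow q a = a \<and> odd (count A a))"
proof -
  have "a \<in># A" if "odd (count A a)"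
    using that by (metis even_zero not_in_iff)
  moreover have "finite {a \<in> set_mset A. opp_arrow q a = a \<and> odd (count A a)}"
    by simp
  ultimately show ?thesis
    by (auto simp: delete_pairs_def count_image_opp_arrow assms)
qed

text \<open>The counts of an arrow and of its opposite grow by the same number, so their truncated
  difference is unchanged; the count of a self-opposite loop grows by an even number, so its parity
  is unchanged too. Hence opposite pairs can be added or dropped at will under
  \<open>delete_pairs\<close>.\<close>

lemma delete_pairs_add_opposites:
  assumes "q \<noteq> 0"
  shows "delete_pairs q (A + (P + image_mset (opp_arrow q) P)) = delete_pairs q A"
  by (rule multiset_eqI) (auto simp: count_delete_pairs count_image_opp_arrow assms)

text \<open>This also rules out a single self-opposite loop, which is its own partner.\<close>

definition reduced_arrows :: "complex \<Rightarrow> ('v \<times> 'v \<times> complex) multiset \<Rightarrow> bool" where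
  "reduced_arrows q A \<longleftrightarrow> (\<forall>a\<in>#A. opp_arrow q a \<notin># A)"

lemma delete_pairs_reduced:
  assumes "q \<noteq> 0" "reduced_arrows q A"
  shows "delete_pairs q A = A"
proof (rule multiset_eqI)
  fix a
  show "count (delete_pairs q A) a = count A a"
    using assms by (cases "a \<in># A") (auto simp: count_delete_pairs reduced_arrows_def not_in_iff)
qed

lemma delete_pairs_reduced_add:
  assumes "q \<noteq> 0" "reduced_arrows q A"
  shows "delete_pairs q (A + (P + image_mset (opp_arrow q) P)) = A"
  using assms by (simp add: delete_pairs_add_opposites delete_pairs_reduced)

definition gauge_arrow :: "'v \<Rightarrow> complex \<Rightarrow> 'v \<times> 'v \<times> complex \<Rightarrow> 'v \<times> 'v \<times> complex" where
  "gauge_arrow i \<alpha> = (\<lambda>(s, t, \<kappa>).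
     (s, t, \<kappa> * (if t = i then \<alpha> else 1) * (if s = i then inverse \<alpha> else 1)))"

lemma gauge_arrow_simps [simp]:
  "fst (gauge_arrow i \<alpha> a) = fst a" "fst (snd (gauge_arrow i \<alpha> a)) = fst (snd a)"
  by (cases a; simp add: gauge_arrow_def)+

lemma quiver_gauge_eq: "quiver_gauge i \<alpha> Q = Q\<lparr>arrows := image_mset (gauge_arrow i \<alpha>) (arrows Q)\<rparr>"
  by (simp add: quiver_gauge_def gauge_arrow_def)

lemma gauge_arrow_opp_arrow:
  "gauge_arrow i \<alpha> (opp_arrow q a) = opp_arrow q (gauge_arrow i \<alpha> a)"
  by (cases a) (auto simp: gauge_arrow_def opp_arrow_def)

lemma gauge_arrow_inverse:
  assumes "\<alpha> \<noteq> 0"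
  shows "gauge_arrow i \<alpha> (gauge_arrow i (inverse \<alpha>) a) = a"
    "gauge_arrow i (inverse \<alpha>) (gauge_arrow i \<alpha> a) = a"
  using assms by (cases a; simp add: gauge_arrow_def)+

lemma image_gauge_arrow_inverse:
  assumes "\<alpha> \<noteq> 0"
  shows "image_mset (gauge_arrow i \<alpha>) (image_mset (gauge_arrow i (inverse \<alpha>)) A) = A"
  using assms by (simp add: multiset.map_comp o_def gauge_arrow_inverse)

lemma reduced_image_gauge_arrow:
  assumes "\<alpha> \<noteq> 0" "reduced_arrows q A"
  shows "reduced_arrows q (image_mset (gauge_arrow i \<alpha>) A)"
  unfolding reduced_arrows_def
proof
  fix a assume "a \<in># image_mset (gauge_arrow i \<alpha>) A"
  then obtain b where b: "b \<in># A" "a = gauge_arrow i \<alpha> b" by auto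
  show "opp_arrow q a \<notin># image_mset (gauge_arrow i \<alpha>) A"
  proof
    assume "opp_arrow q a \<in># image_mset (gauge_arrow i \<alpha>) A"
    then obtain c where c: "c \<in># A" "gauge_arrow i \<alpha> (opp_arrow q b) = gauge_arrow i \<alpha> c"
      by (auto simp: b gauge_arrow_opp_arrow)
    then have "opp_arrow q b = c"
      using gauge_arrow_inverse(2)[OF assms(1)] by metis
    then show False
      using assms b c by (auto simp: reduced_arrows_def)
  qed
qed

section \<open>Splitting off the arrows at a vertex, and mutation as an involution up to
  gauging\<close>

definition touching :: "'v \<Rightarrow> ('v \<times> 'v \<times> complex) multiset \<Rightarrow> bool" where
  "touching k A \<longleftrightarrow> (\<forall>(s, t, \<kappa>)\<in>#A. (s = k) \<noteq> (t = k))"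

definition avoiding :: "'v \<Rightarrow> ('v \<times> 'v \<times> complex) multiset \<Rightarrow> bool" where
  "avoiding k A \<longleftrightarrow> (\<forall>(s, t, \<kappa>)\<in>#A. s \<noteq> k \<and> t \<noteq> k)"

lemma touchingD:
  assumes "touching k A"
  shows "(s, k, \<kappa>) \<in># A \<Longrightarrow> s \<noteq> k" "(k, t, \<kappa>) \<in># A \<Longrightarrow> t \<noteq> k"
  using assms by (auto simp: touching_def)

lemma avoiding_union [simp]: "avoiding k (A + B) \<longleftrightarrow> avoiding k A \<and> avoiding k B"
  unfolding avoiding_def set_mset_union by blast

lemma flip_arrows_union [simp]: "flip_arrows q k (A + B) = flip_arrows q k A + flip_arrows q k B"
  by (simp add: flip_arrows_def)

lemma flip_arrows_avoiding [simp]: "avoiding k A \<Longrightarrow> flip_arrows q k A = A"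
proof -
  assume "avoiding k A"
  then have "flip_arrows q k A = image_mset (\<lambda>a. a) A"
    unfolding flip_arrows_def by (intro image_mset_cong) (auto simp: avoiding_def)
  then show ?thesis by simp
qed

lemma gauge_avoiding [simp]: "avoiding k A \<Longrightarrow> image_mset (gauge_arrow k \<alpha>) A = A"
proof -
  assume "avoiding k A"
  then have "image_mset (gauge_arrow k \<alpha>) A = image_mset (\<lambda>a. a) A"
    by (intro image_mset_cong) (auto simp: avoiding_def gauge_arrow_def)
  then show ?thesis by simp
qed

lemma flip_flip_arrows:
  assumes "q \<noteq> 0"
  shows "flip_arrows q k (flip_arrows q k A) = A"
proof -
  have "flip_arrows q k (flip_arrows q k A) = image_mset (\<lambda>a. a) A"
    unfolding flip_arrows_def multiset.map_comp o_def
    using assms by (intro image_mset_cong) (auto simp: field_simps)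
  then show ?thesis by simp
qed

lemma flip_gauge_arrows:
  assumes "touching k A" "\<alpha> \<noteq> 0"
  shows "flip_arrows q k (image_mset (gauge_arrow k \<alpha>) A) = image_mset (gauge_arrow k \<alpha>) (flip_arrows q k A)"
  unfolding flip_arrows_def multiset.map_comp o_def
  using assms by (intro image_mset_cong) (auto simp: gauge_arrow_def touching_def)

lemma composite_arrows_altdef:
  "composite_arrows q k A = (\<Sum>a\<in>#filter_mset (\<lambda>a. fst (snd a) = k) A.
     image_mset (\<lambda>b. (fst (snd b), fst a, inverse (q ^ 2 * snd (snd a) * snd (snd b))))
       (filter_mset (\<lambda>b. fst b = k) A))"
  by (simp add: composite_arrows_def case_prod_unfold)

lemma composite_arrows_union_avoiding:
  assumes "avoiding k B"
  shows "composite_arrows q k (A + B) = composite_arrows q k A"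
proof -
  have "filter_mset (\<lambda>a. fst (snd a) = k) B = {#}" "filter_mset (\<lambda>b. fst b = k) B = {#}"
    using assms unfolding avoiding_def by (auto simp: filter_mset_eq_conv)
  then show ?thesis
    unfolding composite_arrows_altdef filter_union_mset by (simp only: add_0_right)
qed

text \<open>The factor \<alpha> of an incoming arrow cancels the factor 1/\<alpha> of an outgoing
  one in the product of their labels.\<close>

lemma composite_gauge_arrows:
  assumes "touching k A" "\<alpha> \<noteq> 0"
  shows "composite_arrows q k (image_mset (gauge_arrow k \<alpha>) A) = composite_arrows q k A"
  unfolding composite_arrows_altdef filter_mset_image_mset multiset.map_comp o_def gauge_arrow_simps
  by (rule arg_cong[where f = sum_mset], rule image_mset_cong, rule image_mset_cong)
    (use assms(2) touchingD[OF assms(1)] in \<open>auto simp: gauge_arrow_def\<close>)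

lemma image_mset_sum_mset_image:
  "image_mset f (\<Sum>x\<in>#A. g x) = (\<Sum>x\<in>#A. image_mset f (g x))"
  by (induction A) auto

lemma sum_mset_image_swap:
  "(\<Sum>x\<in>#A. image_mset (h x) B) = (\<Sum>y\<in>#B. image_mset (\<lambda>x. h x y) A)"
proof (induction A)
  case (add x A)
  have "(\<Sum>y\<in>#B. image_mset (\<lambda>x. h x y) (add_mset x A)) = (\<Sum>y\<in>#B. {#h x y#} + image_mset (\<lambda>x. h x y) A)"
    by simp
  also have "\<dots> = image_mset (h x) B + (\<Sum>y\<in>#B. image_mset (\<lambda>x. h x y) A)"
    by (simp only: sum_mset.distrib) simp
  finally show ?case using add by simp
qed simp

text \<open>Flipping exchanges incoming and outgoing arrows and turns a label x into 1/(q x). A path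
  through \<open>k\<close> with labels x, y gives a composite with label 1/(q^2 x y) before the flip
  and, in the other direction, one with label x y after it. These two are opposite arrows, which is
  why mutating twice returns to the start up to deleted pairs.\<close>

lemma composite_flip_arrows:
  assumes "touching k A" "q \<noteq> 0"
  shows "composite_arrows q k A = image_mset (opp_arrow q) (composite_arrows q k (flip_arrows q k A))"
proof -
  let ?f = "\<lambda>(s, t, \<kappa>). if s = k \<or> t = k then (t, s, inverse (q * \<kappa>)) else (s, t, \<kappa>)"
  let ?I = "filter_mset (\<lambda>a. fst (snd a) = k) A" and ?O = "filter_mset (\<lambda>b. fst b = k) A"
  have I: "filter_mset (\<lambda>a. fst (snd a) = k) (image_mset ?f A) = image_mset ?f ?O"
    and O: "filter_mset (\<lambda>b. fst b = k) (image_mset ?f A) = image_mset ?f ?I"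
    unfolding filter_mset_image_mset
    by (rule arg_cong[where f = "image_mset _"], rule filter_mset_cong; auto split: if_splits)+
  have "composite_arrows q k A =
      (\<Sum>b\<in>#?O. image_mset (\<lambda>a. (fst (snd b), fst a, inverse (q ^ 2 * snd (snd a) * snd (snd b)))) ?I)"
    unfolding composite_arrows_altdef by (rule sum_mset_image_swap)
  also have "\<dots> = image_mset (opp_arrow q) (composite_arrows q k (flip_arrows q k A))"
    unfolding composite_arrows_altdef image_mset_sum_mset_image flip_arrows_def I O multiset.map_comp o_def
    by (rule arg_cong[where f = sum_mset], rule image_mset_cong, rule image_mset_cong)
      (use assms in \<open>auto simp: opp_arrow_def field_simps power2_eq_square\<close>)
  finally show ?thesis .
qed

text \<open>One matching of arrows proves a mutation and its inverse: \<open>P\<close> and its opposite are the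
  pairs deleted after mutating the first quiver.\<close>

lemma mutation_pair:
  assumes "q \<noteq> 0" "\<alpha> \<noteq> 0"
    and touch: "touching k A\<^sub>k" "touching k T\<^sub>k" and avoid: "avoiding k A" "avoiding k T"
    and flip: "flip_arrows q k A\<^sub>k = image_mset (gauge_arrow k (inverse \<alpha>)) T\<^sub>k"
    and comp: "A + composite_arrows q k (flip_arrows q k A\<^sub>k) = T + (P + image_mset (opp_arrow q) P)"
    and red: "reduced_arrows q (A\<^sub>k + A)" "reduced_arrows q (T\<^sub>k + T)"
    and arr: "arrows Q = A\<^sub>k + A" "arrows R = T\<^sub>k + T"
  shows "arrows (quiver_gauge k \<alpha> (quiver_mutation q k Q)) = arrows R"
    and "arrows (quiver_gauge k (inverse \<alpha>) (quiver_mutation q k R)) = arrows Q"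
proof -
  let ?C = "composite_arrows q k (flip_arrows q k A\<^sub>k)" and ?g = "\<lambda>\<alpha>. image_mset (gauge_arrow k \<alpha>)"
  have \<alpha>': "inverse \<alpha> \<noteq> 0" using assms by simp
  have "flip_arrows q k (arrows Q) + composite_arrows q k (flip_arrows q k (arrows Q))
      = ?g (inverse \<alpha>) T\<^sub>k + (A + ?C)"
    using avoid by (simp add: arr composite_arrows_union_avoiding flip)
  also have "\<dots> = ?g (inverse \<alpha>) (T\<^sub>k + T) + (P + image_mset (opp_arrow q) P)"
    using avoid by (simp add: comp)
  finally have "delete_pairs q (flip_arrows q k (arrows Q) + composite_arrows q k (flip_arrows q k (arrows Q)))
      = ?g (inverse \<alpha>) (T\<^sub>k + T)"
    by (simp only: delete_pairs_reduced_add[OF \<open>q \<noteq> 0\<close> reduced_image_gauge_arrow[OF \<alpha>' red(2)]])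
  then show "arrows (quiver_gauge k \<alpha> (quiver_mutation q k Q)) = arrows R"
    using \<open>\<alpha> \<noteq> 0\<close> by (simp add: quiver_gauge_eq quiver_mutation_def Let_def arr(2) image_gauge_arrow_inverse
       multiset.map_comp o_def gauge_arrow_inverse)
  have T: "T\<^sub>k = ?g \<alpha> (flip_arrows q k A\<^sub>k)"
    using \<open>\<alpha> \<noteq> 0\<close> by (simp add: flip image_gauge_arrow_inverse)
  have tf: "touching k (flip_arrows q k A\<^sub>k)"
    using touch(1) by (auto simp: touching_def flip_arrows_def)
  have fT: "flip_arrows q k T\<^sub>k = ?g \<alpha> A\<^sub>k"
    unfolding T flip_gauge_arrows[OF tf \<open>\<alpha> \<noteq> 0\<close>] flip_flip_arrows[OF \<open>q \<noteq> 0\<close>] ..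
  have cT: "composite_arrows q k (?g \<alpha> A\<^sub>k) = image_mset (opp_arrow q) ?C"
    unfolding composite_gauge_arrows[OF touch(1) \<open>\<alpha> \<noteq> 0\<close>] by (rule composite_flip_arrows[OF touch(1) \<open>q \<noteq> 0\<close>])
  \<comment> \<open>The pairs \<open>P\<close> are put back on purpose: together with
    \<open>T\<close> they form the right-hand side of \<open>comp\<close>, so the composites of the
    first mutation reappear and cancel against those of the second, which are their
    opposites.\<close>
  have "delete_pairs q (flip_arrows q k (arrows R) + composite_arrows q k (flip_arrows q k (arrows R)))
      = delete_pairs q ((?g \<alpha> A\<^sub>k + T + image_mset (opp_arrow q) ?C) + (P + image_mset (opp_arrow q) P))"
    using avoid \<open>q \<noteq> 0\<close>
    by (subst delete_pairs_add_opposites) (simp_all add: arr composite_arrows_union_avoiding fT cT)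
  also have "?g \<alpha> A\<^sub>k + T + image_mset (opp_arrow q) ?C + (P + image_mset (opp_arrow q) P)
      = ?g \<alpha> A\<^sub>k + image_mset (opp_arrow q) ?C + (T + (P + image_mset (opp_arrow q) P))"
    by (simp only: ac_simps)
  also have "\<dots> = ?g \<alpha> (A\<^sub>k + A) + (?C + image_mset (opp_arrow q) ?C)"
    unfolding comp[symmetric] using avoid by (simp add: ac_simps)
  also have "delete_pairs q \<dots> = ?g \<alpha> (A\<^sub>k + A)"
    by (rule delete_pairs_reduced_add[OF \<open>q \<noteq> 0\<close> reduced_image_gauge_arrow[OF \<open>\<alpha> \<noteq> 0\<close> red(1)]])
  finally show "arrows (quiver_gauge k (inverse \<alpha>) (quiver_mutation q k R)) = arrows Q"
    using image_gauge_arrow_inverse[OF \<alpha>', of k "A\<^sub>k + A"]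
    by (simp add: quiver_gauge_eq quiver_mutation_def Let_def arr(1))
qed

text \<open>Here \<open>k\<close> is the mutated vertex. The prefix \<open>down\<close> refers to
  the quiver with index \<open>k\<close>, whose index the mutation lowers, and \<open>up\<close> to
  the quiver with index \<open>k - 1\<close>, whose index it raises. The conditional entries let one
  formula cover the ends of the chain.\<close>

definition down_local :: "complex \<Rightarrow> complex \<Rightarrow> nat \<Rightarrow> nat \<Rightarrow> (nat \<times> nat \<times> complex) multiset" where
  "down_local q1 q3 N k =
     mset ((if 1 < k then [(k-1, k, 1), (k, k-1, q3)] else []) @
           (if k < N then [(k, k+1, 1), (k+1, k, q1)] else []) @
           [(0, k, q3 powi (1 - int k)), (k, N+1, q3)])"

definition up_local :: "complex \<Rightarrow> complex \<Rightarrow> complex \<Rightarrow> nat \<Rightarrow> nat \<Rightarrow> (nat \<times> nat \<times> complex) multiset" where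
  "up_local q q1 q3 N k =
     mset ((if 1 < k then [(k-1, k, 1), (k, k-1, q1)] else []) @
           (if k < N then [(k, k+1, 1), (k+1, k, q3)] else []) @
           [(k, 0, q powi (-2) * q3 powi (int k - 2)), (N+1, k, 1)])"

text \<open>Arrows away from \<open>k\<close> shared by both quivers. Loops at \<open>k - 1\<close>
  and \<open>k + 1\<close> are left out because the mutation moves a loop from one to the other; of
  the arrows from 0 to \<open>N + 1\<close> the quiver with index \<open>k - 1\<close> has one more
  if \<open>k\<close> is less than \<open>N\<close>.\<close>

definition common_rest :: "complex \<Rightarrow> complex \<Rightarrow> nat \<Rightarrow> nat \<Rightarrow> (nat \<times> nat \<times> complex) multiset" where
  "common_rest q1 q3 N k =
     mset (map (\<lambda>i. (i, i, q1)) ([1..<k-1] @ [k+2..<N+1]) @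
           map (\<lambda>i. (i, i+1, 1)) ([1..<k-1] @ [k+1..<N]) @
           map (\<lambda>i. (i+1, i, q3)) ([1..<k-1] @ [k+1..<N]) @
           map (\<lambda>t. (0, N+1, q3 powi (1 - int k - int t))) [0..<N-k-1])"

definition down_rest :: "complex \<Rightarrow> complex \<Rightarrow> complex \<Rightarrow> nat \<Rightarrow> nat \<Rightarrow> (nat \<times> nat \<times> complex) multiset" where
  "down_rest q q1 q3 N k = common_rest q1 q3 N k +
     mset ((if 1 < k then [(k-1, k-1, q1)] else []) @
           (if k < N then [(k+1, 0, q powi (-2) * q3 powi (int k - 1)), (N+1, k+1, 1)]
            else [(N+1, 0, q powi (-2) * q3 powi (int k - 2))]))"

definition up_rest :: "complex \<Rightarrow> complex \<Rightarrow> nat \<Rightarrow> nat \<Rightarrow> (nat \<times> nat \<times> complex) multiset" where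
  "up_rest q1 q3 N k = common_rest q1 q3 N k +
     mset ((if 1 < k then [(0, k-1, q3 powi (2 - int k)), (k-1, N+1, q3)] else []) @
           (if k < N then [(k+1, k+1, q1), (0, N+1, q3 powi (2 - int k))] else []))"

lemma mset_set_atLeastLessThan_snoc:
  "m < k \<Longrightarrow> mset_set {m..<k} = add_mset (k - Suc 0) (mset_set {m..<k - Suc 0})" for k :: nat
  by (cases k) (simp_all add: atLeastLessThanSuc)

lemma mset_set_atLeastLessThan_cons:
  "m < k \<Longrightarrow> mset_set {m..<k} = add_mset m (mset_set {Suc m..<k})" for k :: nat
proof -
  assume "m < k"
  then have "{m..<k} = insert m {Suc m..<k}" by auto
  then show ?thesis by simp
qed

lemma image_mset_set_atLeastLessThan_shift:
  "0 < n \<Longrightarrow> image_mset f (mset_set {0..<n}) = add_mset (f 0) (image_mset (\<lambda>t. f (Suc t)) (mset_set {0..<n - Suc 0}))"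
proof -
  assume "0 < n"
  then have "mset [0..<n] = mset (0 # map Suc [0..<n - Suc 0])"
    by (simp add: map_Suc_upt upt_conv_Cons)
  then show ?thesis
    by (simp add: multiset.map_comp o_def)
qed

lemma arrows_sub_quiver_down:
  assumes "2 \<le> N" "1 \<le> k" "k \<le> N"
  shows "arrows (sub_quiver q q1 q3 N k) = down_local q1 q3 N k + down_rest q q1 q3 N k"
proof -
  have *: "mset_set {Suc 0..<k} = add_mset (k - Suc 0) (mset_set {Suc 0..<k - Suc 0})" if "1 < k"
    using that by (simp add: mset_set_atLeastLessThan_snoc)
  show ?thesis
    using assms *
    by (cases "k = N"; cases "1 < k")
      (simp_all add: sub_quiver_def down_local_def down_rest_def common_rest_def)
qed

text \<open>The quiver with index 0 has its own definition, with label q1 on the arrow from 1 to 0.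
  The equation for q1 identifies it with the general label q^-2 q3^(k-2) at \<open>k\<close> =
  1.\<close>

lemma arrows_sub_quiver_up:
  assumes "2 \<le> N" "1 \<le> k" "k \<le> N" "q1 = inverse (q ^ 2 * q3)" "q3 \<noteq> 0"
  shows "arrows (sub_quiver q q1 q3 N (k - 1)) = up_local q q1 q3 N k + up_rest q1 q3 N k"
proof -
  have 1: "mset_set {k..<N} = add_mset k (mset_set {Suc k..<N})"
    "mset_set {Suc k..<Suc N} = add_mset (Suc k) (mset_set {Suc (Suc k)..<Suc N})" if "k < N"
    using that by (simp_all add: mset_set_atLeastLessThan_cons)
  have 3: "mset_set {Suc k..<N} = add_mset (Suc k) (mset_set {Suc (Suc k)..<N})" if "Suc k < N"
    using that by (simp_all add: mset_set_atLeastLessThan_cons)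
  have 2: "image_mset f (mset_set {0..<N - k})
      = add_mset (f 0) (image_mset (\<lambda>t. f (Suc t)) (mset_set {0..<N - Suc k}))"
    if "k < N" for f :: "nat \<Rightarrow> nat \<times> nat \<times> complex"
    using that image_mset_set_atLeastLessThan_shift[of "N - k" f] by simp
  show ?thesis
  proof (cases "k = 1")
    case True
    then show ?thesis using assms 1 2 3
      by (simp add: sub_quiver_def up_local_def up_rest_def common_rest_def power_int_minus numeral_2_eq_2)
  next
    case False
    moreover have "k - Suc 0 < N" using assms by simp
    ultimately show ?thesis
      using assms 1 2 3
      by (cases "k = N"; simp add: sub_quiver_def up_local_def up_rest_def common_rest_def algebra_simps)
  qed
qed

lemma reduced_arrowsI:
  assumes "\<And>i j \<kappa> \<kappa>'. (i, j, \<kappa>) \<in># A \<Longrightarrow> (j, i, \<kappa>') \<in># A \<Longrightarrow> q ^ 2 * \<kappa> * \<kappa>' \<noteq> 1" and "q \<noteq> 0"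
    and "\<And>i j \<kappa>. (i, j, \<kappa>) \<in># A \<Longrightarrow> \<kappa> \<noteq> 0"
  shows "reduced_arrows q A"
  unfolding reduced_arrows_def
proof
  fix a assume a: "a \<in># A"
  obtain i j \<kappa> where *: "a = (i, j, \<kappa>)" by (cases a)
  show "opp_arrow q a \<notin># A"
  proof
    assume "opp_arrow q a \<in># A"
    then have "q ^ 2 * \<kappa> * inverse (q ^ 2 * \<kappa>) \<noteq> 1"
      using assms(1)[of i j \<kappa>] a by (simp add: * opp_arrow_def)
    moreover have "q ^ 2 * \<kappa> \<noteq> 0"
      using assms(2) assms(3)[of i j \<kappa>] a by (simp add: * )
    ultimately show False
      using right_inverse by blast
  qed
qed

lemma reduced_sub_quiver:
  assumes "2 \<le> N" "M \<le> N" "q \<noteq> 0" "q1 \<noteq> 0" "q3 \<noteq> 0"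
    and "q ^ 2 * q1 * q1 \<noteq> 1" "q ^ 2 * q3 \<noteq> 1" "q ^ 2 * q1 \<noteq> 1" "q ^ 2 \<noteq> 1"
  shows "reduced_arrows q (arrows (sub_quiver q q1 q3 N M))" (is "reduced_arrows q ?A")
proof (rule reduced_arrowsI)
  show nz: "\<kappa> \<noteq> 0" if "(i, j, \<kappa>) \<in># ?A" for i j \<kappa>
    using that assms by (auto simp: sub_quiver_def split: if_splits)
  have loop: "\<kappa> = q1" if "(i, i, \<kappa>) \<in># ?A" for i \<kappa>
    using that assms by (auto simp: sub_quiver_def split: if_splits)
  have chain: "\<kappa> = 1" "1 \<le> i \<Longrightarrow> \<kappa>' \<in> {q1, q3}"
    if "(i, Suc i, \<kappa>) \<in># ?A" "(Suc i, i, \<kappa>') \<in># ?A" for i \<kappa> \<kappa>'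
    using that assms by (auto simp: sub_quiver_def split: if_splits)
  have other: "i = j \<or> 1 \<le> j \<and> i = Suc j \<or> 1 \<le> i \<and> j = Suc i" if "(i, j, \<kappa>) \<in># ?A" "(j, i, \<kappa>') \<in># ?A" for i j \<kappa> \<kappa>'
    using that assms by (auto simp: sub_quiver_def split: if_splits)
  show "q ^ 2 * \<kappa> * \<kappa>' \<noteq> 1" if "(i, j, \<kappa>) \<in># ?A" "(j, i, \<kappa>') \<in># ?A" for i j \<kappa> \<kappa>'
    using other[OF that]
  proof (elim disjE conjE)
    assume "i = j"
    then show ?thesis using that loop assms by blast
  next
    assume *: "1 \<le> j" "i = Suc j"
    then have "\<kappa>' = 1" "\<kappa> \<in> {q1, q3}" using that chain by blast+
    then show ?thesis using assms by auto
  next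
    assume *: "1 \<le> i" "j = Suc i"
    then have "\<kappa> = 1" "\<kappa>' \<in> {q1, q3}" using that chain by blast+
    then show ?thesis using assms by auto
  qed
qed fact

lemma touching_sub_quiver:
  assumes "2 \<le> N" "1 \<le> k" "k \<le> N"
  shows "touching k (down_local q1 q3 N k)" "touching k (up_local q q1 q3 N k)"
    "avoiding k (down_rest q q1 q3 N k)" "avoiding k (up_rest q1 q3 N k)"
  using assms
  by (auto simp: touching_def avoiding_def down_local_def up_local_def down_rest_def up_rest_def common_rest_def)

lemma label_cancel:
  fixes q :: complex
  assumes "q \<noteq> 0"
  shows "inverse q * inverse q * (q * x) * (q * y) = x * y"
    "inverse q * inverse q * q * (q * y) = y"
    "inverse q * inverse q * (q * x) * q = x"
    "inverse q * inverse q * q * q = 1"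
    "inverse q * inverse q * (q * q * x) = x"
    "inverse q * inverse q * (q * q) = 1"
  using assms by (simp_all add: field_simps)

lemma flip_down_local:
  assumes "1 \<le> k" "k \<le> N" "q \<noteq> 0" "q3 \<noteq> 0" "q1 = inverse (q ^ 2 * q3)"
  shows "flip_arrows q k (down_local q1 q3 N k) =
    image_mset (gauge_arrow k (inverse (q * q3))) (up_local q q1 q3 N k)"
proof -
  define c where "c = q3 powi (1 - int k)"
  have "c \<noteq> 0" using assms by (simp add: c_def)
  have p: "q3 powi (int k - 2) = inverse (q3 * c)" "q powi (-2) = inverse (q ^ 2)"
    using assms by (simp_all add: c_def power_int_diff power_int_minus field_simps power2_eq_square)
  have e: "inverse (q * q1) = q * q3" "q1 * (q * q3) = inverse q" "q3 * inverse (q * q3) = inverse q"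
    "inverse (q ^ 2) * inverse (q3 * c) * (q * q3) = inverse (q * c)"
    unfolding assms(5) using assms(3,4) \<open>c \<noteq> 0\<close> by (simp_all add: field_simps power2_eq_square)
  have "k - Suc 0 \<noteq> k" "1 < N \<Longrightarrow> N - Suc 0 \<noteq> N" using assms by simp_all
  then show ?thesis
    unfolding flip_arrows_def down_local_def up_local_def gauge_arrow_def p c_def[symmetric]
    using assms(1,2) by (simp add: e del: inverse_mult_distrib)
qed

text \<open>One arrow of each pair. The loop q1 at \<open>k - 1\<close> meets a composite loop q3.
  The arrow from \<open>k - 1\<close> to \<open>k + 1\<close> and its opposite are both composites.
  The other entries are arrows of the first quiver at 0 or \<open>N + 1\<close>, each cancelled by a
  composite.\<close>

definition deleted_pairs :: "complex \<Rightarrow> complex \<Rightarrow> complex \<Rightarrow> nat \<Rightarrow> nat \<Rightarrow> (nat \<times> nat \<times> complex) multiset" where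
  "deleted_pairs q q1 q3 N k =
     mset ((if 1 < k then [(k-1, k-1, q1)] else []) @
           (if 1 < k \<and> k < N then [(k-1, k+1, 1)] else []) @
           (if k < N then [(k+1, 0, q powi (-2) * q3 powi (int k - 1)), (N+1, k+1, 1)]
            else [(N+1, 0, q powi (-2) * q3 powi (int k - 2))]))"

text \<open>After the flip, arrows enter \<open>k\<close> from \<open>k - 1\<close>,
  \<open>k + 1\<close>, \<open>N + 1\<close> and leave it to \<open>k - 1\<close>,
  \<open>k + 1\<close>, 0. Away from the ends of the chain these give nine composites: four are new
  arrows of the second quiver, five belong to deleted pairs.\<close>

lemma composite_down_local:
  assumes "2 \<le> N" "1 \<le> k" "k \<le> N" "q \<noteq> 0" "q3 \<noteq> 0" "q1 = inverse (q ^ 2 * q3)"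
  shows "down_rest q q1 q3 N k + composite_arrows q k (flip_arrows q k (down_local q1 q3 N k)) =
    up_rest q1 q3 N k + (deleted_pairs q q1 q3 N k + image_mset (opp_arrow q) (deleted_pairs q q1 q3 N k))"
proof -
  define c where "c = q3 powi (1 - int k)"
  have "c \<noteq> 0" using assms by (simp add: c_def)
  have p: "q3 powi (int k - 1) = inverse c" "q3 powi (int k - 2) = inverse (q3 * c)"
    "q3 powi (2 - int k) = q3 * c" "q powi (-2) = inverse (q ^ 2)"
    using assms by (simp_all add: c_def power_int_diff power_int_minus field_simps power2_eq_square)
  have r: "q3 * (inverse q * inverse q * inverse q3) = inverse q * inverse q"
    using assms by (simp add: field_simps)
  have k': "k - Suc 0 \<noteq> k" using assms by simp
  consider "1 < k" "k < N" | "1 < k" "N = k" | "k = 1" "k < N"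
    using assms by linarith
  then show ?thesis
    by cases
      (use assms \<open>c \<noteq> 0\<close> in \<open>simp_all add: composite_arrows_altdef flip_arrows_def down_local_def
         down_rest_def up_rest_def deleted_pairs_def opp_arrow_def p c_def[symmetric] power2_eq_square
         label_cancel r k'\<close>)
qed

lemma quiver_gauge_mutation_simps [simp]:
  "verts (quiver_gauge i \<alpha> Q) = verts Q" "kind (quiver_gauge i \<alpha> Q) = kind Q"
  "verts (quiver_mutation q k Q) = verts Q" "kind (quiver_mutation q k Q) = kind Q"
  by (simp_all add: quiver_gauge_def quiver_mutation_def)

lemma sub_quiver_simps [simp]:
  "verts (sub_quiver q q1 q3 N M) = {0..N+1}"
  "kind (sub_quiver q q1 q3 N M) = (\<lambda>i. if i = 0 then Frozen_minus else if i = N+1 then Frozen_plus else Unfrozen)"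
  by (simp_all add: sub_quiver_def)

lemma touching_no_loop:
  assumes "arrows Q = L + R" "touching k L" "avoiding k R"
  shows "labels Q k k = {#}"
proof -
  have "(k, k, \<kappa>) \<notin># L" "(k, k, \<kappa>) \<notin># R" for \<kappa>
    using assms(2,3) by (auto simp: touching_def avoiding_def)
  then show ?thesis
    unfolding labels_def assms(1) by (auto simp: filter_mset_eq_conv)
qed

lemma labels_local:
  assumes "arrows Q = L + R" "avoiding k R"
  shows "labels Q i k = image_mset (\<lambda>(s, t, \<kappa>). \<kappa>) (filter_mset (\<lambda>(s, t, \<kappa>). s = i \<and> t = k) L)"
    "labels Q k i = image_mset (\<lambda>(s, t, \<kappa>). \<kappa>) (filter_mset (\<lambda>(s, t, \<kappa>). s = k \<and> t = i) L)"
proof -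
  have "filter_mset (\<lambda>(s, t, \<kappa>). s = i \<and> t = k) R = {#}" "filter_mset (\<lambda>(s, t, \<kappa>). s = k \<and> t = i) R = {#}"
    using assms(2) by (auto simp: avoiding_def filter_mset_eq_conv)
  then show "labels Q i k = image_mset (\<lambda>(s, t, \<kappa>). \<kappa>) (filter_mset (\<lambda>(s, t, \<kappa>). s = i \<and> t = k) L)"
    "labels Q k i = image_mset (\<lambda>(s, t, \<kappa>). \<kappa>) (filter_mset (\<lambda>(s, t, \<kappa>). s = k \<and> t = i) L)"
    unfolding labels_def assms(1) by simp_all
qed

context
  fixes q q1 q2 q3 :: complex and N k :: nat
  assumes prod: "q1 * q2 * q3 = 1" and sqr: "q ^ 2 = q2"
    and generic: "\<forall>a b c :: int. q1 powi a * q2 powi b * q3 powi c = 1 \<longrightarrow> a = b \<and> b = c"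
    and N: "2 \<le> N" and k: "1 \<le> k" "k \<le> N"
begin

lemma parameters_nonzero: "q \<noteq> 0" "q1 \<noteq> 0" "q2 \<noteq> 0" "q3 \<noteq> 0"
  using prod sqr by auto

lemma q1_eq: "q1 = inverse (q ^ 2 * q3)"
  using prod sqr parameters_nonzero by (simp add: field_simps)

lemma sub_quiver_reduced:
  assumes "M \<le> N"
  shows "reduced_arrows q (arrows (sub_quiver q q1 q3 N M))"
proof (rule reduced_sub_quiver[OF N assms])
  show "q ^ 2 * q1 * q1 \<noteq> 1"
    using generic[rule_format, of 2 1 0] by (auto simp: sqr power2_eq_square[of q1] algebra_simps)
  show "q ^ 2 * q3 \<noteq> 1" using generic[rule_format, of 0 1 1] by (auto simp: sqr)
  show "q ^ 2 * q1 \<noteq> 1" using generic[rule_format, of 1 1 0] by (auto simp: sqr algebra_simps)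
  show "q ^ 2 \<noteq> 1" using generic[rule_format, of 0 1 0] by (auto simp: sqr)
qed (use parameters_nonzero in auto)

lemmas down_arrows = arrows_sub_quiver_down[OF N k, of q q1 q3]
lemmas up_arrows = arrows_sub_quiver_up[OF N k q1_eq parameters_nonzero(4)]
lemmas sub_touching = touching_sub_quiver[OF N k]

lemma sub_quiver_mutation:
  "quiver_gauge k (q * q3) (quiver_mutation q k (sub_quiver q q1 q3 N k)) = sub_quiver q q1 q3 N (k - 1)"
  "quiver_gauge k (q * q1) (quiver_mutation q k (sub_quiver q q1 q3 N (k - 1))) = sub_quiver q q1 q3 N k"
proof -
  have inv: "inverse (q * q3) = q * q1" and nz: "q * q3 \<noteq> 0"
    unfolding q1_eq using parameters_nonzero(1,4) by (simp_all add: field_simps power2_eq_square)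
  note pair = mutation_pair[OF parameters_nonzero(1) nz sub_touching
      flip_down_local[OF k parameters_nonzero(1,4) q1_eq]
      composite_down_local[OF N k parameters_nonzero(1,4) q1_eq] _ _ down_arrows up_arrows, unfolded inv]
  have red: "reduced_arrows q (down_local q1 q3 N k + down_rest q q1 q3 N k)"
    "reduced_arrows q (up_local q q1 q3 N k + up_rest q1 q3 N k)"
    using sub_quiver_reduced[OF k(2)] sub_quiver_reduced[of "k - 1"] k
    by (simp_all only: down_arrows up_arrows diff_le_self le_trans)
  have ext: "Q = R" if "verts Q = verts R" "kind Q = kind R" "arrows Q = arrows R" for Q R :: "nat quiver"
    using that by (rule quiver.equality) simp
  show "quiver_gauge k (q * q3) (quiver_mutation q k (sub_quiver q q1 q3 N k)) = sub_quiver q q1 q3 N (k - 1)"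
    by (rule ext[OF _ _ pair(1)[OF red]]) simp_all
  show "quiver_gauge k (q * q1) (quiver_mutation q k (sub_quiver q q1 q3 N (k - 1))) = sub_quiver q q1 q3 N k"
    by (rule ext[OF _ _ pair(2)[OF red]]) simp_all
qed

lemma sub_quiver_mutable:
  "mutable_at (sub_quiver q q1 q3 N k) k" "mutable_at (sub_quiver q q1 q3 N (k - 1)) k"
proof -
  show "mutable_at (sub_quiver q q1 q3 N k) k"
    unfolding mutable_at_def touching_no_loop[OF down_arrows sub_touching(1,3)]
    using k by simp
  show "mutable_at (sub_quiver q q1 q3 N (k - 1)) k"
    unfolding mutable_at_def touching_no_loop[OF up_arrows sub_touching(2,4)]
    using k by simp
qed

text \<open>The labels at \<open>k\<close> are all that the fermionic contents of the vertex
  operators depend on, besides q and the gauging constant.\<close>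

lemma down_labels:
  "labels (sub_quiver q q1 q3 N k) i k =
     (if i = 0 then {#q3 powi (1 - int k)#} else if Suc i = k then {#1#}
      else if i = Suc k \<and> k < N then {#q1#} else {#})"
  "labels (sub_quiver q q1 q3 N k) k i =
     (if i = Suc N then {#q3#} else if i = 0 then {#} else if Suc i = k then {#q3#}
      else if i = Suc k then {#1#} else {#})"
  unfolding labels_local[OF down_arrows sub_touching(3)] down_local_def using k by auto

lemma up_labels:
  "labels (sub_quiver q q1 q3 N (k - 1)) i k =
     (if i = Suc N then {#1#} else if i = 0 then {#} else if Suc i = k then {#1#}
      else if i = Suc k then {#q3#} else {#})"
  "labels (sub_quiver q q1 q3 N (k - 1)) k i =
     (if i = 0 then {#q powi (-2) * q3 powi (int k - 2)#} else if Suc i = k then {#q1#}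
      else if i = Suc k \<and> k < N then {#1#} else {#})"
  unfolding labels_local[OF up_arrows sub_touching(4)] up_local_def using k by auto

end

section \<open>Signed arrow counts under mutation, which govern the ordering of zero modes\<close>

definition num_arrows :: "('v \<times> 'v \<times> complex) multiset \<Rightarrow> 'v \<Rightarrow> 'v \<Rightarrow> int" where
  "num_arrows A i j = int (size (filter_mset (\<lambda>(s, t, \<kappa>). s = i \<and> t = j) A))"

lemma int_size_labels: "int (size (labels Q i j)) = num_arrows (arrows Q) i j"
  by (simp add: labels_def num_arrows_def)

lemma num_arrows_union [simp]: "num_arrows (A + B) i j = num_arrows A i j + num_arrows B i j"
  by (simp add: num_arrows_def)

lemma num_arrows_opp_arrow: "num_arrows (image_mset (opp_arrow q) A) i j = num_arrows A j i"
proof -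
  have "filter_mset (\<lambda>x. case opp_arrow q x of (s, t, \<kappa>) \<Rightarrow> s = i \<and> t = j) A
      = filter_mset (\<lambda>(s, t, \<kappa>). s = j \<and> t = i) A"
    by (intro filter_mset_cong) (auto simp: opp_arrow_def)
  then show ?thesis
    by (simp add: num_arrows_def filter_mset_image_mset)
qed

lemma num_arrows_loops:
  assumes "i \<noteq> j" "\<forall>(s, t, \<kappa>)\<in>#A. s = t"
  shows "num_arrows A i j = 0"
  using assms by (auto simp: num_arrows_def filter_mset_eq_conv)

text \<open>The intersection of \<open>A\<close> with its image under \<open>opp_arrow\<close> is
  closed under opposites, so removing it takes away equally many arrows in both directions; the
  self-opposite arrows that are added back are loops.\<close>

lemma num_arrows_delete_pairs:
  assumes "q \<noteq> 0" "i \<noteq> j"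
  shows "num_arrows (delete_pairs q A) i j - num_arrows (delete_pairs q A) j i = num_arrows A i j - num_arrows A j i"
proof -
  let ?B = "image_mset (opp_arrow q) A"
  have opp: "image_mset (opp_arrow q) (A \<inter># ?B) = A \<inter># ?B"
    by (rule multiset_eqI) (simp add: count_image_opp_arrow assms min.commute)
  let ?E = "mset_set {a \<in> set_mset A. opp_arrow q a = a \<and> odd (count A a)}"
  have "fst (opp_arrow q a) = fst (snd a)" for a
    by (cases a) (simp add: opp_arrow_def)
  then have "fst a = fst (snd a)" if "opp_arrow q a = a" for a
    using that by metis
  then have loops: "\<forall>(s, t, \<kappa>)\<in>#?E. s = t"
    by fastforce
  have "A = (A - ?B) + A \<inter># ?B"
    by (rule multiset_eqI) simp
  then have "num_arrows A i j = num_arrows (A - ?B) i j + num_arrows (A \<inter># ?B) i j" for i j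
    by (metis num_arrows_union)
  moreover have "num_arrows (A \<inter># ?B) i j = num_arrows (A \<inter># ?B) j i"
    using num_arrows_opp_arrow[of q "A \<inter># ?B"] by (simp add: opp)
  ultimately show ?thesis
    using num_arrows_loops[OF assms(2) loops] num_arrows_loops[OF assms(2)[symmetric] loops]
    by (simp add: delete_pairs_def)
qed

lemma num_arrows_flip_arrows:
  assumes "i \<noteq> j"
  shows "num_arrows (flip_arrows q k A) i j = (if i = k \<or> j = k then num_arrows A j i else num_arrows A i j)"
proof -
  have "filter_mset (\<lambda>x. case (case x of (s, t, \<kappa>) \<Rightarrow> if s = k \<or> t = k then (t, s, inverse (q * \<kappa>)) else (s, t, \<kappa>))
       of (s, t, \<kappa>) \<Rightarrow> s = i \<and> t = j) A
     = filter_mset (\<lambda>(s, t, \<kappa>). if i = k \<or> j = k then s = j \<and> t = i else s = i \<and> t = j) A"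
    using assms by (intro filter_mset_cong) (auto split: if_splits)
  then show ?thesis
    by (auto simp: num_arrows_def flip_arrows_def filter_mset_image_mset)
qed

lemma sum_mset_if_const:
  "(\<Sum>a\<in>#A. if P a then c else 0) = size (filter_mset P A) * c" for c :: nat
  by (induction A) auto

lemma num_arrows_composite_arrows:
  "num_arrows (composite_arrows q k A) i j = num_arrows A j k * num_arrows A k i"
proof -
  have *: "size (filter_mset P (\<Sum>a\<in>#X. image_mset (f a) B)) = (\<Sum>a\<in>#X. size (filter_mset (\<lambda>b. P (f a b)) B))"
    for P :: "'a \<times> 'a \<times> complex \<Rightarrow> bool" and X f and B :: "('a \<times> 'a \<times> complex) multiset"
    by (induction X) (simp_all add: filter_mset_image_mset)
  let ?I = "filter_mset (\<lambda>a. fst (snd a) = k) A" and ?O = "filter_mset (\<lambda>b. fst b = k) A"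
  have "size (filter_mset (\<lambda>(s, t, \<kappa>). s = i \<and> t = j) (composite_arrows q k A))
      = (\<Sum>a\<in>#?I. size (filter_mset (\<lambda>b. fst (snd b) = i \<and> fst a = j) ?O))"
    unfolding composite_arrows_altdef * by simp
  also have "\<dots> = (\<Sum>a\<in>#?I. if fst a = j then size (filter_mset (\<lambda>b. fst (snd b) = i) ?O) else 0)"
    by (intro arg_cong[where f = sum_mset] image_mset_cong) auto
  also have "\<dots> = size (filter_mset (\<lambda>a. fst a = j) ?I) * size (filter_mset (\<lambda>b. fst (snd b) = i) ?O)"
    by (rule sum_mset_if_const)
  also have "filter_mset (\<lambda>a. fst a = j) ?I = filter_mset (\<lambda>(s, t, \<kappa>). s = j \<and> t = k) A"
    unfolding filter_filter_mset by (rule filter_mset_cong) auto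
  also have "filter_mset (\<lambda>b. fst (snd b) = i) ?O = filter_mset (\<lambda>(s, t, \<kappa>). s = k \<and> t = i) A"
    unfolding filter_filter_mset by (rule filter_mset_cong) auto
  finally show ?thesis
    by (simp add: num_arrows_def)
qed

lemma eps_quiver_gauge: "eps (quiver_gauge i \<alpha> Q) = eps Q"
proof -
  have "num_arrows (image_mset (gauge_arrow i \<alpha>) A) s t = num_arrows A s t" for A :: "('a \<times> 'a \<times> complex) multiset" and s t
    unfolding num_arrows_def filter_mset_image_mset
    by (auto simp: case_prod_unfold)
  then show ?thesis
    by (intro ext) (simp add: eps_def int_size_labels quiver_gauge_eq)
qed

text \<open>The matrix mutation rule of cluster algebras, with the numbers of arrows in each
  direction in place of positive parts, because arrows in both directions may coexist. The equality
  of phases of the old and the new seed rests on it.\<close>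

lemma eps_quiver_mutation:
  assumes "q \<noteq> 0" "labels Q k k = {#}"
  shows "eps (quiver_mutation q k Q) i k = - eps Q i k" "eps (quiver_mutation q k Q) k i = - eps Q k i"
    and "i \<noteq> k \<Longrightarrow> j \<noteq> k \<Longrightarrow> eps (quiver_mutation q k Q) i j = eps Q i j +
      int (size (labels Q k j)) * int (size (labels Q i k)) - int (size (labels Q k i)) * int (size (labels Q j k))"
proof -
  have 0: "num_arrows (arrows Q) k k = 0"
    using assms(2) int_size_labels[of Q k k] by simp
  have fk: "num_arrows (flip_arrows q k A) k k = num_arrows A k k" for A :: "('a \<times> 'a \<times> complex) multiset"
    unfolding num_arrows_def flip_arrows_def filter_mset_image_mset
    apply simp
    by (intro arg_cong[where f = size] filter_mset_cong) (auto split: if_splits)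
  have d: "eps (quiver_mutation q k Q) i j = (if i = j then 0 else
      num_arrows (flip_arrows q k (arrows Q)) i j + num_arrows (flip_arrows q k (arrows Q)) j k * num_arrows (flip_arrows q k (arrows Q)) k i
    - (num_arrows (flip_arrows q k (arrows Q)) j i + num_arrows (flip_arrows q k (arrows Q)) i k * num_arrows (flip_arrows q k (arrows Q)) k j))" for i j
    using num_arrows_delete_pairs[OF assms(1), of i j
        "flip_arrows q k (arrows Q) + composite_arrows q k (flip_arrows q k (arrows Q))"]
    by (cases "i = j") (simp_all add: eps_def int_size_labels quiver_mutation_def Let_def num_arrows_composite_arrows)
  show "eps (quiver_mutation q k Q) i k = - eps Q i k" "eps (quiver_mutation q k Q) k i = - eps Q k i"
    unfolding d by (simp_all add: num_arrows_flip_arrows eps_def int_size_labels fk 0)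
  show "eps (quiver_mutation q k Q) i j = eps Q i j +
      int (size (labels Q k j)) * int (size (labels Q i k)) - int (size (labels Q k i)) * int (size (labels Q j k))"
    if "i \<noteq> k" "j \<noteq> k"
    using that unfolding d by (simp add: num_arrows_flip_arrows eps_def int_size_labels)
qed

section \<open>Vertex operators\<close>

locale complex_vector_space = vector_space sc for sc :: "complex \<Rightarrow> 'w \<Rightarrow> 'w::ab_group_add"
begin

abbreviation lin :: "('w \<Rightarrow> 'w) \<Rightarrow> bool" where
  "lin \<equiv> Vector_Spaces.linear sc sc"

lemma lin_iff: "lin f \<longleftrightarrow> (\<forall>x y. f (x + y) = f x + f y) \<and> (\<forall>c x. f (sc c x) = sc c (f x))"
  unfolding Vector_Spaces.linear_def module_hom_def module_hom_axioms_def
  using vector_space_axioms module_axioms by blast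

lemma lin_add: "lin f \<Longrightarrow> f (x + y) = f x + f y"
  and lin_scale: "lin f \<Longrightarrow> f (sc c x) = sc c (f x)"
  by (simp_all add: lin_iff)

lemma lin_0: "lin f \<Longrightarrow> f 0 = 0"
  using lin_scale[of f 0 0] by simp

lemma lin_sum: "lin f \<Longrightarrow> f (sum g A) = (\<Sum>x\<in>A. f (g x))"
  by (induction A rule: infinite_finite_induct) (simp_all add: lin_0 lin_add)

lemma lin_sum_list: "lin f \<Longrightarrow> f (sum_list xs) = sum_list (map f xs)"
  by (induction xs) (simp_all add: lin_0 lin_add)

lemma lin_zero_fun: "lin (\<lambda>w. 0)"
  and lin_ident: "lin (\<lambda>w. w)"
  and lin_plus: "lin f \<Longrightarrow> lin g \<Longrightarrow> lin (\<lambda>w. f w + g w)"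
  and lin_sc: "lin f \<Longrightarrow> lin (\<lambda>w. sc c (f w))"
  and lin_comp: "lin f \<Longrightarrow> lin g \<Longrightarrow> lin (\<lambda>w. f (g w))"
  by (simp_all add: lin_iff scale_right_distrib scale_scale mult.commute)

lemma lin_sum_fun: "(\<And>x. x \<in> A \<Longrightarrow> lin (f x)) \<Longrightarrow> lin (\<lambda>w. \<Sum>x\<in>A. f x w)"
  by (induction A rule: infinite_finite_induct) (simp_all add: lin_zero_fun lin_plus)

lemma lin_sum_list_fun: "(\<And>x. x \<in> set xs \<Longrightarrow> lin (f x)) \<Longrightarrow> lin (\<lambda>w. \<Sum>x\<leftarrow>xs. f x w)"
  by (induction xs) (simp_all add: lin_zero_fun lin_plus)

lemma lin_Sum_any:
  assumes "lin f" "finite {x. g x \<noteq> 0}"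
  shows "f (Sum_any g) = Sum_any (\<lambda>x. f (g x))"
proof -
  have "Sum_any (\<lambda>x. f (g x)) = (\<Sum>x | g x \<noteq> 0. f (g x))"
    by (rule Sum_any.expand_superset) (use assms lin_0 in auto)
  then show ?thesis
    by (simp add: Sum_any.expand_set lin_sum[OF assms(1)])
qed

lemma subspace_Sum_any: "subspace S \<Longrightarrow> (\<And>x. g x \<in> S) \<Longrightarrow> Sum_any g \<in> S"
  by (simp add: Sum_any.expand_set subspace_sum)

lemma subspace_sum_list: "subspace S \<Longrightarrow> (\<And>x. x \<in> set xs \<Longrightarrow> g x \<in> S) \<Longrightarrow> (\<Sum>x\<leftarrow>xs. g x) \<in> S"
  by (induction xs) (auto simp: subspace_0 subspace_add)


lemma sum_list_eq_0: "(\<And>x. x \<in> set xs \<Longrightarrow> f x = 0) \<Longrightarrow> (\<Sum>x\<leftarrow>xs. f x) = (0 :: 'w)"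
  by (induction xs) auto


subsection \<open>Coefficients of exponentials\<close>

lemma lin_pow_coeff: "(\<And>m. 0 < m \<Longrightarrow> lin (a m)) \<Longrightarrow> lin (pow_coeff a k n)"
proof (induction k arbitrary: n)
  case 0
  show ?case by (cases "n = 0") (simp_all add: lin_zero_fun lin_ident)
next
  case (Suc k)
  have "lin (\<lambda>w. \<Sum>m=1..n. a m (pow_coeff a k (n - m) w))"
  proof (rule lin_sum_fun)
    fix m assume "m \<in> {1..n}"
    then show "lin (\<lambda>w. a m (pow_coeff a k (n - m) w))"
      using lin_comp[OF Suc.prems Suc.IH[OF Suc.prems], of m "n - m"] by simp
  qed
  moreover have "pow_coeff a (Suc k) n = (\<lambda>w. \<Sum>m=1..n. a m (pow_coeff a k (n - m) w))"
    by (rule ext) simp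
  ultimately show ?case by simp
qed

lemma lin_exp_coeff: "(\<And>m. 0 < m \<Longrightarrow> lin (a m)) \<Longrightarrow> lin (exp_coeff sc a n)"
proof -
  assume "\<And>m. 0 < m \<Longrightarrow> lin (a m)"
  then have "lin (\<lambda>w. \<Sum>k\<le>n. sc (1 / fact k) (pow_coeff a k n w))"
    by (intro lin_sum_fun lin_sc lin_pow_coeff)
  then show ?thesis by (simp add: exp_coeff_def[abs_def])
qed

lemma pow_coeff_eq_0:
  "(\<And>m. 0 < m \<Longrightarrow> lin (a m)) \<Longrightarrow> n < k \<Longrightarrow> pow_coeff a k n w = 0"
proof (induction k arbitrary: n)
  case (Suc k)
  have "a m (pow_coeff a k (n - m) w) = 0" if "m \<in> {1..n}" for m
    using Suc that by (auto simp: lin_0)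
  then show ?case by simp
qed simp

lemma pow_coeff_commute:
  assumes "lin f" "\<And>m w. 0 < m \<Longrightarrow> f (a m w) = a m (f w)"
  shows "f (pow_coeff a k n w) = pow_coeff a k n (f w)"
proof (induction k arbitrary: n)
  case (Suc k)
  then show ?case using assms by (simp add: lin_sum)
qed (simp add: lin_0 assms)

lemma exp_coeff_commute:
  assumes "lin f" "\<And>m w. 0 < m \<Longrightarrow> f (a m w) = a m (f w)"
  shows "f (exp_coeff sc a n w) = exp_coeff sc a n (f w)"
  by (simp add: exp_coeff_def lin_sum lin_scale assms pow_coeff_commute[of f a])

lemma exp_coeff_upto:
  assumes "\<And>m. 0 < m \<Longrightarrow> lin (a m)" "n \<le> N"
  shows "exp_coeff sc a n w = (\<Sum>k\<le>N. sc (1 / fact k) (pow_coeff a k n w))"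
  unfolding exp_coeff_def
  by (rule sum.mono_neutral_left) (use assms pow_coeff_eq_0[of a] in auto)

lemma pow_coeff_scale:
  assumes "\<And>m. 0 < m \<Longrightarrow> lin (a m)"
  shows "pow_coeff (\<lambda>m u. sc (c ^ m) (a m u)) k n w = sc (c ^ n) (pow_coeff a k n w)"
proof (induction k arbitrary: n)
  case (Suc k)
  have "sc (c ^ m) (a m (sc (c ^ (n - m)) u)) = sc (c ^ n) (a m u)" if "m \<in> {1..n}" for m u
    using that assms by (auto simp: lin_scale scale_scale simp flip: power_add)
  then show ?case by (simp add: Suc scale_sum_right)
qed simp

lemma exp_coeff_scale:
  assumes "\<And>m. 0 < m \<Longrightarrow> lin (a m)"
  shows "exp_coeff sc (\<lambda>m u. sc (c ^ m) (a m u)) n w = sc (c ^ n) (exp_coeff sc a n w)"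
  by (simp add: exp_coeff_def pow_coeff_scale[OF assms] scale_sum_right scale_scale mult.commute)

text \<open>The coefficient of z^n in a(z)^i b(z)^j, for the exponents a(z) and b(z) with
  coefficients \<open>a\<close> and \<open>b\<close>.\<close>

definition pow_conv where
  "pow_conv a b i j n w = (\<Sum>p\<le>n. pow_coeff a i p (pow_coeff b j (n - p) w :: 'w))"

lemma sum_pow_conv_left:
  assumes a: "\<And>m. 0 < m \<Longrightarrow> lin (a m)"
  shows "(\<Sum>m=1..n. a m (pow_conv a b i j (n - m) w)) = pow_conv a b (Suc i) j n w"
proof -
  have "(\<Sum>m=1..n. a m (pow_conv a b i j (n - m) w))
      = (\<Sum>m=1..n. \<Sum>p\<le>n - m. a m (pow_coeff a i p (pow_coeff b j (n - m - p) w)))"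
    by (intro sum.cong) (simp_all add: pow_conv_def lin_sum[OF a])
  also have "\<dots> = (\<Sum>(m, p)\<in>Sigma {1..n} (\<lambda>m. {..n - m}). a m (pow_coeff a i p (pow_coeff b j (n - m - p) w)))"
    by (simp add: sum.Sigma)
  also have "\<dots> = (\<Sum>(p, m)\<in>Sigma {..n} (\<lambda>p. {1..p}). a m (pow_coeff a i (p - m) (pow_coeff b j (n - p) w)))"
    by (rule sum.reindex_bij_witness[where i = "\<lambda>(p, m). (m, p - m)" and j = "\<lambda>(m, p). (m + p, m)"]) auto
  also have "\<dots> = (\<Sum>p\<le>n. \<Sum>m=1..p. a m (pow_coeff a i (p - m) (pow_coeff b j (n - p) w)))"
    by (simp add: sum.Sigma)
  finally show ?thesis by (simp add: pow_conv_def)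
qed

lemma sum_pow_conv_right:
  assumes a: "\<And>m. 0 < m \<Longrightarrow> lin (a m)" and b: "\<And>m. 0 < m \<Longrightarrow> lin (b m)"
    and ab: "\<And>m m' w. 0 < m \<Longrightarrow> 0 < m' \<Longrightarrow> b m (a m' w) = a m' (b m w)"
  shows "(\<Sum>m=1..n. b m (pow_conv a b i j (n - m) w)) = pow_conv a b i (Suc j) n w"
proof -
  have "(\<Sum>m=1..n. b m (pow_conv a b i j (n - m) w))
      = (\<Sum>m=1..n. \<Sum>p\<le>n - m. pow_coeff a i p (b m (pow_coeff b j (n - m - p) w)))"
    by (intro sum.cong)
      (simp_all add: pow_conv_def lin_sum[OF b] pow_coeff_commute[OF b, where a = a] ab)
  also have "\<dots> = (\<Sum>(m, p)\<in>Sigma {1..n} (\<lambda>m. {..n - m}). pow_coeff a i p (b m (pow_coeff b j (n - m - p) w)))"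
    by (simp add: sum.Sigma)
  also have "\<dots> = (\<Sum>(p, m)\<in>Sigma {..n} (\<lambda>p. {1..n - p}). pow_coeff a i p (b m (pow_coeff b j (n - p - m) w)))"
    by (rule sum.reindex_bij_witness[where i = "\<lambda>(p, m). (m, p)" and j = "\<lambda>(m, p). (p, m)"])
      (auto simp: diff_diff_eq add.commute)
  also have "\<dots> = (\<Sum>p\<le>n. \<Sum>m=1..n - p. pow_coeff a i p (b m (pow_coeff b j (n - p - m) w)))"
    by (simp add: sum.Sigma)
  finally show ?thesis by (simp add: pow_conv_def lin_sum[OF lin_pow_coeff[of a]] a)
qed

text \<open>Binomial theorem for a(z) + b(z): the outermost factor is a(z) or b(z), the latter moves
  past the powers of a(z), and Pascal's rule collects the terms.\<close>

lemma pow_coeff_add: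
  assumes a: "\<And>m. 0 < m \<Longrightarrow> lin (a m)" and b: "\<And>m. 0 < m \<Longrightarrow> lin (b m)"
    and ab: "\<And>m m' w. 0 < m \<Longrightarrow> 0 < m' \<Longrightarrow> b m (a m' w) = a m' (b m w)"
  shows "pow_coeff (\<lambda>m u. a m u + b m u) k n w
    = (\<Sum>i\<le>k. sc (of_nat (k choose i)) (pow_conv a b i (k - i) n w))"
proof (induction k arbitrary: n)
  case 0
  have "pow_conv a b 0 0 n w = (\<Sum>p\<le>n. if p = 0 then if n = 0 then w else 0 else 0)"
    unfolding pow_conv_def by (intro sum.cong) auto
  then show ?case by (simp add: sum.delta)
next
  case (Suc k)
  let ?P = "\<lambda>i j. pow_conv a b i j n w" and ?C = "\<lambda>i. of_nat (k choose i) :: complex"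
  have "pow_coeff (\<lambda>m u. a m u + b m u) (Suc k) n w
      = (\<Sum>m=1..n. \<Sum>i\<le>k. sc (?C i) (a m (pow_conv a b i (k - i) (n - m) w)))
      + (\<Sum>m=1..n. \<Sum>i\<le>k. sc (?C i) (b m (pow_conv a b i (k - i) (n - m) w)))"
    by (simp add: Suc lin_sum[OF a] lin_sum[OF b] lin_scale[OF a] lin_scale[OF b] sum.distrib)
  also have "\<dots> = (\<Sum>i\<le>k. sc (?C i) (?P (Suc i) (k - i))) + (\<Sum>i\<le>k. sc (?C i) (?P i (Suc (k - i))))"
    by (subst (1 2) sum.swap)
      (simp only: scale_sum_right[symmetric] sum_pow_conv_left[OF a] sum_pow_conv_right[OF a b ab])
  also have "(\<Sum>i\<le>k. sc (?C i) (?P i (Suc (k - i)))) = (\<Sum>i\<le>Suc k. sc (?C i) (?P i (Suc k - i)))"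
    by (simp add: Suc_diff_le)
  also have "\<dots> = ?P 0 (Suc k) + (\<Sum>i\<le>k. sc (?C (Suc i)) (?P (Suc i) (k - i)))"
    by (subst sum.atMost_Suc_shift) simp
  also have "(\<Sum>i\<le>k. sc (?C i) (?P (Suc i) (k - i))) + \<dots>
      = ?P 0 (Suc k) + (\<Sum>i\<le>k. sc (of_nat (Suc k choose Suc i)) (?P (Suc i) (k - i)))"
    by (simp add: scale_left_distrib sum.distrib)
  also have "\<dots> = (\<Sum>i\<le>Suc k. sc (of_nat (Suc k choose i)) (?P i (Suc k - i)))"
    by (subst sum.atMost_Suc_shift) simp
  finally show ?case .
qed

lemma pow_conv_eq_0:
  assumes a: "\<And>m. 0 < m \<Longrightarrow> lin (a m)" and b: "\<And>m. 0 < m \<Longrightarrow> lin (b m)"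
    and "n < i + j"
  shows "pow_conv a b i j n w = 0"
proof -
  have "pow_coeff a i p (pow_coeff b j (n - p) w) = 0" if "p \<le> n" for p
    using assms(3) that pow_coeff_eq_0[of a p i, OF a] pow_coeff_eq_0[of b "n - p" j, OF b]
      lin_0[OF lin_pow_coeff[of a, OF a]]
    by (cases "p < i") auto
  then show ?thesis by (simp add: pow_conv_def)
qed

lemma exp_coeff_add:
  assumes a: "\<And>m. 0 < m \<Longrightarrow> lin (a m)" and b: "\<And>m. 0 < m \<Longrightarrow> lin (b m)"
    and ab: "\<And>m m' w. 0 < m \<Longrightarrow> 0 < m' \<Longrightarrow> b m (a m' w) = a m' (b m w)"
  shows "exp_coeff sc (\<lambda>m u. a m u + b m u) n w = (\<Sum>p\<le>n. exp_coeff sc a p (exp_coeff sc b (n - p) w))"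
proof -
  let ?f = "\<lambda>i j. sc (1 / (fact i * fact j)) (pow_conv a b i j n w)"
  have "of_nat (k choose i) / fact k = (1 / (fact i * fact (k - i)) :: complex)" if "i \<le> k" for k i
    using that by (simp add: binomial_fact field_simps)
  then have "exp_coeff sc (\<lambda>m u. a m u + b m u) n w = (\<Sum>k\<le>n. \<Sum>i\<le>k. ?f i (k - i))"
    by (simp add: exp_coeff_def pow_coeff_add[OF a b ab] scale_sum_right)
  also have "\<dots> = (\<Sum>(i, j)\<in>{(i, j). i + j \<le> n}. ?f i j)"
    by (rule sum.triangle_reindex_eq[symmetric])
  \<comment> \<open>The square adds only zeros, since a(z)^i b(z)^j starts at z^(i+j); on the square
    the sum factorizes into two exponentials.\<close>
  also have "\<dots> = (\<Sum>(i, j)\<in>{..n} \<times> {..n}. ?f i j)"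
  proof (rule sum.mono_neutral_left)
    show "\<forall>p\<in>{..n} \<times> {..n} - {(i, j). i + j \<le> n}. (case p of (i, j) \<Rightarrow> ?f i j) = 0"
    proof
      fix p assume p: "p \<in> {..n} \<times> {..n} - {(i, j). i + j \<le> n}"
      obtain i j where ij: "p = (i, j)" by (cases p)
      then have "n < i + j" using p by auto
      then have "pow_conv a b i j n w = 0"
        by (intro pow_conv_eq_0) (use a b in auto)
      then show "(case p of (i, j) \<Rightarrow> ?f i j) = 0" by (simp add: ij)
    qed
  qed auto
  also have "\<dots> = (\<Sum>i\<le>n. \<Sum>j\<le>n. ?f i j)"
    by (simp add: sum.cartesian_product)
  also have "\<dots> = (\<Sum>i\<le>n. \<Sum>j\<le>n. \<Sum>p\<le>n. sc (1 / fact i) (pow_coeff a i p (sc (1 / fact j) (pow_coeff b j (n - p) w))))"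
    by (simp add: pow_conv_def scale_sum_right lin_scale[OF lin_pow_coeff[of a, OF a]] scale_scale)
  also have "\<dots> = (\<Sum>p\<le>n. \<Sum>i\<le>n. \<Sum>j\<le>n. sc (1 / fact i) (pow_coeff a i p (sc (1 / fact j) (pow_coeff b j (n - p) w))))"
    by (subst (2) sum.swap, subst sum.swap) simp
  also have "\<dots> = (\<Sum>p\<le>n. exp_coeff sc a p (exp_coeff sc b (n - p) w))"
    by (intro sum.cong refl)
      (simp add: exp_coeff_upto[where a = a and N = n] exp_coeff_upto[where a = b and N = n] a b
        lin_sum[OF lin_pow_coeff[of a, OF a]] scale_sum_right)
  finally show ?thesis .
qed

text \<open>Seed modes agree with their fermionic realization only on \<open>S\<close>. Each
  application must therefore be known to land in \<open>S\<close> before the next one can be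
  compared, so equality and membership are proved together.\<close>

lemma pow_coeff_cong_on:
  assumes S: "subspace S" and f: "\<And>m u. 0 < m \<Longrightarrow> u \<in> S \<Longrightarrow> f m u = g m u \<and> g m u \<in> S" and w: "w \<in> S"
  shows "pow_coeff f k n w = pow_coeff g k n w \<and> pow_coeff g k n w \<in> S"
proof (induction k arbitrary: n)
  case 0
  then show ?case using w subspace_0[OF S] by simp
next
  case (Suc k)
  have *: "f m (pow_coeff f k (n - m) w) = g m (pow_coeff g k (n - m) w) \<and> g m (pow_coeff g k (n - m) w) \<in> S"
    if "m \<in> {1..n}" for m
    using Suc[of "n - m"] f[of m "pow_coeff g k (n - m) w"] that by auto
  then show ?case
    by (auto intro!: subspace_sum[OF S] sum.cong)
qed

lemma exp_coeff_cong_on: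
  assumes S: "subspace S" and f: "\<And>m u. 0 < m \<Longrightarrow> u \<in> S \<Longrightarrow> f m u = g m u \<and> g m u \<in> S" and w: "w \<in> S"
  shows "exp_coeff sc f n w = exp_coeff sc g n w \<and> exp_coeff sc g n w \<in> S"
proof -
  note p = pow_coeff_cong_on[where f = f and g = g, OF S f w]
  show ?thesis
    unfolding exp_coeff_def using p by (auto intro!: subspace_sum[OF S] subspace_scale[OF S])
qed

lemma osc_coeff_cong_on:
  assumes S: "subspace S" and f: "\<And>m u. m \<noteq> 0 \<Longrightarrow> u \<in> S \<Longrightarrow> f m u = g m u \<and> g m u \<in> S" and w: "w \<in> S"
  shows "osc_coeff sc f n w = osc_coeff sc g n w \<and> osc_coeff sc g n w \<in> S"
proof -
  have p: "exp_coeff sc (\<lambda>m. f (int m)) k u = exp_coeff sc (\<lambda>m. g (int m)) k u \<and> exp_coeff sc (\<lambda>m. g (int m)) k u \<in> S"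
    if "u \<in> S" for k u
    by (rule exp_coeff_cong_on[OF S _ that]) (rule f, simp_all)
  have m: "exp_coeff sc (\<lambda>m. f (- int m)) k u = exp_coeff sc (\<lambda>m. g (- int m)) k u \<and> exp_coeff sc (\<lambda>m. g (- int m)) k u \<in> S"
    if "u \<in> S" for k u
    by (rule exp_coeff_cong_on[OF S _ that]) (rule f, simp_all)
  show ?thesis
  proof
    show "osc_coeff sc f n w = osc_coeff sc g n w"
      unfolding osc_coeff_def using p[OF w] m by (intro arg_cong[where f = Sum_any] ext) simp
    show "osc_coeff sc g n w \<in> S"
      unfolding osc_coeff_def using p[OF w] m subspace_0[OF S] by (intro subspace_Sum_any[OF S]) auto
  qed
qed


subsection \<open>Coefficients of vertex operators\<close>

definition creation_coeff :: "(int \<Rightarrow> 'w \<Rightarrow> 'w) \<Rightarrow> int \<Rightarrow> 'w \<Rightarrow> 'w" where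
  "creation_coeff a n w = (if 0 \<le> n then exp_coeff sc (\<lambda>m. a (- int m)) (nat n) w else 0)"

definition annihilation_coeff :: "(int \<Rightarrow> 'w \<Rightarrow> 'w) \<Rightarrow> nat \<Rightarrow> 'w \<Rightarrow> 'w" where
  "annihilation_coeff a n w = exp_coeff sc (\<lambda>m. a (int m)) n w"

text \<open>This makes the sum in \<open>osc_coeff\<close> finite on each vector; for infinite
  support \<open>Sum_any\<close> would return the default value 0.\<close>

definition locally_finite :: "(int \<Rightarrow> 'w \<Rightarrow> 'w) \<Rightarrow> bool" where
  "locally_finite a \<longleftrightarrow> (\<forall>w. \<exists>K. \<forall>n>K. annihilation_coeff a n w = 0)"

definition lin_modes :: "(int \<Rightarrow> 'w \<Rightarrow> 'w) \<Rightarrow> bool" where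
  "lin_modes a \<longleftrightarrow> (\<forall>m. m \<noteq> 0 \<longrightarrow> lin (a m))"

definition commutes_with_modes :: "('w \<Rightarrow> 'w) \<Rightarrow> (int \<Rightarrow> 'w \<Rightarrow> 'w) \<Rightarrow> bool" where
  "commutes_with_modes f a \<longleftrightarrow> (\<forall>m w. m \<noteq> 0 \<longrightarrow> f (a m w) = a m (f w))"

lemma lin_creation_coeff: "lin_modes a \<Longrightarrow> lin (creation_coeff a n)"
  unfolding creation_coeff_def[abs_def] lin_modes_def
  by (cases "0 \<le> n") (simp_all add: lin_zero_fun lin_exp_coeff)

lemma lin_annihilation_coeff: "lin_modes a \<Longrightarrow> lin (annihilation_coeff a n)"
  unfolding annihilation_coeff_def[abs_def] lin_modes_def by (simp add: lin_exp_coeff)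

lemma creation_coeff_0: "lin_modes a \<Longrightarrow> creation_coeff a n 0 = 0"
  and annihilation_coeff_0: "lin_modes a \<Longrightarrow> annihilation_coeff a k 0 = 0"
  by (simp_all add: lin_0 lin_creation_coeff lin_annihilation_coeff)

lemma creation_coeff_neg: "n < 0 \<Longrightarrow> creation_coeff a n w = 0"
  by (simp add: creation_coeff_def)

lemma osc_coeff_expand:
  assumes lin: "lin_modes a" and K: "\<forall>n>K. annihilation_coeff a n w = 0"
  shows "osc_coeff sc a n w = (\<Sum>k\<le>K. creation_coeff a (n + int k) (annihilation_coeff a k w))"
proof -
  have "osc_coeff sc a n w = Sum_any (\<lambda>k. creation_coeff a (n + int k) (annihilation_coeff a k w))"
    by (simp add: osc_coeff_def creation_coeff_def annihilation_coeff_def)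
  moreover have "{k. creation_coeff a (n + int k) (annihilation_coeff a k w) \<noteq> 0} \<subseteq> {..K}"
  proof
    fix k assume "k \<in> {k. creation_coeff a (n + int k) (annihilation_coeff a k w) \<noteq> 0}"
    then have "\<not> K < k" using K creation_coeff_0[OF lin] by auto
    then show "k \<in> {..K}" by simp
  qed
  ultimately show ?thesis
    by (simp add: Sum_any.expand_superset)
qed

lemma lin_osc_coeff:
  assumes a: "lin_modes a" and fin: "locally_finite a"
  shows "lin (osc_coeff sc a n)"
  unfolding lin_iff
proof (intro conjI allI)
  note linc = lin_creation_coeff[OF a] and lina = lin_annihilation_coeff[OF a]
  fix x y c
  obtain K L where K: "\<forall>n>K. annihilation_coeff a n x = 0" and L: "\<forall>n>L. annihilation_coeff a n y = 0"
    using fin unfolding locally_finite_def by metis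
  have 1: "\<forall>n>max K L. annihilation_coeff a n x = 0" "\<forall>n>max K L. annihilation_coeff a n y = 0"
    using K L by simp_all
  then have 2: "\<forall>n>max K L. annihilation_coeff a n (x + y) = 0" "\<forall>n>max K L. annihilation_coeff a n (sc c x) = 0"
    by (simp_all add: lin_add[OF lina] lin_scale[OF lina])
  show "osc_coeff sc a n (x + y) = osc_coeff sc a n x + osc_coeff sc a n y"
    unfolding osc_coeff_expand[OF a 1(1)] osc_coeff_expand[OF a 1(2)] osc_coeff_expand[OF a 2(1)]
    by (simp add: lin_add[OF lina] lin_add[OF linc] sum.distrib)
  show "osc_coeff sc a n (sc c x) = sc c (osc_coeff sc a n x)"
    unfolding osc_coeff_expand[OF a 1(1)] osc_coeff_expand[OF a 2(2)]
    by (simp add: lin_scale[OF lina] lin_scale[OF linc] scale_sum_right)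
qed

lemma creation_coeff_commute:
  assumes "lin f" "commutes_with_modes f a"
  shows "f (creation_coeff a n w) = creation_coeff a n (f w)"
  unfolding creation_coeff_def using assms
  by (simp add: lin_0 exp_coeff_commute[of f] commutes_with_modes_def)

lemma annihilation_coeff_commute:
  assumes "lin f" "commutes_with_modes f a"
  shows "f (annihilation_coeff a n w) = annihilation_coeff a n (f w)"
  unfolding annihilation_coeff_def using assms by (simp add: exp_coeff_commute[of f] commutes_with_modes_def)

lemma osc_coeff_commute:
  assumes a: "lin_modes a" and fin: "locally_finite a" and f: "lin f" "commutes_with_modes f a"
  shows "f (osc_coeff sc a n w) = osc_coeff sc a n (f w)"
proof -
  obtain K where K: "\<forall>n>K. annihilation_coeff a n w = 0"
    using fin unfolding locally_finite_def by metis
  have 2: "\<forall>n>K. annihilation_coeff a n (f w) = 0"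
    using K f by (simp add: annihilation_coeff_commute[OF f, symmetric] lin_0)
  show ?thesis
    unfolding osc_coeff_expand[OF a K] osc_coeff_expand[OF a 2]
    by (simp add: lin_sum[OF f(1)] creation_coeff_commute[OF f] annihilation_coeff_commute[OF f])
qed

text \<open>Annihilation in degree k contributes c^-k and creation in degree n + k contributes
  c^(n+k), so every term gets the same factor.\<close>

lemma osc_coeff_scale:
  assumes a: "lin_modes a" and fin: "locally_finite a" and c: "c \<noteq> 0"
  shows "osc_coeff sc (\<lambda>m u. sc (c powi (- m)) (a m u)) n w = sc (c powi n) (osc_coeff sc a n w)"
proof -
  let ?b = "\<lambda>m u. sc (c powi (- m)) (a m u)"
  have ann: "annihilation_coeff ?b k u = sc (c powi (- int k)) (annihilation_coeff a k u)" for k u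
    using exp_coeff_scale[of "\<lambda>m. a (int m)" "inverse c" k u] a
    by (simp add: annihilation_coeff_def power_int_minus power_inverse lin_modes_def)
  have cre: "creation_coeff ?b k u = sc (c powi k) (creation_coeff a k u)" for k u
    using exp_coeff_scale[of "\<lambda>m. a (- int m)" c "nat k" u] a
    by (simp add: creation_coeff_def power_int_def lin_modes_def)
  obtain K where K: "\<forall>n>K. annihilation_coeff a n w = 0"
    using fin unfolding locally_finite_def by metis
  have 2: "\<forall>n>K. annihilation_coeff ?b n w = 0"
    using K by (simp add: ann)
  have b: "lin_modes ?b" using a lin_sc unfolding lin_modes_def by blast
  have e: "c powi (n + int k) * c powi (- int k) = c powi n" for k
    using c by (simp flip: power_int_add)
  show ?thesis
    unfolding osc_coeff_expand[OF a K] osc_coeff_expand[OF b 2]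
    by (simp add: ann cre lin_scale[OF lin_creation_coeff[OF a]] e scale_sum_right mult.commute[of "_ powi (- _)"]
      del: power_int_minus)
qed

context
  fixes a b :: "int \<Rightarrow> 'w \<Rightarrow> 'w"
  assumes a: "lin_modes a" and b: "lin_modes b"
    and ab: "\<And>m. m \<noteq> 0 \<Longrightarrow> commutes_with_modes (b m) a"
begin

lemmas linca = lin_creation_coeff[OF a] and lincb = lin_creation_coeff[OF b]
  and linaa = lin_annihilation_coeff[OF a] and linab = lin_annihilation_coeff[OF b]

lemma lin_modes_plus: "lin_modes (\<lambda>m u. a m u + b m u)"
  using a b lin_plus unfolding lin_modes_def by blast

lemma annihilation_coeff_plus:
  "annihilation_coeff (\<lambda>m u. a m u + b m u) n w = (\<Sum>p\<le>n. annihilation_coeff a p (annihilation_coeff b (n - p) w))"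
  unfolding annihilation_coeff_def by (rule exp_coeff_add) (use a b ab in \<open>auto simp: lin_modes_def commutes_with_modes_def\<close>)

lemma creation_coeff_plus:
  assumes "I \<supseteq> {0..n}" "finite I"
  shows "creation_coeff (\<lambda>m u. a m u + b m u) n w = (\<Sum>p\<in>I. creation_coeff a p (creation_coeff b (n - p) w))"
proof (cases "0 \<le> n")
  case True
  have "(\<Sum>p\<in>I. creation_coeff a p (creation_coeff b (n - p) w))
      = (\<Sum>p\<in>{0..n}. creation_coeff a p (creation_coeff b (n - p) w))"
    by (rule sum.mono_neutral_right) (use assms in \<open>auto simp: creation_coeff_neg creation_coeff_0[OF a] not_le\<close>)
  also have "\<dots> = (\<Sum>p\<le>nat n. creation_coeff a (int p) (creation_coeff b (n - int p) w))"
    by (rule sum.reindex_bij_witness[where i = int and j = nat]) (use True in auto)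
  also have "\<dots> = creation_coeff (\<lambda>m u. a m u + b m u) n w"
  proof -
    have "exp_coeff sc (\<lambda>m u. a (- int m) u + b (- int m) u) (nat n) w
      = (\<Sum>p\<le>nat n. exp_coeff sc (\<lambda>m. a (- int m)) p (exp_coeff sc (\<lambda>m. b (- int m)) (nat n - p) w))"
      by (rule exp_coeff_add) (use a b ab in \<open>auto simp: lin_modes_def commutes_with_modes_def\<close>)
    then show ?thesis
      using True by (auto simp: creation_coeff_def nat_diff_distrib intro!: sum.cong)
  qed
  finally show ?thesis ..
next
  case False
  have "creation_coeff a p (creation_coeff b (n - p) w) = 0" for p
    using False by (cases "0 \<le> p") (simp_all add: creation_coeff_neg creation_coeff_0[OF a])
  then show ?thesis using False by (simp add: creation_coeff_def)
qed

lemma commutes_with_annihilation: "m \<noteq> 0 \<Longrightarrow> b m (annihilation_coeff a i w) = annihilation_coeff a i (b m w)"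
  using a b ab annihilation_coeff_commute[of "b m" a] by (simp add: lin_modes_def)

lemma annihilation_commutes_with_modes: "commutes_with_modes (annihilation_coeff a i) b"
  by (simp add: commutes_with_modes_def commutes_with_annihilation)

lemmas annihilation_annihilation_commute = annihilation_coeff_commute[OF linaa annihilation_commutes_with_modes]
lemmas annihilation_creation_commute = creation_coeff_commute[OF linaa annihilation_commutes_with_modes]

context
  fixes w :: 'w and K :: nat
  assumes Ka: "\<forall>n>K. annihilation_coeff a n w = 0" and Kb: "\<forall>n>K. annihilation_coeff b n w = 0"
begin

lemma annihilation_both_eq_0: "K < i \<or> K < j \<Longrightarrow> annihilation_coeff a i (annihilation_coeff b j w) = 0"
  using Ka Kb annihilation_coeff_0[OF a] annihilation_coeff_0[OF b] annihilation_annihilation_commute by metis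

lemma annihilation_coeff_plus_eq_0:
  assumes "2 * K < n" shows "annihilation_coeff (\<lambda>m u. a m u + b m u) n w = 0"
  unfolding annihilation_coeff_plus
proof (intro sum.neutral ballI)
  fix p assume "p \<in> {..n}"
  then have "K < p \<or> K < n - p" using assms by auto
  then show "annihilation_coeff a p (annihilation_coeff b (n - p) w) = 0" by (rule annihilation_both_eq_0)
qed

lemma osc_osc_expand:
  "osc_coeff sc a n' (osc_coeff sc b j w) =
     (\<Sum>i\<le>K. \<Sum>l\<le>K. creation_coeff a (n' + int i) (creation_coeff b (j + int l)
        (annihilation_coeff a i (annihilation_coeff b l w))))"
proof -
  have *: "annihilation_coeff a i (osc_coeff sc b j w) =
      (\<Sum>l\<le>K. creation_coeff b (j + int l) (annihilation_coeff a i (annihilation_coeff b l w)))" for i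
    unfolding osc_coeff_expand[OF b Kb] by (simp add: lin_sum[OF linaa] annihilation_creation_commute)
  have "\<forall>i>K. annihilation_coeff a i (osc_coeff sc b j w) = 0"
    unfolding * by (simp add: annihilation_both_eq_0 lin_0[OF lincb])
  from osc_coeff_expand[OF a this] show ?thesis
    by (simp add: * lin_sum[OF linca])
qed

lemma osc_osc_eq_0:
  assumes "j \<notin> {- int K..n + int K}"
  shows "osc_coeff sc a (n - j) (osc_coeff sc b j w) = 0"
  unfolding osc_osc_expand
proof (intro sum.neutral ballI)
  fix i l assume "i \<in> {..K}" "l \<in> {..K}"
  then have "j + int l < 0 \<or> n - j + int i < 0" using assms by auto
  then show "creation_coeff a (n - j + int i) (creation_coeff b (j + int l)
      (annihilation_coeff a i (annihilation_coeff b l w))) = 0"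
    by (auto simp: creation_coeff_neg creation_coeff_0[OF a])
qed

text \<open>All modes of \<open>a\<close> commute with all modes of \<open>b\<close>, so the four
  exponentials regroup into two normally ordered pairs. With annihilation degrees at most
  \<open>K\<close>, both creation degrees can be nonnegative only for j between -K and n + K, and
  this window carries the whole convolution.\<close>

lemma osc_coeff_plus_sum:
  "osc_coeff sc (\<lambda>m u. a m u + b m u) n w =
     (\<Sum>j\<in>{- int K..n + int K}. osc_coeff sc a (n - j) (osc_coeff sc b j w))"
proof -
  let ?c = "\<lambda>m u. a m u + b m u"
  note lincc = lin_creation_coeff[OF lin_modes_plus]
  let ?g = "\<lambda>i l. creation_coeff ?c (n + int i + int l) (annihilation_coeff a i (annihilation_coeff b l w))"
  have "osc_coeff sc ?c n w = (\<Sum>k\<le>2 * K. creation_coeff ?c (n + int k) (annihilation_coeff ?c k w))"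
    using annihilation_coeff_plus_eq_0 by (intro osc_coeff_expand[OF lin_modes_plus]) simp
  also have "\<dots> = (\<Sum>k\<le>2 * K. \<Sum>i\<le>k. ?g i (k - i))"
    by (intro sum.cong refl) (auto simp: annihilation_coeff_plus lin_sum[OF lincc] intro!: sum.cong)
  also have "\<dots> = (\<Sum>(i, l)\<in>{(i, l). i + l \<le> 2 * K}. ?g i l)"
    by (rule sum.triangle_reindex_eq[symmetric])
  also have "\<dots> = (\<Sum>(i, l)\<in>{..K} \<times> {..K}. ?g i l)"
  proof (rule sum.mono_neutral_right)
    show "finite {(i, l). i + l \<le> 2 * K}"
      by (rule finite_subset[of _ "{..2 * K} \<times> {..2 * K}"]) auto
    show "\<forall>p\<in>{(i, l). i + l \<le> 2 * K} - {..K} \<times> {..K}. (case p of (i, l) \<Rightarrow> ?g i l) = 0"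
    proof
      fix p assume p: "p \<in> {(i, l). i + l \<le> 2 * K} - {..K} \<times> {..K}"
      obtain i l where il: "p = (i, l)" by (cases p)
      then have "K < i \<or> K < l" using p by auto
      then show "(case p of (i, l) \<Rightarrow> ?g i l) = 0"
        by (simp add: il annihilation_both_eq_0 lin_0[OF lincc])
    qed
  qed auto
  also have "\<dots> = (\<Sum>i\<le>K. \<Sum>l\<le>K. ?g i l)"
    by (simp add: sum.cartesian_product)
  also have "\<dots> = (\<Sum>i\<le>K. \<Sum>l\<le>K. \<Sum>j\<in>{- int K..n + int K}.
      creation_coeff a (n - j + int i) (creation_coeff b (j + int l) (annihilation_coeff a i (annihilation_coeff b l w))))"
  proof (intro sum.cong refl)
    fix i l assume il: "i \<in> {..K}" "l \<in> {..K}"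
    let ?u = "annihilation_coeff a i (annihilation_coeff b l w)"
    have "?g i l = (\<Sum>p\<in>{int i - int K..n + int i + int K}. creation_coeff a p (creation_coeff b (n + int i + int l - p) ?u))"
      by (rule creation_coeff_plus) (use il in auto)
    also have "\<dots> = (\<Sum>j\<in>{- int K..n + int K}. creation_coeff a (n - j + int i) (creation_coeff b (j + int l) ?u))"
      by (rule sum.reindex_bij_witness[where i = "\<lambda>j. n - j + int i" and j = "\<lambda>p. n - p + int i"])
        (auto simp: algebra_simps)
    finally show "?g i l = \<dots>" .
  qed
  also have "\<dots> = (\<Sum>j\<in>{- int K..n + int K}. osc_coeff sc a (n - j) (osc_coeff sc b j w))"
    unfolding osc_osc_expand by (subst (2) sum.swap, subst sum.swap) simp
  finally show ?thesis .
qed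

end

lemma locally_finite_plus:
  assumes "locally_finite a" "locally_finite b"
  shows "locally_finite (\<lambda>m u. a m u + b m u)"
  unfolding locally_finite_def
proof
  fix w
  obtain K L where K: "\<forall>n>K. annihilation_coeff a n w = 0" and L: "\<forall>n>L. annihilation_coeff b n w = 0"
    using assms unfolding locally_finite_def by metis
  then have "\<forall>n>max K L. annihilation_coeff a n w = 0" "\<forall>n>max K L. annihilation_coeff b n w = 0"
    by simp_all
  from annihilation_coeff_plus_eq_0[OF this]
  show "\<exists>K. \<forall>n>K. annihilation_coeff (\<lambda>m u. a m u + b m u) n w = 0" by blast
qed

lemma osc_coeff_plus:
  assumes "locally_finite a" "locally_finite b"
  shows "osc_coeff sc (\<lambda>m u. a m u + b m u) n w = Sum_any (\<lambda>j. osc_coeff sc a (n - j) (osc_coeff sc b j w))"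
    and "finite {j. osc_coeff sc a (n - j) (osc_coeff sc b j w) \<noteq> 0}"
proof -
  obtain K L where K: "\<forall>n>K. annihilation_coeff a n w = 0" and L: "\<forall>n>L. annihilation_coeff b n w = 0"
    using assms unfolding locally_finite_def by metis
  then have KL: "\<forall>n>max K L. annihilation_coeff a n w = 0" "\<forall>n>max K L. annihilation_coeff b n w = 0"
    by simp_all
  have sub: "{j. osc_coeff sc a (n - j) (osc_coeff sc b j w) \<noteq> 0} \<subseteq> {- int (max K L)..n + int (max K L)}"
    using osc_osc_eq_0[OF KL] by blast
  then show "finite {j. osc_coeff sc a (n - j) (osc_coeff sc b j w) \<noteq> 0}"
    by (rule finite_subset) simp
  show "osc_coeff sc (\<lambda>m u. a m u + b m u) n w = Sum_any (\<lambda>j. osc_coeff sc a (n - j) (osc_coeff sc b j w))"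
    unfolding osc_coeff_plus_sum[OF KL] by (rule Sum_any.expand_superset[OF _ sub, symmetric]) simp
qed

end

text \<open>The list \<open>L\<close> depends on the mode number because shifting the argument to c
  z multiplies the m-th mode by c^-m. The induction needs a stronger claim: a word of positive modes
  is applied on top of the power, and each step of the recursion moves one mode into the word while
  the total degree stays the same. Smoothness then kills words of degree above
  \<open>K\<close>.\<close>

lemma locally_finite_smooth:
  fixes v :: "'i \<Rightarrow> int \<Rightarrow> 'w \<Rightarrow> 'w"
  assumes sm: "smooth_on UNIV I v" and v: "\<And>i m. i \<in> I \<Longrightarrow> m \<noteq> 0 \<Longrightarrow> lin (v i m)"
    and L: "\<And>m. fst ` set (L m) \<subseteq> I"
  shows "locally_finite (\<lambda>m u. \<Sum>(i, c)\<leftarrow>L m. sc c (v i m u))"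
  unfolding locally_finite_def
proof
  fix w
  let ?b = "\<lambda>m u. \<Sum>(i, c)\<leftarrow>L m. sc c (v i m u)"
  define adm :: "('i \<times> int) list \<Rightarrow> bool" where "adm = (\<lambda>l. \<forall>(i, n)\<in>set l. i \<in> I \<and> 0 < n)"
  define act where "act = (\<lambda>l. foldr (\<lambda>(i, n). v i n) l)"
  define deg :: "('i \<times> int) list \<Rightarrow> int" where "deg = (\<lambda>l. \<Sum>(i, n)\<leftarrow>l. n)"
  obtain K where K: "\<And>l. adm l \<Longrightarrow> K < deg l \<Longrightarrow> act l w = 0"
    using sm unfolding smooth_on_def adm_def act_def deg_def by blast
  have lin: "lin (act l)" if "adm l" for l
    using that
  proof (induction l)
    case Nil
    then show ?case by (simp add: act_def id_def lin_ident)
  next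
    case (Cons p l)
    obtain i n where p: "p = (i, n)" by (cases p)
    have "lin (\<lambda>w. v i n (act l w))"
      by (rule lin_comp[OF v]) (use Cons in \<open>auto simp: p adm_def\<close>)
    then show ?case by (simp add: act_def p o_def)
  qed
  have pow: "act l (pow_coeff (\<lambda>m. ?b (int m)) k n w) = 0" if "adm l" "K < deg l + int n" for k l n
    using that
  proof (induction k arbitrary: l n)
    case 0
    then show ?case using K[of l] lin_0[OF lin] by simp
  next
    case (Suc k)
    have *: "act l (v i (int m) (pow_coeff (\<lambda>m. ?b (int m)) k (n - m) w)) = 0"
      if "m \<in> {1..n}" "i \<in> I" for m i
    proof -
      have "adm (l @ [(i, int m)])" "K < deg (l @ [(i, int m)]) + int (n - m)"
        using Suc.prems that by (auto simp: adm_def deg_def)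
      then have "act (l @ [(i, int m)]) (pow_coeff (\<lambda>m. ?b (int m)) k (n - m) w) = 0"
        by (rule Suc.IH)
      then show ?thesis by (simp add: act_def)
    qed
    have "act l (?b (int m) (pow_coeff (\<lambda>m. ?b (int m)) k (n - m) w)) = 0" if "m \<in> {1..n}" for m
    proof -
      let ?u = "pow_coeff (\<lambda>m. ?b (int m)) k (n - m) w"
      have "act l (sc c (v i (int m) ?u)) = 0" if "(i, c) \<in> set (L (int m))" for i c
        using * [OF \<open>m \<in> {1..n}\<close>, of i] that L[of "int m"] Suc.prems(1)
        by (force simp: lin_scale[OF lin])
      then have "(\<Sum>x\<leftarrow>L (int m). act l (case x of (i, c) \<Rightarrow> sc c (v i (int m) ?u))) = 0"
        by (intro sum_list_eq_0) auto
      then show ?thesis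
        using Suc.prems(1) by (simp add: lin_sum_list[OF lin] o_def)
    qed
    then show ?case using Suc.prems(1) by (simp add: lin_sum[OF lin])
  qed
  have "annihilation_coeff ?b n w = 0" if "nat K < n" for n
    using pow[of "[]"] that by (auto simp: annihilation_coeff_def exp_coeff_def adm_def deg_def act_def intro!: sum.neutral)
  then show "\<exists>K. \<forall>n>K. annihilation_coeff ?b n w = 0" by blast
qed

end

section \<open>Fermions\<close>

locale logarithm =
  fixes \<Gamma> :: "complex set" and lg :: "complex \<Rightarrow> complex"
  assumes branch: "log_branch \<Gamma> lg"
begin

lemma one_in: "1 \<in> \<Gamma>" and zero_notin: "0 \<notin> \<Gamma>" and inverse_in: "a \<in> \<Gamma> \<Longrightarrow> inverse a \<in> \<Gamma>"
  and mult_in: "a \<in> \<Gamma> \<Longrightarrow> b \<in> \<Gamma> \<Longrightarrow> a * b \<in> \<Gamma>" and exp_lg: "a \<in> \<Gamma> \<Longrightarrow> exp (lg a) = a"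
  and lg_mult: "a \<in> \<Gamma> \<Longrightarrow> b \<in> \<Gamma> \<Longrightarrow> lg (a * b) = lg a + lg b"
  using branch by (auto simp: log_branch_def)

lemma in_nonzero: "a \<in> \<Gamma> \<Longrightarrow> a \<noteq> 0"
  using zero_notin by metis

lemma lg_1: "lg 1 = 0"
  using lg_mult[OF one_in one_in] by simp

lemma lg_inverse: "a \<in> \<Gamma> \<Longrightarrow> lg (inverse a) = - lg a"
  using lg_mult[OF inverse_in, of a a] in_nonzero[of a] lg_1 by (simp add: eq_neg_iff_add_eq_0)

lemma power_in: "a \<in> \<Gamma> \<Longrightarrow> a ^ n \<in> \<Gamma>"
  by (induction n) (auto simp: one_in mult_in)

lemma power_int_in: "a \<in> \<Gamma> \<Longrightarrow> a powi n \<in> \<Gamma>"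
  by (simp add: power_int_def power_in inverse_in)

lemma power_int_eq_exp: "a \<in> \<Gamma> \<Longrightarrow> a powi n = exp (of_int n * lg a)"
  using exp_lg[of a] by (metis exp_power_int mult.commute)

lemma prod_mset_in: "set_mset A \<subseteq> \<Gamma> \<Longrightarrow> prod_mset A \<in> \<Gamma>"
  by (induction A) (auto simp: one_in mult_in)

lemma lg_prod_mset: "set_mset A \<subseteq> \<Gamma> \<Longrightarrow> lg (prod_mset A) = (\<Sum>a\<in>#A. lg a)"
  by (induction A) (auto simp: lg_1 lg_mult prod_mset_in)

text \<open>A logarithm of the quotient of the two products, chosen additively, so that complex
  powers of such quotients multiply without branch ambiguities.\<close>

definition lgsum :: "complex multiset \<Rightarrow> complex multiset \<Rightarrow> complex" where
  "lgsum A B = (\<Sum>a\<in>#A. lg a) - (\<Sum>b\<in>#B. lg b)"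

lemma lgsum_empty [simp]: "lgsum {#} {#} = 0"
  and lgsum_union [simp]: "lgsum (A + A') (B + B') = lgsum A B + lgsum A' B'"
  by (simp_all add: lgsum_def)

lemma lgsum_scaled:
  assumes "c \<in> \<Gamma>" "set_mset A \<subseteq> \<Gamma>" "set_mset B \<subseteq> \<Gamma>"
  shows "lgsum (image_mset ((*) c) A) (image_mset ((*) c) B)
    = lgsum A B + (of_nat (size A) - of_nat (size B)) * lg c"
proof -
  have "(\<Sum>a\<in>#image_mset ((*) c) A. lg a) = of_nat (size A) * lg c + (\<Sum>a\<in>#A. lg a)" if "set_mset A \<subseteq> \<Gamma>" for A
    using that assms(1) by (induction A) (auto simp: lg_mult algebra_simps)
  from this[OF assms(2)] this[OF assms(3)] show ?thesis
    by (simp add: lgsum_def algebra_simps)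
qed

lemma cpow_quotient:
  assumes "set_mset A \<subseteq> \<Gamma>" "set_mset B \<subseteq> \<Gamma>"
  shows "cpow lg (prod_mset A / prod_mset B) e = exp (e * lgsum A B)"
  using assms
  by (simp add: cpow_def lgsum_def divide_inverse lg_mult lg_inverse inverse_in prod_mset_in lg_prod_mset)

end

locale fermion_system = complex_vector_space sc + logarithm \<Gamma> lg
  for sc :: "complex \<Rightarrow> 'w \<Rightarrow> 'w::ab_group_add" and \<Gamma> lg +
  fixes F :: "'w fermion"
  assumes fermions: "fermions sc lg F"
begin

lemma raising: "lin (raising F)" "bij (raising F)"
  and charge: "lin (charge F n)"
  and charge_charge: "charge F n (charge F m w) = (if n = m then charge F m w else 0)"
  and finite_charges: "finite {n. charge F n w \<noteq> 0}" and Sum_any_charge: "Sum_any (\<lambda>n. charge F n w) = w"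
  and raising_charge: "raising F (charge F n w) = charge F (n + 1) (raising F w)"
  and fosc: "m \<noteq> 0 \<Longrightarrow> lin (fosc F m)"
  and fosc_charge: "m \<noteq> 0 \<Longrightarrow> fosc F m (charge F n w) = charge F n (fosc F m w)"
  and smooth_fosc: "smooth_on UNIV {()} (\<lambda>_. fosc F)"
  using fermions unfolding fermions_def commutes_def by ((elim conjE)?, simp)+

lemma raising_inverse [simp]: "raising F (inv (raising F) w) = w" "inv (raising F) (raising F w) = w"
  using raising(2) by (simp_all add: bij_is_inj bij_is_surj surj_f_inv_f)

lemma raising_power_0 [simp]: "raising_power F 0 w = w"
  by (simp add: raising_power_def)

lemma raising_power_succ: "raising_power F (m + 1) w = raising F (raising_power F m w)"
proof (cases "0 \<le> m")
  case True
  then have "nat (m + 1) = Suc (nat m)" by simp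
  then show ?thesis using True by (simp add: raising_power_def)
next
  case False
  then have "nat (- m) = Suc (nat (- (m + 1)))" by simp
  then have "raising F (raising_power F m w) = (inv (raising F) ^^ nat (- (m + 1))) w"
    using False by (simp add: raising_power_def)
  then show ?thesis
    using False by (cases "m = - 1") (simp_all add: raising_power_def)
qed

lemma raising_power_pred: "raising_power F (m - 1) w = inv (raising F) (raising_power F m w)"
  using raising_power_succ[of "m - 1" w] by simp

lemma raising_power_add: "raising_power F (m + n) w = raising_power F m (raising_power F n w)"
proof (induction m rule: int_induct[of _ 0])
  case (step1 m)
  then show ?case
    using raising_power_succ[of "m + n" w] raising_power_succ[of m] by (simp add: algebra_simps)
next
  case (step2 m)
  then show ?case
    using raising_power_pred[of "m + n" w] raising_power_pred[of m] by (simp add: algebra_simps)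
qed simp

lemma lin_inv_raising: "lin (inv (raising F))"
  unfolding lin_iff
proof (intro conjI allI)
  fix x y :: 'w and c :: complex
  show "inv (raising F) (x + y) = inv (raising F) x + inv (raising F) y"
    using lin_add[OF raising(1), of "inv (raising F) x" "inv (raising F) y"] by (metis raising_inverse)
  show "inv (raising F) (sc c x) = sc c (inv (raising F) x)"
    using lin_scale[OF raising(1), of c "inv (raising F) x"] by (metis raising_inverse)
qed

lemma lin_raising_power: "lin (raising_power F m)"
proof (induction m rule: int_induct[of _ 0])
  case base
  then show ?case by (simp add: lin_iff)
next
  case (step1 m)
  then show ?case
    using lin_comp[OF raising(1) step1(2)] by (simp add: raising_power_succ[abs_def])
next
  case (step2 m)
  then show ?case
    using lin_comp[OF lin_inv_raising step2(2)] by (simp add: raising_power_pred[abs_def])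
qed

lemma raising_power_eq_0_iff: "raising_power F m w = 0 \<longleftrightarrow> w = 0"
  using raising_power_add[of "- m" m w] lin_0[OF lin_raising_power] by auto

lemma charge_raising_power: "charge F (n + m) (raising_power F m w) = raising_power F m (charge F n w)"
proof (induction m arbitrary: n rule: int_induct[of _ 0])
  case (step1 m)
  then show ?case
    using raising_charge[of "n + m" "raising_power F m w"] by (simp add: raising_power_succ add.assoc)
next
  case (step2 m)
  have "raising F (charge F (n + (m - 1)) (raising_power F (m - 1) w)) = raising_power F m (charge F n w)"
    using raising_charge[of "n + (m - 1)" "raising_power F (m - 1) w"] step2(2)[of n] raising_power_succ[of "m - 1" w]
    by (simp add: algebra_simps)
  then show ?case
    by (metis raising_inverse(2) raising_power_pred)
qed simp

lemma raising_power_commute: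
  assumes "\<And>w. f (raising F w) = raising F (f w)"
  shows "f (raising_power F m w) = raising_power F m (f w)"
proof (induction m rule: int_induct[of _ 0])
  case (step1 m)
  then show ?case by (simp add: raising_power_succ assms)
next
  case (step2 m)
  have "f (inv (raising F) w) = inv (raising F) (f w)" for w
    using assms[of "inv (raising F) w"] by (metis raising_inverse)
  with step2 show ?case by (simp add: raising_power_pred)
qed simp

lemma pure_charge: "charge F n w = w \<Longrightarrow> charge F m w = (if m = n then w else 0)"
  using charge_charge[of m n w] by simp

lemma Sum_any_pure:
  assumes "charge F n w = w" "\<And>m. T m 0 = 0"
  shows "Sum_any (\<lambda>m. T m (charge F m w)) = T n w"
proof -
  have "Sum_any (\<lambda>m. T m (charge F m w)) = (\<Sum>m\<in>{n}. T m (charge F m w))"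
    by (rule Sum_any.expand_superset) (use assms in \<open>auto simp: pure_charge[OF assms(1)] split: if_splits\<close>)
  then show ?thesis by (simp add: assms)
qed

abbreviation excess :: "complex multiset \<Rightarrow> complex multiset \<Rightarrow> int" where
  "excess A B \<equiv> int (size A) - int (size B)"

lemma nord_zero_pure:
  assumes "charge F n w = w" "set_mset A \<subseteq> \<Gamma>" "set_mset B \<subseteq> \<Gamma>"
  shows "nord_zero sc lg F A B r w =
    (let e = offset F + of_int n + of_int (excess A B) / 2 in
     if r = of_int (excess A B) * e then sc (exp (e * lgsum A B)) (raising_power F (excess A B) w) else 0)"
proof -
  let ?m = "excess A B"
  let ?T = "\<lambda>n u. if r = of_int ?m * (offset F + of_int n + of_int ?m / 2)
    then sc (exp ((offset F + of_int n + of_int ?m / 2) * lgsum A B)) (raising_power F ?m u) else 0"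
  have "nord_zero sc lg F A B r w = Sum_any (\<lambda>n. ?T n (charge F n w))"
    unfolding nord_zero_def Let_def cpow_quotient[OF assms(2,3)] by simp
  also have "\<dots> = ?T n w"
    by (rule Sum_any_pure[OF assms(1)]) (simp add: lin_0[OF lin_raising_power])
  finally show ?thesis by (simp add: Let_def)
qed

lemma lin_Sum_any_fun:
  fixes T :: "'i \<Rightarrow> 'w \<Rightarrow> 'w"
  assumes "\<And>x. lin (T x)" "\<And>w. finite {x. T x w \<noteq> 0}"
  shows "lin (\<lambda>w. Sum_any (\<lambda>x. T x w))"
  unfolding lin_iff
proof (intro conjI allI)
  fix u v :: 'w and c :: complex
  show "Sum_any (\<lambda>x. T x (u + v)) = Sum_any (\<lambda>x. T x u) + Sum_any (\<lambda>x. T x v)"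
    by (simp add: lin_add[OF assms(1)] Sum_any.distrib assms(2))
  show "Sum_any (\<lambda>x. T x (sc c u)) = sc c (Sum_any (\<lambda>x. T x u))"
    by (simp add: lin_scale[OF assms(1)] lin_Sum_any[OF lin_sc[OF lin_ident] assms(2)])
qed

lemma lin_if: "lin f \<Longrightarrow> lin (\<lambda>w. if P then f w else 0)"
  by (cases P) (simp_all add: lin_zero_fun)

lemma lin_nord_zero: "lin (nord_zero sc lg F A B r)"
proof -
  define T where "T = (\<lambda>n w. let e = offset F + of_int n + of_int (excess A B) / 2 in
     if r = of_int (excess A B) * e then sc (cpow lg (prod_mset A / prod_mset B) e) (raising_power F (excess A B) w) else 0)"
  have T: "lin (T n)" for n
    unfolding T_def Let_def by (rule lin_if, rule lin_sc, rule lin_raising_power)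
  have "nord_zero sc lg F A B r = (\<lambda>w. Sum_any (\<lambda>n. T n (charge F n w)))"
    by (intro ext) (simp only: nord_zero_def T_def Let_def)
  moreover have "lin (\<lambda>w. Sum_any (\<lambda>n. T n (charge F n w)))"
  proof (rule lin_Sum_any_fun)
    show "lin (\<lambda>w. T n (charge F n w))" for n by (rule lin_comp[OF T charge])
    show "finite {n. T n (charge F n w) \<noteq> 0}" for w
      by (rule finite_subset[OF _ finite_charges[of w]]) (use lin_0[OF T] in auto)
  qed
  ultimately show ?thesis by simp
qed

lemma nord_modes_eq:
  "nord_modes sc F A B = (\<lambda>m u. \<Sum>(i, c)\<leftarrow>[((), - (((\<Sum>c\<in>#A. c powi (-m)) - (\<Sum>c\<in>#B. c powi (-m))) / of_int m))]. sc c (fosc F m u))"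
  by (intro ext) (simp add: nord_modes_def)

lemma lin_modes_nord_modes: "lin_modes (nord_modes sc F A B)"
  unfolding lin_modes_def nord_modes_def[abs_def] using lin_sc[OF fosc] by blast

lemma locally_finite_nord_modes: "locally_finite (nord_modes sc F A B)"
  unfolding nord_modes_eq by (rule locally_finite_smooth[OF smooth_fosc]) (use fosc in auto)

lemma commutes_with_nord_modes:
  assumes "lin f" "\<And>m w. m \<noteq> 0 \<Longrightarrow> f (fosc F m w) = fosc F m (f w)"
  shows "commutes_with_modes f (nord_modes sc F A B)"
  unfolding commutes_with_modes_def nord_modes_def
proof (intro allI impI)
  fix m :: int and w c assume "m \<noteq> 0"
  show "f (sc c (fosc F m w)) = sc c (fosc F m (f w))" for c
    by (simp only: lin_scale[OF assms(1)] assms(2)[OF \<open>m \<noteq> 0\<close>])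
qed

lemma nord_osc_commute:
  assumes "lin f" "\<And>m w. m \<noteq> 0 \<Longrightarrow> f (fosc F m w) = fosc F m (f w)"
  shows "f (osc_coeff sc (nord_modes sc F A B) n w) = osc_coeff sc (nord_modes sc F A B) n (f w)"
  by (rule osc_coeff_commute[OF lin_modes_nord_modes locally_finite_nord_modes assms(1) commutes_with_nord_modes[OF assms]])

lemma charge_nord_osc:
  "charge F m (osc_coeff sc (nord_modes sc F A B) n w) = osc_coeff sc (nord_modes sc F A B) n (charge F m w)"
  by (rule nord_osc_commute) (simp_all add: charge fosc_charge)

lemma nord_field_pure:
  assumes w: "charge F n w = w" and AB: "set_mset A \<subseteq> \<Gamma>" "set_mset B \<subseteq> \<Gamma>"
    and e: "e = offset F + of_int n + of_int (excess A B) / 2"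
  shows "nord_field sc lg F A B (of_int (excess A B) * e + of_int p) w =
    sc (exp (e * lgsum A B)) (raising_power F (excess A B) (osc_coeff sc (nord_modes sc F A B) p w))"
proof -
  let ?m = "excess A B" and ?o = "\<lambda>j. osc_coeff sc (nord_modes sc F A B) j w"
  have "charge F n (?o j) = ?o j" for j
    by (simp add: charge_nord_osc w)
  from nord_zero_pure[OF this AB]
  \<comment> \<open>At a fixed charge the zero mode carries a single power of z, so only the
    oscillator coefficient of degree \<open>p\<close> survives in the convolution.\<close>
  have *: "nord_zero sc lg F A B (of_int ?m * e + of_int p - of_int j) (?o j) =
     (if j = p then sc (exp (e * lgsum A B)) (raising_power F ?m (?o p)) else 0)" for j
    by (auto simp: Let_def e)
  have "nord_field sc lg F A B (of_int ?m * e + of_int p) w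
      = Sum_any (\<lambda>j. if j = p then sc (exp (e * lgsum A B)) (raising_power F ?m (?o p)) else 0)"
    unfolding nord_field_def * ..
  then show ?thesis by simp
qed

lemma nord_modes_union:
  "nord_modes sc F (A + A') (B + B') m u = nord_modes sc F A B m u + nord_modes sc F A' B' m u"
  by (simp add: nord_modes_def scale_left_distrib[symmetric] diff_divide_distrib add_divide_distrib)

lemma nord_modes_scaled:
  "nord_modes sc F (image_mset ((*) c) A) (image_mset ((*) c) B) m u = sc (c powi (- m)) (nord_modes sc F A B m u)"
proof -
  have "(\<Sum>a\<in>#image_mset ((*) c) A. a powi (- m)) = c powi (- m) * (\<Sum>a\<in>#A. a powi (- m))" for A
    by (induction A) (simp_all add: power_int_mult_distrib algebra_simps)
  then show ?thesis
    by (simp add: nord_modes_def scale_scale algebra_simps)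
qed

lemma nord_modes_scaled_abs:
  "nord_modes sc F (image_mset ((*) c) A) (image_mset ((*) c) B) = (\<lambda>m u. sc (c powi (- m)) (nord_modes sc F A B m u))"
  by (intro ext nord_modes_scaled)

text \<open>The factor c^r is made of c^(m e) from the zero mode, m the excess, and c^p from the
  oscillators; the additive branch \<open>lg\<close> puts the two together.\<close>

lemma nord_field_scaled:
  assumes w: "charge F n w = w" and AB: "set_mset A \<subseteq> \<Gamma>" "set_mset B \<subseteq> \<Gamma>" and c: "c \<in> \<Gamma>"
    and r: "r = of_int (excess A B) * (offset F + of_int n + of_int (excess A B) / 2) + of_int p"
  shows "nord_field sc lg F (image_mset ((*) c) A) (image_mset ((*) c) B) r w
    = sc (cpow lg c r) (nord_field sc lg F A B r w)"
proof -
  let ?A = "image_mset ((*) c) A" and ?B = "image_mset ((*) c) B"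
  define e where "e = offset F + of_int n + of_int (excess A B) / 2"
  have AB': "set_mset ?A \<subseteq> \<Gamma>" "set_mset ?B \<subseteq> \<Gamma>" using AB c mult_in by auto
  have m: "excess ?A ?B = excess A B" by simp
  have "nord_field sc lg F ?A ?B r w = sc (exp (e * lgsum ?A ?B))
      (raising_power F (excess A B) (osc_coeff sc (nord_modes sc F ?A ?B) p w))"
    using nord_field_pure[OF w AB', of e p] by (simp add: r e_def)
  also have "\<dots> = sc (exp (e * lgsum ?A ?B) * c powi p)
      (raising_power F (excess A B) (osc_coeff sc (nord_modes sc F A B) p w))"
    unfolding nord_modes_scaled_abs
    by (simp add: osc_coeff_scale[OF lin_modes_nord_modes locally_finite_nord_modes in_nonzero[OF c]]
       lin_scale[OF lin_raising_power] scale_scale)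
  also have "exp (e * lgsum ?A ?B) * c powi p = cpow lg c r * exp (e * lgsum A B)"
    unfolding lgsum_scaled[OF c AB] power_int_eq_exp[OF c] cpow_def r e_def[symmetric] exp_add[symmetric]
    by (simp add: algebra_simps)
  finally show ?thesis
    using nord_field_pure[OF w AB, of e p] by (simp add: r e_def scale_scale)
qed

text \<open>Zero modes and oscillators see the contents only through size, product and power sums of
  the formal difference of \<open>A\<close> and \<open>B\<close>. Hence Psi(cz) and Psi*(cz) cancel
  inside the normal ordering signs, which is the mechanism of the telescoping. Adding across instead
  of subtracting avoids truncated multiset differences.\<close>

lemma nord_field_cross:
  assumes "A + B' = A' + B" "set_mset (A + A' + B + B') \<subseteq> \<Gamma>"
  shows "nord_field sc lg F A B = nord_field sc lg F A' B'"
proof -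
  have "size (A + B') = size (A' + B)" "prod_mset (A + B') = prod_mset (A' + B)"
    "(\<Sum>c\<in>#A + B'. c powi (-n)) = (\<Sum>c\<in>#A' + B. c powi (-n))" for n
    by (simp_all only: assms(1))
  then have sz: "int (size A) - int (size B) = int (size A') - int (size B')"
    and pr: "prod_mset A * prod_mset B' = prod_mset A' * prod_mset B"
    and su: "(\<Sum>c\<in>#A. c powi (-n)) - (\<Sum>c\<in>#B. c powi (-n)) = (\<Sum>c\<in>#A'. c powi (-n)) - (\<Sum>c\<in>#B'. c powi (-n))" for n
    by (simp_all add: algebra_simps flip: of_nat_add)
  have "prod_mset B \<in> \<Gamma>" "prod_mset B' \<in> \<Gamma>"
    using assms(2) by (auto intro!: prod_mset_in)
  then have "prod_mset B \<noteq> 0" "prod_mset B' \<noteq> 0"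
    using in_nonzero by blast+
  then have "prod_mset A / prod_mset B = prod_mset A' / prod_mset B'"
    using pr by (subst frac_eq_eq)
  with sz su show ?thesis
    by (intro ext) (simp only: nord_field_def nord_zero_def nord_modes_def[abs_def])
qed

lemma psi_scaled:
  assumes "charge F n w = w" "c \<in> \<Gamma>" "r = offset F + of_int n + 1 / 2 + of_int p"
  shows "nord_field sc lg F {#c#} {#} r w = sc (cpow lg c r) (psi sc lg F r w)"
  using nord_field_scaled[OF assms(1), of "{#1#}" "{#}" c r p] one_in assms by (simp add: psi_def)

lemma psi_star_scaled:
  assumes "charge F n w = w" "c \<in> \<Gamma>" "r = - (offset F + of_int n - 1 / 2) + of_int p"
  shows "nord_field sc lg F {#} {#c#} r w = sc (cpow lg c r) (psi_star sc lg F r w)"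
  using nord_field_scaled[OF assms(1), of "{#}" "{#1#}" c r p] one_in assms by (simp add: psi_star_def)

end

section \<open>Bosonized seeds\<close>

text \<open>The zero mode factors of a product of the V_i. Each V_i is taken at the exponent that
  cancels the power of z in its fermionic zero mode E^d z^(d (J + d/2)), where d is
  \<open>d i\<close> and J is \<mu> plus the charges of the factors to its right.\<close>

primrec virtual_zero_modes ::
  "('v \<Rightarrow> int) \<Rightarrow> ('v \<Rightarrow> complex \<Rightarrow> 'w \<Rightarrow> 'w) \<Rightarrow> complex \<Rightarrow> 'v list \<Rightarrow> 'w \<Rightarrow> 'w" where
  "virtual_zero_modes d V \<mu> [] w = w"
| "virtual_zero_modes d V \<mu> (i # l) w =
     V i (- (of_int (d i) * (\<mu> + of_int (\<Sum>j\<leftarrow>l. d j) + of_int (d i) / 2))) (virtual_zero_modes d V \<mu> l w)"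

primrec sum_pairs :: "('v \<Rightarrow> 'v \<Rightarrow> complex) \<Rightarrow> 'v list \<Rightarrow> complex" where
  "sum_pairs f [] = 0"
| "sum_pairs f (i # l) = (\<Sum>j\<leftarrow>l. f i j) + sum_pairs f l"

lemma sum_pairs_filter:
  assumes "\<And>i. i \<in> set l \<Longrightarrow> f k i = 0 \<and> f i k = 0"
  shows "sum_pairs f l = sum_pairs f (filter (\<lambda>i. i \<noteq> k) l)"
  using assms
proof (induction l)
  case (Cons i l)
  have "(\<Sum>j\<leftarrow>l. f i j) = (\<Sum>j\<leftarrow>filter (\<lambda>j. j \<noteq> k) l. f i j)" if "i \<in> set (i # l)"
    using Cons.prems[of i] by (induction l) auto
  moreover have "(\<Sum>j\<leftarrow>l. f k j) = 0"
    using Cons.prems by (induction l) auto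
  ultimately show ?case using Cons by auto
qed simp

lemma sum_pairs_cong:
  assumes "\<And>i j. i \<in> set l \<Longrightarrow> j \<in> set l \<Longrightarrow> f i j = g i j"
  shows "sum_pairs f l = sum_pairs g l"
  using assms by (induction l) (auto cong: map_cong)

definition scaled_content :: "('v \<Rightarrow> complex multiset) \<Rightarrow> 'v monomial \<Rightarrow> complex multiset" where
  "scaled_content A l = (\<Sum>(i, c)\<leftarrow>l. image_mset ((*) c) (A i))"

lemma scaled_content_simps [simp]:
  "scaled_content A [] = {#}"
  "scaled_content A ((i, c) # l) = image_mset ((*) c) (A i) + scaled_content A l"
  "scaled_content A (l @ l') = scaled_content A l + scaled_content A l'"
  by (simp_all add: scaled_content_def)

text \<open>On \<open>S\<close>, X_i(z) is \<open>sg i\<close> times the normally ordered product of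
  Psi(az), a in \<open>A i\<close>, and Psi*(bz), b in \<open>B i\<close>, times V_i(z). The
  contents stay abstract so that the old seed and the gauged mutated seed are both instances. At
  \<open>k\<close> the V-part is trivial, so that \<open>k\<close> is treated like the other
  vertices.\<close>

locale bosonized_seed = fermion_system sc \<Gamma> lg F
  for sc :: "complex \<Rightarrow> 'w \<Rightarrow> 'w::ab_group_add" and \<Gamma> lg F +
  fixes q :: complex and S :: "'w set" and \<Sigma> :: "('v, 'w) seed" and k :: 'v
    and sg :: "'v \<Rightarrow> complex" and A B :: "'v \<Rightarrow> complex multiset"
    and V :: "'v \<Rightarrow> complex \<Rightarrow> 'w \<Rightarrow> 'w" and v :: "'v \<Rightarrow> int \<Rightarrow> 'w \<Rightarrow> 'w"
  assumes S: "subspace S" and q_in: "q \<in> \<Gamma>" and k_vert: "k \<in> verts (quiv \<Sigma>)"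
    and content_in: "i \<in> verts (quiv \<Sigma>) \<Longrightarrow> set_mset (A i) \<subseteq> \<Gamma> \<and> set_mset (B i) \<subseteq> \<Gamma>"
    and eps_k: "i \<in> verts (quiv \<Sigma>) \<Longrightarrow> eps (quiv \<Sigma>) i k = excess (A i) (B i) \<and>
      eps (quiv \<Sigma>) k i = - excess (A i) (B i)"
    and lgsum_k: "lgsum (A k) (B k) = - 2 * lg q"
    and zmode_S: "i \<in> verts (quiv \<Sigma>) \<Longrightarrow> w \<in> S \<Longrightarrow> zmode \<Sigma> i w \<in> S"
    and modes_S: "i \<in> verts (quiv \<Sigma>) \<Longrightarrow> n \<noteq> 0 \<Longrightarrow> w \<in> S \<Longrightarrow> modes \<Sigma> i n w \<in> S"
    and V: "i \<in> verts (quiv \<Sigma>) \<Longrightarrow> lin (V i r) \<and> commutes_with_fermions F (V i r)"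
    and V_finite: "i \<in> verts (quiv \<Sigma>) \<Longrightarrow> finite {r. V i r w \<noteq> 0}"
    and V_k: "V k 0 w = w"
    and v: "i \<in> verts (quiv \<Sigma>) \<Longrightarrow> n \<noteq> 0 \<Longrightarrow> lin (v i n) \<and> commutes_with_fermions F (v i n)"
    and v_k: "v k n w = 0" and v_smooth: "smooth_on UNIV (verts (quiv \<Sigma>) - {k}) v"
    and zmode_eq: "i \<in> verts (quiv \<Sigma>) \<Longrightarrow> w \<in> S \<Longrightarrow>
      zmode \<Sigma> i w = sc (sg i) (field_times (nord_zero sc lg F (A i) (B i)) (V i) 0 w)"
    and modes_eq: "i \<in> verts (quiv \<Sigma>) \<Longrightarrow> w \<in> S \<Longrightarrow> n \<noteq> 0 \<Longrightarrow>
      modes \<Sigma> i n w = nord_modes sc F (A i) (B i) n w + v i n w"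
begin

abbreviation "I \<equiv> verts (quiv \<Sigma>)"

definition chg :: "'v \<Rightarrow> int" where
  "chg i = excess (A i) (B i)"

abbreviation lgs :: "'v \<Rightarrow> complex" where
  "lgs i \<equiv> lgsum (A i) (B i)"

text \<open>For an ordered pair of factors, the logarithm of the scalar between the zero mode
  ordering of the seed, with its power of q, and the symmetric ordering of the fermionic zero
  modes.\<close>

definition phase :: "'v \<Rightarrow> 'v \<Rightarrow> complex" where
  "phase i j = - of_int (eps (quiv \<Sigma>) i j) * lg q + (of_int (chg j) * lgs i - of_int (chg i) * lgs j) / 2"

lemma chg_k [simp]: "chg k = 0"
proof -
  have "eps (quiv \<Sigma>) k k = 0" by (simp add: eps_def)
  with eps_k[OF k_vert] show ?thesis unfolding chg_def by linarith
qed

text \<open>X_k is a multiple of q^(-2J), and moving it past E^d produces exactly the power of q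
  prescribed by \<open>eps\<close>. This is why all phases depend only on the factors at other
  vertices.\<close>

lemma phase_k: "i \<in> I \<Longrightarrow> phase k i = 0 \<and> phase i k = 0"
proof -
  assume i: "i \<in> I"
  have "eps (quiv \<Sigma>) i k = chg i" "eps (quiv \<Sigma>) k i = - chg i"
    using eps_k[OF i] unfolding chg_def by blast+
  then show ?thesis by (simp add: phase_def lgsum_k)
qed

lemma V_simps:
  assumes "i \<in> I"
  shows "charge F n (V i r w) = V i r (charge F n w)"
    "raising_power F m (V i r w) = V i r (raising_power F m w)"
    "p \<noteq> 0 \<Longrightarrow> fosc F p (V i r w) = V i r (fosc F p w)"
  using V[OF assms, of r] raising_power_commute[of "V i r"]
  by (auto simp: commutes_with_fermions_def commutes_def)

lemma field_times_pure:
  assumes i: "i \<in> I" and w: "charge F n w = w"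
  shows "field_times (nord_zero sc lg F (A i) (B i)) (V i) r w =
    (let e = offset F + of_int n + of_int (chg i) / 2 in
     sc (exp (e * lgs i)) (raising_power F (chg i) (V i (r - of_int (chg i) * e) w)))"
proof -
  let ?e = "offset F + of_int n + of_int (chg i) / 2"
  have *: "nord_zero sc lg F (A i) (B i) t (V i (r - t) w) =
     (if t = of_int (chg i) * ?e then sc (exp (?e * lgs i)) (raising_power F (chg i) (V i (r - of_int (chg i) * ?e) w)) else 0)"
    for t
    using nord_zero_pure[of n "V i (r - t) w" "A i" "B i" t] w content_in[OF i]
    by (simp add: V_simps[OF i] Let_def flip: chg_def)
  show ?thesis
    unfolding field_times_def * Let_def by simp
qed

lemma zmode_pure:
  assumes i: "i \<in> I" and w: "w \<in> S" "charge F n w = w"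
  shows "zmode \<Sigma> i w = (let e = offset F + of_int n + of_int (chg i) / 2 in
     sc (sg i * exp (e * lgs i)) (raising_power F (chg i) (V i (- (of_int (chg i) * e)) w)))"
  using zmode_eq[OF i w(1)] field_times_pure[OF i w(2), of 0] by (simp add: Let_def)

lemma lin_field_times:
  assumes i: "i \<in> I"
  shows "lin (field_times (nord_zero sc lg F (A i) (B i)) (V i) r)"
proof -
  let ?Y = "nord_zero sc lg F (A i) (B i)"
  have "lin (\<lambda>w. Sum_any (\<lambda>t. ?Y t (V i (r - t) w)))"
  proof (rule lin_Sum_any_fun)
    show "lin (\<lambda>w. ?Y t (V i (r - t) w))" for t
      using lin_comp[OF lin_nord_zero] V[OF i] by blast
    fix w
    have "{t. ?Y t (V i (r - t) w) \<noteq> 0} \<subseteq> (\<lambda>s. r - s) ` {s. V i s w \<noteq> 0}"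
    proof
      fix t assume "t \<in> {t. ?Y t (V i (r - t) w) \<noteq> 0}"
      then have "V i (r - t) w \<noteq> 0" using lin_0[OF lin_nord_zero] by auto
      then show "t \<in> (\<lambda>s. r - s) ` {s. V i s w \<noteq> 0}" by (intro image_eqI[of _ _ "r - t"]) auto
    qed
    then show "finite {t. ?Y t (V i (r - t) w) \<noteq> 0}"
      by (rule finite_subset) (simp add: V_finite[OF i])
  qed
  then show ?thesis by (simp add: field_times_def[abs_def])
qed

lemma zmode_add: "i \<in> I \<Longrightarrow> x \<in> S \<Longrightarrow> y \<in> S \<Longrightarrow> zmode \<Sigma> i (x + y) = zmode \<Sigma> i x + zmode \<Sigma> i y"
  by (simp add: zmode_eq subspace_add[OF S] lin_add[OF lin_field_times] scale_right_distrib)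

lemma virtual_zero_modes_simps:
  assumes "set l \<subseteq> I"
  shows "lin (virtual_zero_modes chg V \<mu> l)"
    "charge F n (virtual_zero_modes chg V \<mu> l w) = virtual_zero_modes chg V \<mu> l (charge F n w)"
    "p \<noteq> 0 \<Longrightarrow> fosc F p (virtual_zero_modes chg V \<mu> l w) = virtual_zero_modes chg V \<mu> l (fosc F p w)"
proof -
  have "lin (virtual_zero_modes chg V \<mu> l) \<and>
    charge F n (virtual_zero_modes chg V \<mu> l w) = virtual_zero_modes chg V \<mu> l (charge F n w) \<and>
    (p \<noteq> 0 \<longrightarrow> fosc F p (virtual_zero_modes chg V \<mu> l w) = virtual_zero_modes chg V \<mu> l (fosc F p w))"
    using assms
  proof (induction l)
    case Nil
    have "virtual_zero_modes chg V \<mu> [] = (\<lambda>w. w)" by (rule ext) simp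
    then show ?case by (simp add: lin_ident)
  next
    case (Cons i l)
    let ?U = "virtual_zero_modes chg V \<mu>"
      and ?r = "- (of_int (chg i) * (\<mu> + of_int (\<Sum>j\<leftarrow>l. chg j) + of_int (chg i) / 2))"
    have i: "i \<in> I" and IH: "lin (?U l)" "charge F n (?U l w) = ?U l (charge F n w)"
      "p \<noteq> 0 \<longrightarrow> fosc F p (?U l w) = ?U l (fosc F p w)"
      using Cons by simp_all
    have "lin (V i ?r)" using V[OF i] by blast
    then have "lin (\<lambda>w. V i ?r (?U l w))" using IH(1) by (rule lin_comp)
    moreover have eq: "?U (i # l) = (\<lambda>w. V i ?r (?U l w))"
      by (rule ext) simp
    ultimately have "lin (?U (i # l))" by simp
    then show ?case
      unfolding eq using IH(2,3) by (simp add: V_simps[OF i])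
  qed
  then show "lin (virtual_zero_modes chg V \<mu> l)"
    "charge F n (virtual_zero_modes chg V \<mu> l w) = virtual_zero_modes chg V \<mu> l (charge F n w)"
    "p \<noteq> 0 \<Longrightarrow> fosc F p (virtual_zero_modes chg V \<mu> l w) = virtual_zero_modes chg V \<mu> l (fosc F p w)"
    by blast+
qed

lemma virtual_zero_modes_filter:
  "virtual_zero_modes chg V \<mu> l w = virtual_zero_modes chg V \<mu> (filter (\<lambda>i. i \<noteq> k) l) w"
proof -
  have "(\<Sum>j\<leftarrow>filter (\<lambda>j. j \<noteq> k) l. chg j) = (\<Sum>j\<leftarrow>l. chg j)" for l
    by (induction l) auto
  then show ?thesis
    by (induction l) (auto simp: V_k)
qed

lemma sum_list_phase:
  "(\<Sum>j\<leftarrow>l. phase i j) = - of_int (\<Sum>j\<leftarrow>l. eps (quiv \<Sigma>) i j) * lg q +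
     (of_int (\<Sum>j\<leftarrow>l. chg j) * lgs i - of_int (chg i) * (\<Sum>j\<leftarrow>l. lgs j)) / 2"
  by (induction l) (simp_all add: phase_def algebra_simps add_divide_distrib diff_divide_distrib)

text \<open>Induction on the word: each X_i acts on a vector whose charge is \<open>n\<close> plus
  the charges to its right. Membership in \<open>S\<close> and the charge are carried along because
  the fermionic form of X_i is available only on \<open>S\<close> and explicit only at a single
  charge.\<close>

lemma weyl_product_pure:
  assumes "set l \<subseteq> I" "w \<in> S" "charge F n w = w"
  shows "weyl_product sc q (quiv \<Sigma>) (zmode \<Sigma>) l w \<in> S \<and>
    charge F (n + (\<Sum>j\<leftarrow>l. chg j)) (weyl_product sc q (quiv \<Sigma>) (zmode \<Sigma>) l w) = weyl_product sc q (quiv \<Sigma>) (zmode \<Sigma>) l w \<and>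
    weyl_product sc q (quiv \<Sigma>) (zmode \<Sigma>) l w =
      sc ((\<Prod>i\<leftarrow>l. sg i) * exp ((offset F + of_int n + of_int (\<Sum>j\<leftarrow>l. chg j) / 2) * (\<Sum>j\<leftarrow>l. lgs j) + sum_pairs phase l))
        (raising_power F (\<Sum>j\<leftarrow>l. chg j) (virtual_zero_modes chg V (offset F + of_int n) l w))"
  using assms(1)
proof (induction l)
  case Nil
  then show ?case using assms by simp
next
  case (Cons i l)
  let ?W = "weyl_product sc q (quiv \<Sigma>) (zmode \<Sigma>)" and ?d = "\<Sum>j\<leftarrow>l. chg j" and ?R = "\<Sum>j\<leftarrow>l. lgs j"
  let ?U = "virtual_zero_modes chg V (offset F + of_int n)"
  let ?e = "offset F + of_int (n + ?d) + of_int (chg i) / 2"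
  let ?c = "(\<Prod>i\<leftarrow>l. sg i) * exp ((offset F + of_int n + of_int ?d / 2) * ?R + sum_pairs phase l)"
  have i: "i \<in> I" and l: "set l \<subseteq> I" using Cons.prems by auto
  have IH: "?W l w \<in> S" "charge F (n + ?d) (?W l w) = ?W l w"
    "?W l w = sc ?c (raising_power F ?d (?U l w))"
    using Cons.IH[OF l] by blast+
  have "zmode \<Sigma> i (?W l w) = sc (sg i * exp (?e * lgs i)) (raising_power F (chg i) (V i (- (of_int (chg i) * ?e)) (?W l w)))"
    using zmode_pure[OF i IH(1,2)] by (simp only: Let_def)
  also have "\<dots> = sc (sg i * exp (?e * lgs i) * ?c) (raising_power F (chg i + ?d) (V i (- (of_int (chg i) * ?e)) (?U l w)))"
    unfolding IH(3) using V[OF i]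
    by (simp only: lin_scale lin_scale[OF lin_raising_power] scale_scale raising_power_add V_simps[OF i])
  also have "V i (- (of_int (chg i) * ?e)) (?U l w) = ?U (i # l) w"
    by (simp add: algebra_simps)
  finally have z: "zmode \<Sigma> i (?W l w) = sc (sg i * exp (?e * lgs i) * ?c) (raising_power F (chg i + ?d) (?U (i # l) w))" .
  have "q powi (- (\<Sum>j\<leftarrow>l. eps (quiv \<Sigma>) i j)) * (sg i * exp (?e * lgs i) * ?c) =
     (\<Prod>i\<leftarrow>i # l. sg i) * exp ((offset F + of_int n + of_int (chg i + ?d) / 2) * (lgs i + ?R) + sum_pairs phase (i # l))"
    unfolding power_int_eq_exp[OF q_in] sum_pairs.simps sum_list_phase
    by (simp add: exp_add[symmetric] mult.assoc mult.left_commute[of "exp _"] algebra_simps add_divide_distrib diff_divide_distrib)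
  then have eq: "?W (i # l) w = sc ((\<Prod>i\<leftarrow>i # l. sg i) * exp ((offset F + of_int n + of_int (chg i + ?d) / 2) * (lgs i + ?R) + sum_pairs phase (i # l)))
      (raising_power F (chg i + ?d) (?U (i # l) w))"
    by (simp only: weyl_product.simps z scale_scale)
  have "charge F (n + (chg i + ?d)) (?W (i # l) w) = ?W (i # l) w"
    unfolding eq lin_scale[OF charge] charge_raising_power
    by (simp only: virtual_zero_modes_simps(2)[OF Cons.prems] assms(3))
  moreover have "?W (i # l) w \<in> S"
    using zmode_S[OF i IH(1)] by (simp add: subspace_scale[OF S])
  ultimately show ?case using eq by simp
qed

end

section \<open>Normally ordered monomials in a bosonized seed\<close>

definition virtual_modes ::
  "(complex \<Rightarrow> 'w \<Rightarrow> 'w) \<Rightarrow> ('v \<Rightarrow> int \<Rightarrow> 'w \<Rightarrow> 'w) \<Rightarrow> 'v monomial \<Rightarrow> int \<Rightarrow> 'w \<Rightarrow> 'w::ab_group_add" where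
  "virtual_modes sc v l m u = (\<Sum>(i, c)\<leftarrow>l. sc (c powi (- m)) (v i m u))"

definition omit :: "'v \<Rightarrow> 'v monomial \<Rightarrow> 'v monomial" where
  "omit k l = filter (\<lambda>x. fst x \<noteq> k) l"

lemma omit_simps [simp]:
  "omit k [] = []" "omit k (x # l) = (if fst x = k then omit k l else x # omit k l)"
  "omit k (l @ l') = omit k l @ omit k l'"
  by (simp_all add: omit_def)

lemma map_fst_omit: "map fst (omit k l) = filter (\<lambda>i. i \<noteq> k) (map fst l)"
  by (induction l) auto

lemma fst_omit: "fst ` set l \<subseteq> I \<Longrightarrow> fst ` set (omit k l) \<subseteq> I - {k}"
  by (auto simp: omit_def)

context bosonized_seed
begin

lemma lin_modes_virtual:
  assumes "fst ` set l \<subseteq> I"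
  shows "lin_modes (virtual_modes sc v l)"
  unfolding lin_modes_def
proof (intro allI impI)
  fix m :: int assume m: "m \<noteq> 0"
  have "lin (\<lambda>u. \<Sum>x\<leftarrow>l. sc (snd x powi (- m)) (v (fst x) m u))"
    by (rule lin_sum_list_fun, rule lin_sc) (use assms v m in auto)
  then show "lin (virtual_modes sc v l m)"
    by (simp add: virtual_modes_def[abs_def] case_prod_unfold)
qed

lemma locally_finite_virtual:
  assumes "fst ` set l \<subseteq> I"
  shows "locally_finite (virtual_modes sc v (omit k l))"
proof -
  have eq: "virtual_modes sc v (omit k l) = (\<lambda>m u. \<Sum>(i, c)\<leftarrow>map (\<lambda>(i, c). (i, c powi (- m))) (omit k l). sc c (v i m u))"
    by (intro ext) (simp add: virtual_modes_def o_def case_prod_unfold)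
  show ?thesis
    unfolding eq by (rule locally_finite_smooth[OF v_smooth]) (use v fst_omit[OF assms, of k] in auto)
qed

lemma virtual_modes_commute:
  assumes "fst ` set l \<subseteq> I" "m \<noteq> 0"
  shows "charge F n (virtual_modes sc v l m w) = virtual_modes sc v l m (charge F n w)"
    "p \<noteq> 0 \<Longrightarrow> fosc F p (virtual_modes sc v l m w) = virtual_modes sc v l m (fosc F p w)"
proof -
  have *: "charge F n (v i m u) = v i m (charge F n u)" "p \<noteq> 0 \<Longrightarrow> fosc F p (v i m u) = v i m (fosc F p u)"
    if "i \<in> I" for i u
    using v[OF that assms(2)] by (simp_all add: commutes_with_fermions_def commutes_def)
  show "charge F n (virtual_modes sc v l m w) = virtual_modes sc v l m (charge F n w)"
    using assms(1) by (induction l) (auto simp: virtual_modes_def lin_0[OF charge] lin_add[OF charge] lin_scale[OF charge] *)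
  show "fosc F p (virtual_modes sc v l m w) = virtual_modes sc v l m (fosc F p w)" if "p \<noteq> 0"
    using assms(1) that
    by (induction l) (auto simp: virtual_modes_def lin_0[OF fosc] lin_add[OF fosc] lin_scale[OF fosc] *)
qed

lemma virtual_commutes_with_nord_modes:
  assumes "fst ` set l \<subseteq> I" "m \<noteq> 0"
  shows "commutes_with_modes (virtual_modes sc v l m) (nord_modes sc F X Y)"
  by (rule commutes_with_nord_modes)
    (use lin_modes_virtual[OF assms(1)] assms virtual_modes_commute[OF assms] in \<open>auto simp: lin_modes_def\<close>)

lemma charge_virtual_osc:
  assumes "fst ` set l \<subseteq> I"
  shows "charge F n (osc_coeff sc (virtual_modes sc v (omit k l)) j w) =
    osc_coeff sc (virtual_modes sc v (omit k l)) j (charge F n w)"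
proof -
  have l: "fst ` set (omit k l) \<subseteq> I" using fst_omit[OF assms] by blast
  show ?thesis
    by (rule osc_coeff_commute[OF lin_modes_virtual[OF l] locally_finite_virtual[OF assms] charge])
      (simp add: commutes_with_modes_def virtual_modes_commute[OF l])
qed

lemma modes_sum:
  assumes "fst ` set l \<subseteq> I" "u \<in> S" "m \<noteq> 0"
  shows "(\<Sum>(i, c)\<leftarrow>l. sc (c powi (- m)) (modes \<Sigma> i m u)) =
     nord_modes sc F (scaled_content A l) (scaled_content B l) m u + virtual_modes sc v (omit k l) m u"
    (is "?L l = ?R l")
    and "nord_modes sc F (scaled_content A l) (scaled_content B l) m u + virtual_modes sc v (omit k l) m u \<in> S"
proof -
  have "nord_modes sc F {#} {#} m u = 0"
    by (simp add: nord_modes_def)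
  then show eq: "?L l = ?R l"
    using assms(1)
  proof (induction l)
    case (Cons x l)
    obtain i c where x: "x = (i, c)" by (cases x)
    have "?L (x # l) = sc (c powi (- m)) (nord_modes sc F (A i) (B i) m u) + sc (c powi (- m)) (v i m u) + ?R l"
      using Cons modes_eq[of i u m] assms by (simp add: x scale_right_distrib)
    also have "\<dots> = ?R (x # l)"
      by (auto simp: x nord_modes_union nord_modes_scaled virtual_modes_def v_k algebra_simps)
    finally show ?case .
  qed (simp add: virtual_modes_def)
  have "?L l \<in> S"
    by (rule subspace_sum_list[OF S]) (use assms modes_S in \<open>auto intro!: subspace_scale[OF S]\<close>)
  then show "?R l \<in> S" unfolding eq .
qed

lemma osc_modes_sum:
  assumes l: "fst ` set l \<subseteq> I" and w: "w \<in> S"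
  defines "X \<equiv> \<lambda>m u. \<Sum>(i, c)\<leftarrow>l. sc (c powi (- m)) (modes \<Sigma> i m u)"
    and "a \<equiv> nord_modes sc F (scaled_content A l) (scaled_content B l)" and "b \<equiv> virtual_modes sc v (omit k l)"
  shows "osc_coeff sc X n w \<in> S"
    and "osc_coeff sc X n w = Sum_any (\<lambda>j. osc_coeff sc a (n - j) (osc_coeff sc b j w))"
    and "finite {j. osc_coeff sc a (n - j) (osc_coeff sc b j w) \<noteq> 0}"
    and "osc_coeff sc X n w = osc_coeff sc (\<lambda>m u. a m u + b m u) n w"
    and "lin (osc_coeff sc (\<lambda>m u. a m u + b m u) n)"
proof -
  have l': "fst ` set (omit k l) \<subseteq> I" using fst_omit[OF l] by blast
  have a: "lin_modes a" "locally_finite a"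
    unfolding a_def by (rule lin_modes_nord_modes, rule locally_finite_nord_modes)
  have b: "lin_modes b" "locally_finite b"
    unfolding b_def by (rule lin_modes_virtual[OF l'], rule locally_finite_virtual[OF l])
  have ab: "commutes_with_modes (b m) a" if "m \<noteq> 0" for m
    unfolding a_def b_def by (rule virtual_commutes_with_nord_modes[OF l' that])
  have cong: "osc_coeff sc X n w = osc_coeff sc (\<lambda>m u. a m u + b m u) n w \<and>
      osc_coeff sc (\<lambda>m u. a m u + b m u) n w \<in> S"
    by (rule osc_coeff_cong_on[OF S _ w])
      (use modes_sum[OF l] in \<open>auto simp: X_def a_def b_def\<close>)
  then show eq: "osc_coeff sc X n w = osc_coeff sc (\<lambda>m u. a m u + b m u) n w" and "osc_coeff sc X n w \<in> S"
    by simp_all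
  show "osc_coeff sc X n w = Sum_any (\<lambda>j. osc_coeff sc a (n - j) (osc_coeff sc b j w))"
    unfolding eq by (rule osc_coeff_plus(1)[OF a(1) b(1) _ a(2) b(2)]) (rule ab)
  show "finite {j. osc_coeff sc a (n - j) (osc_coeff sc b j w) \<noteq> 0}"
    by (rule osc_coeff_plus(2)[OF a(1) b(1) _ a(2) b(2)]) (rule ab)
  show "lin (osc_coeff sc (\<lambda>m u. a m u + b m u) n)"
    by (rule lin_osc_coeff[OF lin_modes_plus[OF a(1) b(1)] locally_finite_plus[OF a(1) b(1) _ a(2) b(2)]]) (simp_all add: ab)
qed

text \<open>For the mutated seed, linearity of modes and zero modes is not among the data, so
  additivity on \<open>S\<close> is drawn from the fermionic realization.\<close>

lemma normal_ordered_S_add: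
  assumes l: "fst ` set l \<subseteq> I" and xy: "x \<in> S" "y \<in> S"
  shows "normal_ordered sc q \<Sigma> l n (x + y) = normal_ordered sc q \<Sigma> l n x + normal_ordered sc q \<Sigma> l n y"
proof -
  let ?W = "weyl_product sc q (quiv \<Sigma>) (zmode \<Sigma>)"
  have W: "?W is (x + y) = ?W is x + ?W is y \<and> ?W is x \<in> S" if "set is \<subseteq> I" "x \<in> S" "y \<in> S" for "is" x y
    using that
  proof (induction "is" arbitrary: x y)
    case (Cons i "is")
    have "?W is y \<in> S" using Cons.IH[of y x] Cons.prems by simp
    then show ?case
      using Cons.IH[of x y] Cons.prems
      by (simp add: zmode_add scale_right_distrib zmode_S subspace_scale[OF S])
  qed simp
  let ?X = "\<lambda>m u. \<Sum>(i, c)\<leftarrow>l. sc (c powi (- m)) (modes \<Sigma> i m u)"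
  have "osc_coeff sc ?X n (x + y) = osc_coeff sc ?X n x + osc_coeff sc ?X n y"
    unfolding osc_modes_sum(4)[OF l xy(1)] osc_modes_sum(4)[OF l xy(2)] osc_modes_sum(4)[OF l subspace_add[OF S xy]]
    by (rule lin_add[OF osc_modes_sum(5)[OF l xy(1)]])
  then show ?thesis
    unfolding normal_ordered_def
    using W[of "map fst l" "osc_coeff sc ?X n x" "osc_coeff sc ?X n y"] osc_modes_sum(1)[OF l xy(1)] osc_modes_sum(1)[OF l xy(2)] l
    by simp
qed

text \<open>In \<open>normal_ordered\<close> the arguments c enter the oscillators only, whereas a
  fermionic field with scaled contents also scales its zero mode. The second term of the exponent
  takes these powers of c back.\<close>

definition virtual_factor :: "int \<Rightarrow> 'v monomial \<Rightarrow> complex" where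
  "virtual_factor n l = exp (sum_pairs phase (map fst l) -
     (offset F + of_int n + of_int (\<Sum>(i, c)\<leftarrow>l. chg i) / 2) * (\<Sum>(i, c)\<leftarrow>l. of_int (chg i) * lg c))"

definition virtual_vector :: "int \<Rightarrow> 'v monomial \<Rightarrow> int \<Rightarrow> 'w \<Rightarrow> 'w" where
  "virtual_vector n l j w = virtual_zero_modes chg V (offset F + of_int n) (map fst l)
     (osc_coeff sc (virtual_modes sc v l) j w)"

text \<open>The power of z in the fermionic zero mode E^d z^(d (J + d/2)), with d the total charge
  of the monomial.\<close>

definition base_exponent :: "int \<Rightarrow> 'v monomial \<Rightarrow> complex" where
  "base_exponent n l = of_int (\<Sum>(i, c)\<leftarrow>l. chg i) * (offset F + of_int n + of_int (\<Sum>(i, c)\<leftarrow>l. chg i) / 2)"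

lemma excess_scaled_content:
  "excess (scaled_content A l) (scaled_content B l) = (\<Sum>(i, c)\<leftarrow>l. chg i)"
  by (induction l) (auto simp: chg_def)

lemma chg_omit: "(\<Sum>(i, c)\<leftarrow>omit k l. chg i) = (\<Sum>(i, c)\<leftarrow>l. chg i)"
  "(\<Sum>(i, c)\<leftarrow>omit k l. of_int (chg i) * lg c) = (\<Sum>(i, c)\<leftarrow>l. of_int (chg i) * lg c)"
  by (induction l) auto

lemma scaled_content_in:
  assumes "fst ` set l \<subseteq> I" "snd ` set l \<subseteq> \<Gamma>"
  shows "set_mset (scaled_content A l) \<subseteq> \<Gamma>" "set_mset (scaled_content B l) \<subseteq> \<Gamma>"
proof -
  have "set_mset (scaled_content A l) \<subseteq> \<Gamma> \<and> set_mset (scaled_content B l) \<subseteq> \<Gamma>"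
    using assms
  proof (induction l)
    case (Cons x l)
    obtain i c where x: "x = (i, c)" by (cases x)
    have i: "i \<in> I" and c: "c \<in> \<Gamma>" using Cons.prems by (simp_all add: x)
    have "set_mset (image_mset ((*) c) (A i)) \<subseteq> \<Gamma>" "set_mset (image_mset ((*) c) (B i)) \<subseteq> \<Gamma>"
      using content_in[OF i] mult_in[OF c] by auto
    then show ?case using Cons by (simp add: x)
  qed simp
  then show "set_mset (scaled_content A l) \<subseteq> \<Gamma>" "set_mset (scaled_content B l) \<subseteq> \<Gamma>" by simp_all
qed

lemma lgsum_scaled_content:
  assumes "fst ` set l \<subseteq> I" "snd ` set l \<subseteq> \<Gamma>"
  shows "lgsum (scaled_content A l) (scaled_content B l) =
    (\<Sum>j\<leftarrow>map fst l. lgs j) + (\<Sum>(i, c)\<leftarrow>l. of_int (chg i) * lg c)"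
  using assms
proof (induction l)
  case (Cons x l)
  obtain i c where x: "x = (i, c)" by (cases x)
  show ?case
    using Cons content_in[of i] lgsum_scaled[of c "A i" "B i"] by (simp add: x chg_def)
qed simp

lemma charge_virtual_vector:
  assumes "fst ` set l \<subseteq> I" "charge F n w = w"
  shows "charge F n (virtual_vector n (omit k l) j w) = virtual_vector n (omit k l) j w"
proof -
  have "set (map fst (omit k l)) \<subseteq> I" using fst_omit[OF assms(1)] by auto
  then show ?thesis
    by (simp add: virtual_vector_def virtual_zero_modes_simps(2) charge_virtual_osc[OF assms(1)] assms(2))
qed

text \<open>The commuting fermionic and virtual oscillators factorize, and
  \<open>weyl_product_pure\<close> evaluates the zero modes. At the exponents belonging to charge
  \<open>n\<close> the fermionic field carries the additional scalar exp(e lgsum), which is divided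
  out. What remains outside the field refers to \<open>omit k l\<close> only, apart from the
  signs.\<close>

theorem normal_ordered_eq:
  fixes p :: int
  assumes l: "fst ` set l \<subseteq> I" "snd ` set l \<subseteq> \<Gamma>" and w: "w \<in> S" "charge F n w = w"
  defines "X \<equiv> \<lambda>j. nord_field sc lg F (scaled_content A l) (scaled_content B l)
      (base_exponent n (omit k l) + of_int (p - j)) (virtual_vector n (omit k l) j w)"
  shows "normal_ordered sc q \<Sigma> l p w = sc ((\<Prod>(i, c)\<leftarrow>l. sg i) * virtual_factor n (omit k l)) (Sum_any X)"
    and "finite {j. X j \<noteq> 0}"
proof -
  let ?A = "scaled_content A l" and ?B = "scaled_content B l" and ?is = "map fst l"
  let ?a = "nord_modes sc F ?A ?B" and ?b = "virtual_modes sc v (omit k l)"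
  let ?d = "\<Sum>(i, c)\<leftarrow>l. chg i" and ?c = "\<Sum>(i, c)\<leftarrow>l. of_int (chg i) * lg c"
  let ?e = "offset F + of_int n + of_int ?d / 2"
  let ?U = "virtual_zero_modes chg V (offset F + of_int n)"
  let ?o = "\<lambda>j. osc_coeff sc ?a (p - j) (osc_coeff sc ?b j w)"
  have is': "set ?is \<subseteq> I" using l by auto
  have d: "(\<Sum>j\<leftarrow>?is. chg j) = ?d" by (simp add: case_prod_unfold o_def)
  have vv: "virtual_vector n (omit k l) j w = ?U ?is (osc_coeff sc ?b j w)" for j
    unfolding virtual_vector_def map_fst_omit using virtual_zero_modes_filter by metis
  have u: "charge F n (?U ?is (osc_coeff sc ?b j w)) = ?U ?is (osc_coeff sc ?b j w)" for j
    using charge_virtual_vector[OF l(1) w(2)] by (simp add: vv)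
  have X: "X j = sc (exp (?e * lgsum ?A ?B)) (raising_power F ?d (?U ?is (?o j)))" for j
  proof -
    have "X j = sc (exp (?e * lgsum ?A ?B)) (raising_power F ?d (osc_coeff sc ?a (p - j) (?U ?is (osc_coeff sc ?b j w))))"
      unfolding X_def vv base_exponent_def chg_omit
      using nord_field_pure[OF u scaled_content_in[OF l], of _ "p - j"] excess_scaled_content[of l] by simp
    also have "osc_coeff sc ?a (p - j) (?U ?is (osc_coeff sc ?b j w)) = ?U ?is (?o j)"
      by (rule nord_osc_commute[symmetric])
        (use virtual_zero_modes_simps[OF is'] in auto)
    finally show ?thesis .
  qed
  have "{j. X j \<noteq> 0} \<subseteq> {j. ?o j \<noteq> 0}"
    by (auto simp: X lin_0[OF lin_raising_power] lin_0[OF virtual_zero_modes_simps(1)[OF is']])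
  then show "finite {j. X j \<noteq> 0}"
    by (rule finite_subset) (rule osc_modes_sum(3)[OF l(1) w(1)])
  let ?x = "osc_coeff sc (\<lambda>m u. \<Sum>(i, c)\<leftarrow>l. sc (c powi (- m)) (modes \<Sigma> i m u)) p w"
  have xS: "?x \<in> S" by (rule osc_modes_sum(1)[OF l(1) w(1)])
  have x: "?x = Sum_any ?o" by (rule osc_modes_sum(2)[OF l(1) w(1)])
  have fin: "finite {j. ?o j \<noteq> 0}" by (rule osc_modes_sum(3)[OF l(1) w(1)])
  have xn: "charge F n ?x = ?x"
    unfolding x lin_Sum_any[OF charge fin] by (simp add: charge_nord_osc charge_virtual_osc[OF l(1)] w(2))
  have linU: "lin (\<lambda>y. raising_power F ?d (?U ?is y))"
    by (rule lin_comp[OF lin_raising_power virtual_zero_modes_simps(1)[OF is']])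
  have "normal_ordered sc q \<Sigma> l p w = weyl_product sc q (quiv \<Sigma>) (zmode \<Sigma>) ?is ?x"
    by (simp add: normal_ordered_def)
  also have "\<dots> = sc ((\<Prod>i\<leftarrow>?is. sg i) * exp (?e * (\<Sum>j\<leftarrow>?is. lgs j) + sum_pairs phase ?is))
      (raising_power F ?d (?U ?is ?x))"
    using weyl_product_pure[OF is' xS xn] unfolding d by blast
  also have "raising_power F ?d (?U ?is ?x) = Sum_any (\<lambda>j. raising_power F ?d (?U ?is (?o j)))"
    unfolding x by (rule lin_Sum_any[OF linU fin])
  also have "\<dots> = sc (exp (- ?e * lgsum ?A ?B)) (Sum_any X)"
  proof -
    have "exp (- a * b) * exp (a * b) = 1" for a b :: complex
      by (simp add: exp_minus)
    then have "raising_power F ?d (?U ?is (?o j)) = sc (exp (- ?e * lgsum ?A ?B)) (X j)" for j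
      by (simp only: X scale_scale scale_one)
    then show ?thesis
      using lin_Sum_any[OF lin_sc[OF lin_ident] \<open>finite {j. X j \<noteq> 0}\<close>] by simp
  qed
  also have "sc ((\<Prod>i\<leftarrow>?is. sg i) * exp (?e * (\<Sum>j\<leftarrow>?is. lgs j) + sum_pairs phase ?is)) \<dots>
      = sc ((\<Prod>(i, c)\<leftarrow>l. sg i) * virtual_factor n (omit k l)) (Sum_any X)"
  proof -
    have "sum_pairs phase ?is = sum_pairs phase (map fst (omit k l))"
      unfolding map_fst_omit by (rule sum_pairs_filter) (use phase_k is' in blast)
    then have "exp (?e * (\<Sum>j\<leftarrow>?is. lgs j) + sum_pairs phase ?is) * exp (- ?e * lgsum ?A ?B) = virtual_factor n (omit k l)"
      unfolding virtual_factor_def chg_omit lgsum_scaled_content[OF l] by (simp add: algebra_simps flip: exp_add)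
    moreover have "(\<Prod>i\<leftarrow>?is. sg i) = (\<Prod>(i, c)\<leftarrow>l. sg i)"
      by (simp add: case_prod_unfold o_def)
    ultimately show ?thesis
      by (simp only: scale_scale mult.assoc)
  qed
  finally show "normal_ordered sc q \<Sigma> l p w = sc ((\<Prod>(i, c)\<leftarrow>l. sg i) * virtual_factor n (omit k l)) (Sum_any X)" .
qed

end

section \<open>Charge components of vectors in the seed space\<close>

context bosonized_seed
begin

text \<open>Up to its sign, X_k acts on charge m as q^(-2 (offset + m)) and preserves
  \<open>S\<close>. These eigenvalues are distinct, so applying X_k minus one of them removes that
  charge and only rescales the others by nonzero numbers. Induction on the number of charges present
  isolates each component.\<close>

lemma charge_mem:
  assumes generic: "\<And>n :: int. q powi n = 1 \<Longrightarrow> n = 0" and sg_k: "sg k \<noteq> 0" and w: "w \<in> S"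
  shows "charge F n w \<in> S"
proof -
  define D where "D = field_times (nord_zero sc lg F (A k) (B k)) (V k) 0"
  define \<mu> where "\<mu> m = exp ((offset F + of_int m) * (- 2 * lg q))" for m :: int
  have linD: "lin D" unfolding D_def by (rule lin_field_times[OF k_vert])
  have D_S: "D u \<in> S" if "u \<in> S" for u
    using subspace_scale[OF S zmode_S[OF k_vert that], of "inverse (sg k)"] sg_k
    by (simp add: zmode_eq[OF k_vert that] D_def)
  have "D (charge F m u) = sc (\<mu> m) (charge F m u)" for m u
    using field_times_pure[OF k_vert, of m "charge F m u" 0]
    by (simp add: charge_charge D_def lgsum_k V_k \<mu>_def)
  then have D: "D u = Sum_any (\<lambda>m. sc (\<mu> m) (charge F m u))" for u
    using lin_Sum_any[OF linD finite_charges, of u] by (simp add: Sum_any_charge)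
  have charge_D: "charge F m (D u) = sc (\<mu> m) (charge F m u)" for m u
  proof -
    have "finite {j. sc (\<mu> j) (charge F j u) \<noteq> 0}"
      by (rule finite_subset[OF _ finite_charges[of u]]) auto
    then have "charge F m (D u) = Sum_any (\<lambda>j. charge F m (sc (\<mu> j) (charge F j u)))"
      unfolding D by (rule lin_Sum_any[OF charge])
    also have "\<dots> = Sum_any (\<lambda>j. if j = m then sc (\<mu> m) (charge F m u) else 0)"
      by (rule arg_cong[where f = Sum_any]) (auto simp: lin_scale[OF charge] charge_charge)
    finally show ?thesis by simp
  qed
  have \<mu>_inj: "m = j" if "\<mu> m = \<mu> j" for m j
  proof -
    have "q powi (- 2 * (m - j)) = exp (((offset F + of_int m) - (offset F + of_int j)) * (- 2 * lg q))"
      unfolding power_int_eq_exp[OF q_in] by (simp add: algebra_simps)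
    also have "\<dots> = \<mu> m / \<mu> j"
      unfolding \<mu>_def left_diff_distrib exp_diff ..
    also have "\<dots> = 1" using that by (simp add: \<mu>_def)
    finally show ?thesis using generic by force
  qed
  have "\<forall>u\<in>S. card {m. charge F m u \<noteq> 0} = N \<longrightarrow> (\<forall>n. charge F n u \<in> S)" for N
  proof (induction N rule: less_induct)
    case (less N)
    show ?case
    proof (intro ballI impI allI)
      fix u n assume u: "u \<in> S" and N: "card {m. charge F m u \<noteq> 0} = N"
      show "charge F n u \<in> S"
      proof (cases "\<exists>m. m \<noteq> n \<and> charge F m u \<noteq> 0")
        case False
        have "u = Sum_any (\<lambda>m. charge F m u)" by (simp add: Sum_any_charge)
        also have "\<dots> = Sum_any (\<lambda>m. if m = n then charge F n u else 0)"
          by (intro arg_cong[where f = Sum_any] ext) (use False in auto)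
        finally show ?thesis using u by simp
      next
        case True
        then obtain m where m: "m \<noteq> n" "charge F m u \<noteq> 0" by blast
        define x where "x = D u - sc (\<mu> m) u"
        have x: "x \<in> S" unfolding x_def by (intro subspace_diff[OF S] D_S subspace_scale[OF S] u)
        have cx: "charge F j x = sc (\<mu> j - \<mu> m) (charge F j u)" for j
          using lin_add[OF charge, of j x "sc (\<mu> m) u"]
          by (simp add: x_def charge_D lin_scale[OF charge] scale_left_diff_distrib algebra_simps)
        have "{j. charge F j x \<noteq> 0} \<subset> {j. charge F j u \<noteq> 0}"
          using m by (auto simp: cx)
        then have "card {j. charge F j x \<noteq> 0} < N"
          using psubset_card_mono[OF finite_charges] N by blast
        then have "charge F n x \<in> S"
          using less x by blast
        then have "sc (inverse (\<mu> n - \<mu> m)) (charge F n x) \<in> S"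
          by (rule subspace_scale[OF S])
        moreover have "\<mu> n - \<mu> m \<noteq> 0" using \<mu>_inj m by auto
        ultimately show ?thesis by (simp add: cx)
      qed
    qed
  qed
  then show ?thesis using w by blast
qed

lemma pure_extension:
  assumes mem: "\<And>w n. w \<in> S \<Longrightarrow> charge F n w \<in> S"
    and f: "\<And>x y. x \<in> S \<Longrightarrow> y \<in> S \<Longrightarrow> f (x + y) = f x + (f y :: 'w)"
    and g: "\<And>x y. x \<in> S \<Longrightarrow> y \<in> S \<Longrightarrow> g (x + y) = g x + (g y :: 'w)"
    and eq: "\<And>w n. w \<in> S \<Longrightarrow> w \<noteq> 0 \<Longrightarrow> charge F n w = w \<Longrightarrow> f w = g w"
    and w: "w \<in> S"
  shows "f w = g w"
proof -
  have 0: "f 0 = 0" "g 0 = 0"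
    using f[of 0 0] g[of 0 0] subspace_0[OF S] by simp_all
  have fin: "f (\<Sum>n\<in>N. charge F n w) = g (\<Sum>n\<in>N. charge F n w)" if "finite N" for N
    using that
  proof (induction N)
    case (insert n N)
    have "f (charge F n w) = g (charge F n w)"
      using eq[of "charge F n w" n] mem[OF w] 0 by (cases "charge F n w = 0") (simp_all add: charge_charge)
    then show ?case
      using insert f[of "charge F n w" "\<Sum>n\<in>N. charge F n w"] g[of "charge F n w" "\<Sum>n\<in>N. charge F n w"]
        mem[OF w] subspace_sum[OF S, of N "\<lambda>n. charge F n w"] by simp
  qed (simp add: 0)
  have "w = (\<Sum>n | charge F n w \<noteq> 0. charge F n w)"
    using Sum_any_charge[of w] by (simp add: Sum_any.expand_set)
  then show ?thesis using fin[OF finite_charges[of w]] by simp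
qed

end

text \<open>The exponents are homogeneous quadratic in the charges and \<mu>, hence unchanged when
  all of these change sign.\<close>

lemma virtual_zero_modes_opposite:
  assumes "\<And>i. i \<in> set l \<Longrightarrow> d' i = - d i"
  shows "virtual_zero_modes d' V (- \<mu>) l w = virtual_zero_modes d V \<mu> l w"
  using assms
proof (induction l)
  case (Cons i l)
  have "(\<Sum>j\<leftarrow>l. d' j) = - (\<Sum>j\<leftarrow>l. d j)"
    using Cons.prems by (induction l) auto
  then have "of_int (d' i) * (- \<mu> + of_int (\<Sum>j\<leftarrow>l. d' j) + of_int (d' i) / 2) =
      of_int (d i) * (\<mu> + of_int (\<Sum>j\<leftarrow>l. d j) + of_int (d i) / 2 :: complex)"
    using Cons.prems by (simp add: algebra_simps)
  then show ?case using Cons by (simp only: virtual_zero_modes.simps list.set_intros)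
qed simp

text \<open>The sign \<open>\<tau>\<close> makes the two seeds interchangeable: exchanging them replaces \<open>\<tau>\<close> by \<open>- \<tau>\<close>.\<close>

locale opposite_seeds =
  L: bosonized_seed sc \<Gamma> lg F q S \<Sigma> k sg A B V v +
  R: bosonized_seed sc \<Gamma> lg F' q S \<Sigma>' k sg' A' B' V v
  for sc :: "complex \<Rightarrow> 'w \<Rightarrow> 'w::ab_group_add" and \<Gamma> lg F F' q S and \<Sigma> \<Sigma>' :: "('v, 'w) seed" and k sg sg' A B A' B' V v +
  fixes \<tau> :: complex
  assumes verts_eq: "verts (quiv \<Sigma>') = verts (quiv \<Sigma>)"
    and chg_opposite: "i \<in> verts (quiv \<Sigma>) \<Longrightarrow> R.chg i = - L.chg i"
    and phase_eq: "i \<in> verts (quiv \<Sigma>) - {k} \<Longrightarrow> j \<in> verts (quiv \<Sigma>) - {k} \<Longrightarrow> R.phase i j = L.phase i j"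
    and psi_star': "psi_star sc lg F' r w = sc \<tau> (sc (cpow lg q r) (psi sc lg F r w) - sc (cpow lg (inverse q) r) (psi sc lg F r w))"
    and psi_star: "psi_star sc lg F r w = sc (- \<tau>) (sc (cpow lg q r) (psi sc lg F' r w) - sc (cpow lg (inverse q) r) (psi sc lg F' r w))"
    and pure_induct: "(\<And>x y. x \<in> S \<Longrightarrow> y \<in> S \<Longrightarrow> f (x + y) = f x + (f y :: 'w)) \<Longrightarrow>
      (\<And>x y. x \<in> S \<Longrightarrow> y \<in> S \<Longrightarrow> g (x + y) = g x + (g y :: 'w)) \<Longrightarrow>
      (\<And>w n n'. w \<in> S \<Longrightarrow> charge F n w = w \<Longrightarrow> charge F' n' w = w \<Longrightarrow>
        offset F + of_int n = - (offset F' + of_int n') \<Longrightarrow> f w = g w) \<Longrightarrow> w \<in> S \<Longrightarrow> f w = g w"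
begin

text \<open>Sums of two monomials are always formed in the first seed. For a current that gains the
  factor with X_k in the mutated seed, the roles have to be exchanged.\<close>

lemma swap: "opposite_seeds sc \<Gamma> lg F' F q S \<Sigma>' \<Sigma> k sg' sg A' B' A B V v (- \<tau>)"
proof unfold_locales
  show "f w = g w"
    if f: "\<And>x y. x \<in> S \<Longrightarrow> y \<in> S \<Longrightarrow> f (x + y) = f x + f y"
      and g: "\<And>x y. x \<in> S \<Longrightarrow> y \<in> S \<Longrightarrow> g (x + y) = g x + g y"
      and eq: "\<And>w n n'. w \<in> S \<Longrightarrow> charge F' n w = w \<Longrightarrow> charge F n' w = w \<Longrightarrow>
        offset F' + of_int n = - (offset F + of_int n') \<Longrightarrow> f w = g w"
      and w: "w \<in> S" for f g :: "'w \<Rightarrow> 'w" and w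
  proof (rule pure_induct[OF f g _ w])
    show "f u = g u" if "u \<in> S" "charge F n u = u" "charge F' n' u = u"
      "offset F + of_int n = - (offset F' + of_int n')" for u n n'
      by (rule eq[OF that(1,3,2)]) (simp add: that(4))
  qed
qed (use verts_eq chg_opposite phase_eq psi_star psi_star' in auto)

abbreviation admissible :: "'v monomial \<Rightarrow> bool" where
  "admissible l \<equiv> fst ` set l \<subseteq> verts (quiv \<Sigma>) \<and> snd ` set l \<subseteq> \<Gamma>"

context
  fixes w n n'
  assumes w: "w \<in> S" "charge F n w = w" "charge F' n' w = w"
    and nn': "offset F + of_int n = - (offset F' + of_int n')"
begin

text \<open>Charges and offset value change sign together, and they enter all three expressions
  through products of two of them or of a charge sum with the value of J. The phases agree by
  \<open>phase_eq\<close>, which applies because \<open>k\<close> is omitted.\<close>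

lemma virtual_eq:
  assumes "fst ` set l \<subseteq> verts (quiv \<Sigma>)"
  shows "R.virtual_vector n' (omit k l) j w = L.virtual_vector n (omit k l) j w"
    "R.virtual_factor n' (omit k l) = L.virtual_factor n (omit k l)"
    "R.base_exponent n' (omit k l) = L.base_exponent n (omit k l)"
proof -
  have off: "offset F' + of_int n' = - (offset F + of_int n)" using nn' by simp
  have l: "set (map fst (omit k l)) \<subseteq> verts (quiv \<Sigma>) - {k}"
    using fst_omit[OF assms, of k] by auto
  then have c: "i \<in> set (map fst (omit k l)) \<Longrightarrow> R.chg i = - L.chg i" for i
    using chg_opposite by blast
  show "R.virtual_vector n' (omit k l) j w = L.virtual_vector n (omit k l) j w"
    unfolding L.virtual_vector_def R.virtual_vector_def off by (rule virtual_zero_modes_opposite[OF c])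
  have "(\<Sum>(i, c)\<leftarrow>xs. R.chg i) = - (\<Sum>(i, c)\<leftarrow>xs. L.chg i) \<and>
    (\<Sum>(i, c)\<leftarrow>xs. of_int (R.chg i) * lg c) = - (\<Sum>(i, c)\<leftarrow>xs. of_int (L.chg i) * lg c)"
    if "\<forall>i\<in>set (map fst xs). R.chg i = - L.chg i" for xs
    using that by (induction xs) auto
  then have s: "(\<Sum>(i, c)\<leftarrow>omit k l. R.chg i) = - (\<Sum>(i, c)\<leftarrow>omit k l. L.chg i)"
    "(\<Sum>(i, c)\<leftarrow>omit k l. of_int (R.chg i) * lg c) = - (\<Sum>(i, c)\<leftarrow>omit k l. of_int (L.chg i) * lg c)"
    using c by blast+
  have ph: "sum_pairs R.phase (map fst (omit k l)) = sum_pairs L.phase (map fst (omit k l))"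
    by (rule sum_pairs_cong) (use l phase_eq in blast)
  show "R.virtual_factor n' (omit k l) = L.virtual_factor n (omit k l)"
    unfolding L.virtual_factor_def R.virtual_factor_def off s ph by (simp add: algebra_simps)
  show "R.base_exponent n' (omit k l) = L.base_exponent n (omit k l)"
    unfolding L.base_exponent_def R.base_exponent_def off s by (simp add: algebra_simps)
qed

lemma cpow_mult: "a \<in> \<Gamma> \<Longrightarrow> b \<in> \<Gamma> \<Longrightarrow> cpow lg (a * b) r = cpow lg a r * cpow lg b r"
  by (simp add: cpow_def L.lg_mult algebra_simps exp_add)

text \<open>After cancellation, \<open>l0\<close>, \<open>l1\<close> and \<open>l\<close> leave
  Psi(q c z), Psi(c z / q) and the other seed's Psi*(c z). All three act on the same virtual
  vectors, at the same exponents and with the same virtual factor, so the fermion transformation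
  applies term by term.\<close>

lemma sum_of_two_pure:
  assumes l: "fst ` set l \<subseteq> verts (quiv \<Sigma>)" "snd ` set l \<subseteq> \<Gamma>"
    and l0: "admissible l0" "omit k l0 = omit k l" and l1: "admissible l1" "omit k l1 = omit k l"
    and c: "c \<in> \<Gamma>"
    and cont: "scaled_content A l0 = scaled_content B l0 + {#q * c#}"
      "scaled_content A l1 = scaled_content B l1 + {#inverse q * c#}"
      "scaled_content A' l + {#c#} = scaled_content B' l"
    and sign: "(\<Prod>(i, c)\<leftarrow>l0. sg i) = \<tau> * (\<Prod>(i, c)\<leftarrow>l. sg' i)" "(\<Prod>(i, c)\<leftarrow>l1. sg i) = - \<tau> * (\<Prod>(i, c)\<leftarrow>l. sg' i)"
  shows "normal_ordered sc q \<Sigma> l0 p w + normal_ordered sc q \<Sigma> l1 p w = normal_ordered sc q \<Sigma>' l p w"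
proof -
  let ?u = "\<lambda>j. L.virtual_vector n (omit k l) j w" and ?r = "\<lambda>j. L.base_exponent n (omit k l) + of_int (p - j)"
  let ?K = "L.virtual_factor n (omit k l)" and ?s = "\<Prod>(i, c)\<leftarrow>l. sg' i"
  note qc = L.mult_in[OF L.q_in c] L.mult_in[OF L.inverse_in[OF L.q_in] c]
  note l0' = conjunct1[OF l0(1)] conjunct2[OF l0(1)] and l1' = conjunct1[OF l1(1)] conjunct2[OF l1(1)]
  have l': "fst ` set l \<subseteq> verts (quiv \<Sigma>')" using l(1) verts_eq by simp
  have u: "charge F n (?u j) = ?u j" "charge F' n' (?u j) = ?u j" for j
    using L.charge_virtual_vector[OF l(1) w(2)] R.charge_virtual_vector[OF l' w(3)] virtual_eq(1)[OF l(1)] by simp_all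
  have f0: "nord_field sc lg F (scaled_content A l0) (scaled_content B l0) = nord_field sc lg F {#q * c#} {#}"
    by (rule L.nord_field_cross) (use cont(1) L.scaled_content_in[OF l0'] qc in auto)
  have f1: "nord_field sc lg F (scaled_content A l1) (scaled_content B l1) = nord_field sc lg F {#inverse q * c#} {#}"
    by (rule L.nord_field_cross) (use cont(2) L.scaled_content_in[OF l1'] qc in auto)
  have f: "nord_field sc lg F' (scaled_content A' l) (scaled_content B' l) = nord_field sc lg F' {#} {#c#}"
    by (rule R.nord_field_cross) (use cont(3) R.scaled_content_in[OF l' l(2)] c in auto)
  let ?Y = "\<lambda>j. nord_field sc lg F {#q * c#} {#} (?r j) (?u j)" and ?Z = "\<lambda>j. nord_field sc lg F {#inverse q * c#} {#} (?r j) (?u j)"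
    and ?X = "\<lambda>j. nord_field sc lg F' {#} {#c#} (?r j) (?u j)"
  \<comment> \<open>A common finite support; by the relation \<open>X\<close> below it also contains
    the support of the third family, so \<open>Sum_any\<close> can be treated as one finite
    sum.\<close>
  have fin: "finite ({j. ?Y j \<noteq> 0} \<union> {j. ?Z j \<noteq> 0})" (is "finite ?J")
    using L.normal_ordered_eq(2)[OF l0' w(1,2), of p] L.normal_ordered_eq(2)[OF l1' w(1,2), of p]
    unfolding f0 f1 l0(2) l1(2) by simp
  \<comment> \<open>The total charge is that of the single fermion left by \<open>l0\<close>; it
    makes the exponents those that occur in Psi at charge \<open>n\<close>.\<close>
  have "(\<Sum>(i, c)\<leftarrow>omit k l. L.chg i) = 1"
    using L.excess_scaled_content[of l0] unfolding cont(1) by (simp flip: L.chg_omit(1)[of l0] add: l0(2))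
  then have b: "L.base_exponent n (omit k l) = offset F + of_int n + 1 / 2"
    by (simp add: L.base_exponent_def)
  have X: "?X j = sc \<tau> (?Y j - ?Z j)" for j
  proof -
    have "?X j = sc (cpow lg c (?r j)) (psi_star sc lg F' (?r j) (?u j))"
      by (rule R.psi_star_scaled[OF u(2) c, where p = "p - j"]) (simp add: b nn')
    also have "\<dots> = sc \<tau> (sc (cpow lg (q * c) (?r j)) (psi sc lg F (?r j) (?u j)) - sc (cpow lg (inverse q * c) (?r j)) (psi sc lg F (?r j) (?u j)))"
      unfolding psi_star' cpow_mult[OF L.q_in c] cpow_mult[OF L.inverse_in[OF L.q_in] c]
      by (simp add: L.scale_right_diff_distrib mult_ac)
    also have "\<dots> = sc \<tau> (?Y j - ?Z j)"
      using L.psi_scaled[OF u(1) qc(1), of "?r j" "p - j"] L.psi_scaled[OF u(1) qc(2), of "?r j" "p - j"] b by simp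
    finally show ?thesis .
  qed
  have S: "Sum_any ?X = sum ?X ?J" "Sum_any ?Y = sum ?Y ?J" "Sum_any ?Z = sum ?Z ?J"
    by (rule Sum_any.expand_superset[OF fin], unfold X, fastforce) (rule Sum_any.expand_superset[OF fin], fastforce)+
  have "normal_ordered sc q \<Sigma> l0 p w + normal_ordered sc q \<Sigma> l1 p w
      = sc (?s * ?K) (sc \<tau> (Sum_any ?Y - Sum_any ?Z))"
    unfolding L.normal_ordered_eq(1)[OF l0' w(1,2)] L.normal_ordered_eq(1)[OF l1' w(1,2)] l0(2) l1(2) sign f0 f1
    by (simp add: L.scale_right_diff_distrib mult_ac)
  also have "sc \<tau> (Sum_any ?Y - Sum_any ?Z) = Sum_any ?X"
    unfolding S unfolding X sum_subtractf[symmetric] by (rule L.scale_sum_right)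
  also have "sc (?s * ?K) (Sum_any ?X) = normal_ordered sc q \<Sigma>' l p w"
    unfolding R.normal_ordered_eq(1)[OF l' l(2) w(1,3)] virtual_eq[OF l(1)] f ..
  finally show ?thesis .
qed

end

lemma sum_of_two:
  assumes l: "admissible l"
    and l0: "admissible l0" "omit k l0 = omit k l" and l1: "admissible l1" "omit k l1 = omit k l"
    and c: "c \<in> \<Gamma>"
    and cont: "scaled_content A l0 = scaled_content B l0 + {#q * c#}"
      "scaled_content A l1 = scaled_content B l1 + {#inverse q * c#}"
      "scaled_content A' l + {#c#} = scaled_content B' l"
    and sign: "(\<Prod>(i, c)\<leftarrow>l0. sg i) = \<tau> * (\<Prod>(i, c)\<leftarrow>l. sg' i)" "(\<Prod>(i, c)\<leftarrow>l1. sg i) = - \<tau> * (\<Prod>(i, c)\<leftarrow>l. sg' i)"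
    and w: "w \<in> S"
  shows "normal_ordered sc q \<Sigma> l0 p w + normal_ordered sc q \<Sigma> l1 p w = normal_ordered sc q \<Sigma>' l p w"
proof (rule pure_induct[OF _ _ _ w])
  show "normal_ordered sc q \<Sigma> l0 p (x + y) + normal_ordered sc q \<Sigma> l1 p (x + y) =
    (normal_ordered sc q \<Sigma> l0 p x + normal_ordered sc q \<Sigma> l1 p x) + (normal_ordered sc q \<Sigma> l0 p y + normal_ordered sc q \<Sigma> l1 p y)"
    if "x \<in> S" "y \<in> S" for x y
    using L.normal_ordered_S_add[OF conjunct1[OF l0(1)] that] L.normal_ordered_S_add[OF conjunct1[OF l1(1)] that] by simp
  show "normal_ordered sc q \<Sigma>' l p (x + y) = normal_ordered sc q \<Sigma>' l p x + normal_ordered sc q \<Sigma>' l p y"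
    if "x \<in> S" "y \<in> S" for x y
    by (rule R.normal_ordered_S_add[OF _ that]) (use l verts_eq in simp)
qed (rule sum_of_two_pure[OF _ _ _ _ conjunct1[OF l] conjunct2[OF l] l0 l1 c cont sign])

end

text \<open>What a mutation provides directly. The last assumption asks for a charged vertex whose
  X_i is injective on \<open>S\<close> and whose new zero mode contains no power of z; from it the
  symmetric principle \<open>pure_induct\<close> is derived.\<close>

locale mutated_pair =
  L: bosonized_seed sc \<Gamma> lg F q S \<Sigma> k sg A B V v +
  R: bosonized_seed sc \<Gamma> lg F' q S \<Sigma>' k sg' A' B' V v
  for sc :: "complex \<Rightarrow> 'w \<Rightarrow> 'w::ab_group_add" and \<Gamma> lg F F' q S and \<Sigma> \<Sigma>' :: "('v, 'w) seed" and k sg sg' A B A' B' V v +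
  assumes verts_eq: "verts (quiv \<Sigma>') = verts (quiv \<Sigma>)"
    and chg_opposite: "i \<in> verts (quiv \<Sigma>) \<Longrightarrow> R.chg i = - L.chg i"
    and phase_eq: "i \<in> verts (quiv \<Sigma>) - {k} \<Longrightarrow> j \<in> verts (quiv \<Sigma>) - {k} \<Longrightarrow> R.phase i j = L.phase i j"
    and psi_star': "psi_star sc lg F' r w = sc (cpow lg q r) (psi sc lg F r w) - sc (cpow lg (inverse q) r) (psi sc lg F r w)"
    and psi_star: "psi_star sc lg F r w = sc (cpow lg (inverse q) r) (psi sc lg F' r w) - sc (cpow lg q r) (psi sc lg F' r w)"
    and generic: "q powi n = 1 \<Longrightarrow> n = 0" and sg_k: "sg k \<noteq> 0" "sg' k \<noteq> 0"
    and charged: "\<exists>i\<in>verts (quiv \<Sigma>). L.chg i \<noteq> 0 \<and> (\<forall>w\<in>S. zmode \<Sigma> i w = 0 \<longrightarrow> w = 0) \<and>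
      (\<forall>w\<in>S. \<forall>r. r \<noteq> 0 \<longrightarrow> field_times (nord_zero sc lg F' (A' i) (B' i)) (V i) r w = 0)"
begin

text \<open>The new charge is minus the old one: a charged \<open>X\<^sub>i\<close> with no power of \<open>z\<close> left forces
  \<open>V\<^sub>i\<close> to single out the same exponent from either charge.\<close>

lemma opposite_charges:
  assumes w: "w \<in> S" "w \<noteq> 0" "charge F' n' w = w"
  shows "\<exists>n. charge F n w = w \<and> offset F + of_int n = - (offset F' + of_int n')"
proof -
  obtain i where i: "i \<in> verts (quiv \<Sigma>)" and d: "L.chg i \<noteq> 0"
    and inj: "\<And>u. u \<in> S \<Longrightarrow> zmode \<Sigma> i u = 0 \<Longrightarrow> u = 0"
    and van: "\<And>u r. u \<in> S \<Longrightarrow> r \<noteq> 0 \<Longrightarrow> field_times (nord_zero sc lg F' (A' i) (B' i)) (V i) r u = 0"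
    using charged by blast
  have i': "i \<in> verts (quiv \<Sigma>')" using i verts_eq by simp
  define t where "t = of_int (R.chg i) * (offset F' + of_int n' + of_int (R.chg i) / 2)"
  have V0: "V i s w = 0" if "s \<noteq> - t" for s
  proof -
    have "field_times (nord_zero sc lg F' (A' i) (B' i)) (V i) (s + t) w = 0"
      using van[OF w(1), of "s + t"] that by (simp add: eq_neg_iff_add_eq_0)
    then have "raising_power F' (R.chg i) (V i s w) = 0"
      using R.field_times_pure[OF i' w(3), of "s + t"] by (simp add: Let_def t_def)
    then show ?thesis by (simp add: R.raising_power_eq_0_iff)
  qed
  \<comment> \<open>On a component of any other old charge, X_i would use V_i at an exponent where
    it vanishes. X_i would then annihilate the component, against injectivity.\<close>
  have pure: "offset F + of_int n = - (offset F' + of_int n')" if "charge F n w \<noteq> 0" for n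
  proof (rule ccontr)
    assume ne: "offset F + of_int n \<noteq> - (offset F' + of_int n')"
    let ?u = "charge F n w" and ?e = "offset F + of_int n + of_int (L.chg i) / 2"
    have u: "?u \<in> S" by (rule L.charge_mem[OF generic sg_k(1) w(1)])
    have "t = of_int (L.chg i) * (- (offset F' + of_int n') + of_int (L.chg i) / 2)"
      by (simp add: t_def chg_opposite[OF i] algebra_simps)
    then have "- (of_int (L.chg i) * ?e) \<noteq> - t"
      using d ne by simp
    then have "V i (- (of_int (L.chg i) * ?e)) ?u = 0"
      using V0 by (simp add: L.V_simps(1)[OF i, symmetric] L.lin_0[OF L.charge])
    then have "zmode \<Sigma> i ?u = 0"
      using L.zmode_pure[OF i u, of n] by (simp add: Let_def L.charge_charge L.lin_0[OF L.lin_raising_power])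
    then show False using inj[OF u] that by simp
  qed
  have "\<exists>n. charge F n w \<noteq> 0"
  proof (rule ccontr)
    assume "\<nexists>n. charge F n w \<noteq> 0"
    then have "Sum_any (\<lambda>n. charge F n w) = Sum_any (\<lambda>n::int. 0 :: 'w)"
      by (intro arg_cong[where f = Sum_any]) auto
    then show False using w(2) L.Sum_any_charge[of w] by simp
  qed
  then obtain n where n: "charge F n w \<noteq> 0" by blast
  have "m = n" if "charge F m w \<noteq> 0" for m
    using pure[OF that] pure[OF n] by (metis add_left_cancel of_int_eq_iff)
  then have *: "charge F m w = (if m = n then charge F n w else 0)" for m
    by auto
  have "Sum_any (\<lambda>m. charge F m w) = Sum_any (\<lambda>m. if m = n then charge F n w else 0)"
    by (rule arg_cong[where f = Sum_any], rule ext) (rule * )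
  then have "charge F n w = w"
    unfolding L.Sum_any_charge by simp
  then show ?thesis using pure[OF n] by blast
qed

lemma opposite_seeds: "opposite_seeds sc \<Gamma> lg F F' q S \<Sigma> \<Sigma>' k sg sg' A B A' B' V v 1"
proof unfold_locales
  show "f w = g w"
    if f: "\<And>x y. x \<in> S \<Longrightarrow> y \<in> S \<Longrightarrow> f (x + y) = f x + f y"
      and g: "\<And>x y. x \<in> S \<Longrightarrow> y \<in> S \<Longrightarrow> g (x + y) = g x + g y"
      and eq: "\<And>w n n'. w \<in> S \<Longrightarrow> charge F n w = w \<Longrightarrow> charge F' n' w = w \<Longrightarrow>
        offset F + of_int n = - (offset F' + of_int n') \<Longrightarrow> f w = g w"
      and w: "w \<in> S" for f g :: "'w \<Rightarrow> 'w" and w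
  proof (rule R.pure_extension[OF _ f g _ w])
    show "charge F' n u \<in> S" if "u \<in> S" for u n
      by (rule R.charge_mem[OF generic sg_k(2) that])
    show "f u = g u" if "u \<in> S" "u \<noteq> 0" "charge F' n' u = u" for u n'
      using opposite_charges[OF that] eq that by blast
  qed
qed (use verts_eq chg_opposite phase_eq psi_star psi_star' in auto)

end

lemma smooth_on_cong:
  assumes "smooth_on S I v" "\<And>i. i \<in> I \<Longrightarrow> v' i = v i"
  shows "smooth_on S I v'"
proof -
  have "foldr (\<lambda>(i, n). v' i n) l w = foldr (\<lambda>(i, n). v i n) l w" if "\<forall>(i, n)\<in>set l. i \<in> I \<and> 0 < n" for l w
    using that by (induction l) (auto simp: assms(2))
  then show ?thesis
    using assms(1) unfolding smooth_on_def by metis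
qed

context complex_vector_space
begin

lemma Sum_any_scale:
  assumes "c \<noteq> 0"
  shows "Sum_any (\<lambda>x. sc c (g x)) = sc c (Sum_any g)"
  using assms by (simp add: Sum_any.expand_set scale_sum_right)

lemma field_times_scale:
  assumes "c \<noteq> 0"
  shows "field_times (\<lambda>r w. sc c (Y r w)) V r w = sc c (field_times Y V r w)"
  by (simp add: field_times_def Sum_any_scale[OF assms])

lemma field_times_unit:
  assumes "\<And>t. Y t 0 = 0"
  shows "field_times Y (\<lambda>r w. if r = 0 then w else 0) r w = (Y r w :: 'w)"
proof -
  have "(\<lambda>t. Y t (if r - t = 0 then w else 0)) = (\<lambda>t. if t = r then Y r w else 0)"
    using assms by auto
  then have "Sum_any (\<lambda>t. Y t (if r - t = 0 then w else 0)) = Y r w"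
    by (simp only: Sum_any.delta)
  then show ?thesis unfolding field_times_def by simp
qed

end

section \<open>Mutated seeds\<close>

text \<open>The substitution \<open>z \<mapsto> z / \<alpha>\<close> of the gauging at \<open>k\<close> is absorbed in the arguments of the new
  fermions in \<open>X\<^sub>k\<close>.\<close>

definition mutation_sign :: "'v quiver \<Rightarrow> 'v \<Rightarrow> 'v \<Rightarrow> complex" where
  "mutation_sign Q k i = (if i = k then - 1 else (- 1) ^ size (labels Q k i))"

definition psi_content :: "complex \<Rightarrow> 'v quiver \<Rightarrow> 'v \<Rightarrow> 'v \<Rightarrow> complex multiset" where
  "psi_content q Q k i = (if i = k then {#inverse q#} else image_mset (\<lambda>\<kappa>. q * \<kappa>) (labels Q i k))"

definition psi_star_content :: "complex \<Rightarrow> 'v quiver \<Rightarrow> 'v \<Rightarrow> 'v \<Rightarrow> complex multiset" where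
  "psi_star_content q Q k i = (if i = k then {#q#} else image_mset (\<lambda>\<kappa>. inverse q * inverse \<kappa>) (labels Q k i))"

definition mutated_psi_content :: "complex \<Rightarrow> complex \<Rightarrow> 'v quiver \<Rightarrow> 'v \<Rightarrow> 'v \<Rightarrow> complex multiset" where
  "mutated_psi_content q \<alpha> Q k i = (if i = k then {#inverse \<alpha> * inverse q#} else image_mset inverse (labels Q k i))"

definition mutated_psi_star_content :: "complex \<Rightarrow> complex \<Rightarrow> 'v quiver \<Rightarrow> 'v \<Rightarrow> 'v \<Rightarrow> complex multiset" where
  "mutated_psi_star_content q \<alpha> Q k i = (if i = k then {#inverse \<alpha> * q#} else labels Q i k)"

text \<open>The fermions and the group \<Gamma> are obtained before \<alpha> is chosen: only once
  \<Gamma> is known to contain q and the labels can the gauging constant be shown to lie in it. A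
  vertex charged with respect to \<open>k\<close> is required in order to tie the new charge to the
  old one.\<close>

lemma (in complex_vector_space) opposite_seeds_exist:
  fixes \<Sigma> \<Sigma>' :: "('v, 'w) seed"
  defines "Q \<equiv> quiv \<Sigma>"
  assumes seed: "chiral_seed sc q S \<Sigma>" and mut: "seed_mutation sc q S k \<Sigma> \<Sigma>'" and k: "mutable_at Q k"
    and generic: "\<forall>n :: int. q powi n = 1 \<longrightarrow> n = 0"
    and charged: "\<exists>i\<in>verts Q. eps Q i k \<noteq> 0"
  shows "\<exists>\<Gamma> lg F F' V v. log_branch \<Gamma> lg \<and> q \<in> \<Gamma> \<and> (\<forall>(i, j, \<kappa>)\<in>#arrows Q. \<kappa> \<in> \<Gamma>) \<and>
    (\<forall>\<alpha>\<in>\<Gamma>. opposite_seeds sc \<Gamma> lg F F' q S \<Sigma> (seed_gauge sc k \<alpha> \<Sigma>') k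
      (\<lambda>i. if i = k then - 1 else 1) (mutation_sign Q k) (psi_content q Q k) (psi_star_content q Q k)
      (mutated_psi_content q \<alpha> Q k) (mutated_psi_star_content q \<alpha> Q k) V v 1)"
proof -
  obtain \<Gamma> lg F F' V0 v0 where lb: "log_branch \<Gamma> lg" and q: "q \<in> \<Gamma>" and arr: "\<forall>(i, j, \<kappa>)\<in>#arrows Q. \<kappa> \<in> \<Gamma>"
    and F: "fermions sc lg F" and F': "fermions sc lg F'"
    and psi1: "\<forall>r w. psi_star sc lg F' r w = sc (cpow lg q r) (psi sc lg F r w) - sc (cpow lg (inverse q) r) (psi sc lg F r w)"
    and psi2: "\<forall>r w. psi_star sc lg F r w = sc (cpow lg (inverse q) r) (psi sc lg F' r w) - sc (cpow lg q r) (psi sc lg F' r w)"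
    and V0v0: "\<forall>i\<in>verts Q - {k}.
           (\<forall>r. lin (V0 i r) \<and> commutes_with_fermions F (V0 i r) \<and> commutes_with_fermions F' (V0 i r)) \<and>
           (\<forall>w. finite {r. V0 i r w \<noteq> 0}) \<and>
           (\<forall>n. n \<noteq> 0 \<longrightarrow> lin (v0 i n) \<and> commutes_with_fermions F (v0 i n) \<and> commutes_with_fermions F' (v0 i n))"
    and smooth: "smooth_on UNIV (verts Q - {k}) v0"
    and Xk: "vertex_eq S (zmode \<Sigma> k) (modes \<Sigma> k)
          (\<lambda>r w. - nord_zero sc lg F {#inverse q#} {#q#} r w) (nord_modes sc F {#inverse q#} {#q#})"
    and Xk': "vertex_eq S (zmode \<Sigma>' k) (modes \<Sigma>' k)
          (\<lambda>r w. - nord_zero sc lg F' {#inverse q#} {#q#} r w) (nord_modes sc F' {#inverse q#} {#q#})"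
    and XiXi': "\<forall>i\<in>verts Q - {k}.
            vertex_eq S (zmode \<Sigma> i) (modes \<Sigma> i)
              (field_times (nord_zero sc lg F (image_mset (\<lambda>\<kappa>. q * \<kappa>) (labels Q i k))
                 (image_mset (\<lambda>\<kappa>. inverse q * inverse \<kappa>) (labels Q k i))) (V0 i))
              (\<lambda>n w. nord_modes sc F (image_mset (\<lambda>\<kappa>. q * \<kappa>) (labels Q i k))
                 (image_mset (\<lambda>\<kappa>. inverse q * inverse \<kappa>) (labels Q k i)) n w + v0 i n w) \<and>
            vertex_eq S (zmode \<Sigma>' i) (modes \<Sigma>' i)
              (field_times (\<lambda>r w. sc ((- 1) ^ size (labels Q k i)) (nord_zero sc lg F' (image_mset inverse (labels Q k i)) (labels Q i k) r w)) (V0 i))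
              (\<lambda>n w. nord_modes sc F' (image_mset inverse (labels Q k i)) (labels Q i k) n w + v0 i n w)"
    using mut unfolding seed_mutation_def Let_def Q_def[symmetric]
    by - (elim conjE exE, rule that; assumption)
  have V0: "lin (V0 i r) \<and> commutes_with_fermions F (V0 i r) \<and> commutes_with_fermions F' (V0 i r)"
    and V0_fin: "finite {r. V0 i r w \<noteq> 0}"
    and v0: "n \<noteq> 0 \<Longrightarrow> lin (v0 i n) \<and> commutes_with_fermions F (v0 i n) \<and> commutes_with_fermions F' (v0 i n)"
    if "i \<in> verts Q - {k}" for i r w n
    using bspec[OF V0v0 that] by blast+
  have Xi: "vertex_eq S (zmode \<Sigma> i) (modes \<Sigma> i)
          (field_times (nord_zero sc lg F (psi_content q Q k i) (psi_star_content q Q k i)) (V0 i))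
          (\<lambda>n w. nord_modes sc F (psi_content q Q k i) (psi_star_content q Q k i) n w + v0 i n w)"
    and Xi': "vertex_eq S (zmode \<Sigma>' i) (modes \<Sigma>' i)
          (field_times (\<lambda>r w. sc ((- 1) ^ size (labels Q k i)) (nord_zero sc lg F' (image_mset inverse (labels Q k i)) (labels Q i k) r w)) (V0 i))
          (\<lambda>n w. nord_modes sc F' (image_mset inverse (labels Q k i)) (labels Q i k) n w + v0 i n w)"
    if "i \<in> verts Q - {k}" for i
    using bspec[OF XiXi' that] that by (simp_all add: psi_content_def psi_star_content_def)
  have quiv': "quiv \<Sigma>' = quiver_mutation q k Q"
    and S': "\<And>i. i \<in> verts Q \<Longrightarrow> zmode \<Sigma>' i ` S \<subseteq> S" "\<And>i n. i \<in> verts Q \<Longrightarrow> n \<noteq> 0 \<Longrightarrow> modes \<Sigma>' i n ` S \<subseteq> S"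
    using mut unfolding seed_mutation_def Q_def[symmetric] by blast+
  have S: "subspace S" and bij': "\<forall>i\<in>verts Q. lin (zmode \<Sigma> i) \<and> bij_betw (zmode \<Sigma> i) S S"
    and modes': "\<forall>i\<in>verts Q. \<forall>n. n \<noteq> 0 \<longrightarrow> lin (modes \<Sigma> i n) \<and> modes \<Sigma> i n ` S \<subseteq> S"
    using seed unfolding chiral_seed_def Let_def Q_def[symmetric] by - (elim conjE, assumption)+
  have bij: "lin (zmode \<Sigma> i) \<and> bij_betw (zmode \<Sigma> i) S S"
    and modes_S: "n \<noteq> 0 \<Longrightarrow> modes \<Sigma> i n ` S \<subseteq> S" if "i \<in> verts Q" for i n
    using bspec[OF bij' that] bspec[OF modes' that] by blast+
  have kQ: "k \<in> verts Q" and loop: "labels Q k k = {#}"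
    using k by (simp_all add: mutable_at_def)
  define V where "V = V0(k := \<lambda>r w. if r = 0 then w else 0)"
  define v where "v = v0(k := \<lambda>n w. 0)"
  interpret F: fermion_system sc \<Gamma> lg F by unfold_locales (rule lb, rule F)
  interpret F': fermion_system sc \<Gamma> lg F' by unfold_locales (rule F')
  have labels_in: "set_mset (labels Q i j) \<subseteq> \<Gamma>" for i j
    using arr by (auto simp: labels_def)
  have eps: "eps Q i k = int (size (labels Q i k)) - int (size (labels Q k i))" "eps Q k i = int (size (labels Q k i)) - int (size (labels Q i k))" for i
    by (auto simp: eps_def loop)
  have q0: "q \<noteq> 0" using F.in_nonzero[OF q] .
  have comm_k: "lin (V k r) \<and> commutes_with_fermions F (V k r) \<and> commutes_with_fermions F' (V k r)"
    "finite {r. V k r w \<noteq> 0}" for r w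
  proof -
    have "lin (V k r)" by (cases "r = 0") (simp_all add: V_def lin_ident lin_zero_fun)
    then show "lin (V k r) \<and> commutes_with_fermions F (V k r) \<and> commutes_with_fermions F' (V k r)"
      by (auto simp: V_def commutes_with_fermions_def commutes_def lin_0 F.raising F'.raising F.charge F'.charge F.fosc F'.fosc)
    show "finite {r. V k r w \<noteq> 0}" by (rule finite_subset[of _ "{0}"]) (auto simp: V_def)
  qed
  have V: "lin (V i r) \<and> commutes_with_fermions F (V i r) \<and> commutes_with_fermions F' (V i r)" "finite {r. V i r w \<noteq> 0}"
    if "i \<in> verts Q" for i r w
    using comm_k V0[of i r] V0_fin[of i w] that by (cases "i = k"; simp add: V_def)+
  have v: "lin (v i n) \<and> commutes_with_fermions F (v i n) \<and> commutes_with_fermions F' (v i n)" if "i \<in> verts Q" "n \<noteq> 0" for i n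
  proof (cases "i = k")
    case True
    then show ?thesis
      by (auto simp: v_def lin_zero_fun commutes_with_fermions_def commutes_def lin_0 F.raising F'.raising F.charge F'.charge F.fosc F'.fosc)
  qed (use v0[of i n] that in \<open>simp add: v_def\<close>)
  have smooth': "smooth_on UNIV (verts Q - {k}) v"
    by (rule smooth_on_cong[OF smooth]) (simp add: v_def)
  have L: "bosonized_seed sc \<Gamma> lg F q S \<Sigma> k (\<lambda>i. if i = k then - 1 else 1) (psi_content q Q k) (psi_star_content q Q k) V v"
  proof (unfold_locales, unfold Q_def[symmetric])
    show "set_mset (psi_content q Q k i) \<subseteq> \<Gamma> \<and> set_mset (psi_star_content q Q k i) \<subseteq> \<Gamma>" for i
      using labels_in[of i k] labels_in[of k i] q F.inverse_in F.mult_in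
      by (auto simp: psi_content_def psi_star_content_def)
    show "eps Q i k = F.excess (psi_content q Q k i) (psi_star_content q Q k i) \<and>
      eps Q k i = - F.excess (psi_content q Q k i) (psi_star_content q Q k i)" for i
      by (auto simp: eps psi_content_def psi_star_content_def loop)
    show "F.lgsum (psi_content q Q k k) (psi_star_content q Q k k) = - 2 * lg q"
      by (simp add: psi_content_def psi_star_content_def F.lgsum_def F.lg_inverse q)
    show "zmode \<Sigma> i w \<in> S" if "i \<in> verts Q" "w \<in> S" for i w
      using bij[OF that(1)] that(2) by (auto simp: bij_betw_def)
    show "zmode \<Sigma> i w = sc (if i = k then - 1 else 1) (field_times (nord_zero sc lg F (psi_content q Q k i) (psi_star_content q Q k i)) (V i) 0 w)"
      if "i \<in> verts Q" "w \<in> S" for i w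
    proof (cases "i = k")
      case True
      then show ?thesis
        using Xk that by (simp add: vertex_eq_def V_def psi_content_def psi_star_content_def field_times_unit lin_0[OF F.lin_nord_zero])
    qed (use Xi[of i] that in \<open>simp add: vertex_eq_def V_def\<close>)
    show "modes \<Sigma> i n w = nord_modes sc F (psi_content q Q k i) (psi_star_content q Q k i) n w + v i n w"
      if "i \<in> verts Q" "w \<in> S" "n \<noteq> 0" for i n w
    proof (cases "i = k")
      case True
      then show ?thesis
        using Xk that by (simp add: vertex_eq_def v_def psi_content_def psi_star_content_def)
    qed (use Xi[of i] that in \<open>simp add: vertex_eq_def v_def\<close>)
  qed (use S q kQ modes_S V v smooth' in \<open>auto simp: V_def v_def\<close>)
  interpret L: bosonized_seed sc \<Gamma> lg F q S \<Sigma> k "\<lambda>i. if i = k then - 1 else 1" "psi_content q Q k" "psi_star_content q Q k" V v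
    by (rule L)
  have pair: "mutated_pair sc \<Gamma> lg F F' q S \<Sigma> (seed_gauge sc k \<alpha> \<Sigma>') k
      (\<lambda>i. if i = k then - 1 else 1) (mutation_sign Q k) (psi_content q Q k) (psi_star_content q Q k)
      (mutated_psi_content q \<alpha> Q k) (mutated_psi_star_content q \<alpha> Q k) V v" if \<alpha>: "\<alpha> \<in> \<Gamma>" for \<alpha>
  proof -
    let ?A = "mutated_psi_content q \<alpha> Q k" and ?B = "mutated_psi_star_content q \<alpha> Q k"
      and ?\<Sigma>' = "seed_gauge sc k \<alpha> \<Sigma>'"
    have vQ: "verts (quiv ?\<Sigma>') = verts Q" and zm: "zmode ?\<Sigma>' = zmode \<Sigma>'"
      and eps': "eps (quiv ?\<Sigma>') = eps (quiver_mutation q k Q)"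
      by (simp_all add: seed_gauge_def quiv' eps_quiver_gauge)
    have a0: "\<alpha> \<noteq> 0" using F.in_nonzero[OF \<alpha>] .
    have field': "field_times (nord_zero sc lg F' (?A i) (?B i)) (V i) r w = (if r = 0 then sc (mutation_sign Q k i) (zmode \<Sigma>' i w) else 0)"
      if "i \<in> verts Q" "w \<in> S" for i r w
    proof (cases "i = k")
      case True
      \<comment> \<open>The gauging factor cancels in the quotient of the two arguments, so it
        affects only the oscillators of X_k.\<close>
      have "nord_zero sc lg F' (?A k) (?B k) r w = nord_zero sc lg F' {#inverse q#} {#q#} r w"
        using a0 by (simp add: nord_zero_def mutated_psi_content_def mutated_psi_star_content_def cong: if_cong)
      moreover have x: "- nord_zero sc lg F' {#inverse q#} {#q#} r w = (if r = 0 then zmode \<Sigma>' k w else 0)"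
        using Xk' that(2) unfolding vertex_eq_def by blast
      have "nord_zero sc lg F' {#inverse q#} {#q#} r w = - (if r = 0 then zmode \<Sigma>' k w else 0)"
        unfolding x[symmetric] by simp
      ultimately show ?thesis
        using True by (simp add: V_def mutation_sign_def field_times_unit lin_0[OF F'.lin_nord_zero])
    next
      case False
      then have "sc (mutation_sign Q k i) (field_times (nord_zero sc lg F' (?A i) (?B i)) (V i) r w) = (if r = 0 then zmode \<Sigma>' i w else 0)"
        using Xi'[of i] that field_times_scale[of "(- 1) ^ size (labels Q k i)"]
        by (simp add: vertex_eq_def V_def mutation_sign_def mutated_psi_content_def mutated_psi_star_content_def)
      then have "sc (mutation_sign Q k i) (sc (mutation_sign Q k i) (field_times (nord_zero sc lg F' (?A i) (?B i)) (V i) r w)) =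
          (if r = 0 then sc (mutation_sign Q k i) (zmode \<Sigma>' i w) else 0)"
        by simp
      moreover have "mutation_sign Q k i * mutation_sign Q k i = 1"
        by (simp add: mutation_sign_def flip: power_mult_distrib)
      ultimately show ?thesis by simp
    qed
    have sign2: "mutation_sign Q k i * mutation_sign Q k i = 1" for i
      by (simp add: mutation_sign_def flip: power_mult_distrib)
    have R: "bosonized_seed sc \<Gamma> lg F' q S ?\<Sigma>' k (mutation_sign Q k) ?A ?B V v"
    proof (unfold_locales, unfold vQ zm eps')
      show "set_mset (?A i) \<subseteq> \<Gamma> \<and> set_mset (?B i) \<subseteq> \<Gamma>" for i
        using labels_in[of i k] labels_in[of k i] q \<alpha> F.inverse_in F.mult_in
        by (auto simp: mutated_psi_content_def mutated_psi_star_content_def)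
      show "eps (quiver_mutation q k Q) i k = F'.excess (?A i) (?B i) \<and> eps (quiver_mutation q k Q) k i = - F'.excess (?A i) (?B i)" for i
        by (auto simp: eps_quiver_mutation(1,2)[OF q0 loop] eps mutated_psi_content_def mutated_psi_star_content_def loop)
      show "F.lgsum (?A k) (?B k) = - 2 * lg q"
        using q \<alpha> by (simp add: mutated_psi_content_def mutated_psi_star_content_def F.lgsum_def F.lg_inverse F.lg_mult F.inverse_in)
      show "modes ?\<Sigma>' i n w \<in> S" if "i \<in> verts Q" "n \<noteq> 0" "w \<in> S" for i n w
        using S'(2)[OF that(1,2)] that(3) by (auto simp: seed_gauge_def intro!: subspace_scale[OF S])
      show "zmode \<Sigma>' i w = sc (mutation_sign Q k i) (field_times (nord_zero sc lg F' (?A i) (?B i)) (V i) 0 w)"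
        if "i \<in> verts Q" "w \<in> S" for i w
        by (simp add: field'[OF that] sign2)
      show "modes ?\<Sigma>' i n w = nord_modes sc F' (?A i) (?B i) n w + v i n w" if "i \<in> verts Q" "w \<in> S" "n \<noteq> 0" for i n w
      proof (cases "i = k")
        case True
        then show ?thesis
          using Xk' that F'.nord_modes_scaled[of "inverse \<alpha>" "{#inverse q#}" "{#q#}" n w]
          by (simp add: vertex_eq_def v_def mutated_psi_content_def mutated_psi_star_content_def seed_gauge_def power_int_minus power_int_inverse)
      next
        case False
        then show ?thesis
          using Xi'[of i] that
          by (simp add: vertex_eq_def v_def mutated_psi_content_def mutated_psi_star_content_def seed_gauge_def)
      qed
    qed (use S q kQ S' V v smooth' in \<open>auto simp: V_def v_def\<close>)
    interpret R: bosonized_seed sc \<Gamma> lg F' q S ?\<Sigma>' k "mutation_sign Q k" ?A ?B V v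
      by (rule R)
    have chg: "R.chg i = - L.chg i" for i
      by (auto simp: L.chg_def R.chg_def psi_content_def psi_star_content_def mutated_psi_content_def mutated_psi_star_content_def)
    show ?thesis
    proof (unfold_locales, unfold vQ Q_def[symmetric])
      show "R.chg i = - L.chg i" for i by (rule chg)
      \<comment> \<open>With p and l the numbers of arrows to and from \<open>k\<close>, the old log
        sum at a vertex is minus the new one plus (p + l) lg q. Antisymmetrized against the charges
        p - l, the extra term gives (p_j l_i - p_i l_j) lg q, which is exactly compensated by the
        change of \<open>eps\<close>.\<close>
      show "R.phase i j = L.phase i j" if "i \<in> verts Q - {k}" "j \<in> verts Q - {k}" for i j
      proof -
        let ?t = "\<lambda>i. (\<Sum>\<kappa>\<in>#labels Q i k. lg \<kappa>) + (\<Sum>\<kappa>\<in>#labels Q k i. lg \<kappa>)"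
        let ?p = "\<lambda>i. of_nat (size (labels Q i k)) :: complex" and ?l = "\<lambda>i. of_nat (size (labels Q k i)) :: complex"
        have lgq: "(\<Sum>\<kappa>\<in>#K. lg (q * \<kappa>)) = of_nat (size K) * lg q + (\<Sum>\<kappa>\<in>#K. lg \<kappa>)" if "set_mset K \<subseteq> \<Gamma>" for K
          using that by (induction K) (auto simp: F.lg_mult q algebra_simps)
        have lgi: "(\<Sum>\<kappa>\<in>#K. lg (inverse \<kappa>)) = - (\<Sum>\<kappa>\<in>#K. lg \<kappa>)" if "set_mset K \<subseteq> \<Gamma>" for K
          using that by (induction K) (auto simp: F.lg_inverse)
        have lgqi: "(\<Sum>\<kappa>\<in>#K. lg (inverse q * inverse \<kappa>)) = - of_nat (size K) * lg q - (\<Sum>\<kappa>\<in>#K. lg \<kappa>)" if "set_mset K \<subseteq> \<Gamma>" for K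
        proof -
          have "(\<Sum>\<kappa>\<in>#K. lg (inverse q * inverse \<kappa>)) = (\<Sum>\<kappa>\<in>#K. - lg q - lg \<kappa>)"
            using that by (intro arg_cong[where f = sum_mset] image_mset_cong)
              (auto simp: F.lg_mult F.lg_inverse F.inverse_in q)
          also have "\<dots> = - of_nat (size K) * lg q - (\<Sum>\<kappa>\<in>#K. lg \<kappa>)"
          proof (induction K)
            case (add \<kappa> K)
            have "(\<Sum>\<kappa>\<in>#add_mset \<kappa> K. - lg q - lg \<kappa>) = - lg q - lg \<kappa> + (\<Sum>\<kappa>\<in>#K. - lg q - lg \<kappa>)"
              by simp
            then show ?case unfolding add by (simp add: algebra_simps)
          qed simp
          finally show ?thesis .
        qed
        have l: "L.lgs i = (?p i + ?l i) * lg q + ?t i" "R.lgs i = - ?t i" "of_int (L.chg i) = ?p i - ?l i" if "i \<noteq> k" for i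
        proof -
          note K = labels_in[of i k] and L = labels_in[of k i]
          have e: "L.lgs i = (\<Sum>\<kappa>\<in>#labels Q i k. lg (q * \<kappa>)) - (\<Sum>\<kappa>\<in>#labels Q k i. lg (inverse q * inverse \<kappa>))"
            "R.lgs i = (\<Sum>\<kappa>\<in>#labels Q k i. lg (inverse \<kappa>)) - (\<Sum>\<kappa>\<in>#labels Q i k. lg \<kappa>)"
            "of_int (L.chg i) = ?p i - ?l i"
            using that by (simp_all add: F.lgsum_def psi_content_def psi_star_content_def mutated_psi_content_def
               mutated_psi_star_content_def multiset.map_comp o_def L.chg_def)
          show "L.lgs i = (?p i + ?l i) * lg q + ?t i" "R.lgs i = - ?t i" "of_int (L.chg i) = ?p i - ?l i"
            unfolding e lgq[OF K] lgqi[OF L] lgi[OF L] by (simp_all add: algebra_simps)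
        qed
        have ne: "i \<noteq> k" "j \<noteq> k" using that by auto
        show ?thesis
          unfolding L.phase_def R.phase_def chg eps' eps_quiver_mutation(3)[OF q0 loop ne] Q_def[symmetric] of_int_minus l[OF ne(1)] l[OF ne(2)]
          by (simp add: field_simps)
      qed
      \<comment> \<open>Injectivity of X_i on \<open>S\<close> comes from bijectivity in the old
        seed; the absence of powers of z comes from \<open>field'\<close>, which describes the new
        zero mode at every exponent.\<close>
      obtain i where i: "i \<in> verts Q" "eps Q i k \<noteq> 0" using charged by blast
      have "L.chg i \<noteq> 0" using L.eps_k[of i] i unfolding L.chg_def Q_def[symmetric] by simp
      moreover have "w = 0" if "w \<in> S" "zmode \<Sigma> i w = 0" for w
        using bij[OF i(1)] that subspace_0[OF S] lin_0[of "zmode \<Sigma> i"] by (auto simp: bij_betw_def inj_on_def)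
      ultimately show "\<exists>i\<in>verts Q. L.chg i \<noteq> 0 \<and> (\<forall>w\<in>S. zmode \<Sigma> i w = 0 \<longrightarrow> w = 0) \<and>
          (\<forall>w\<in>S. \<forall>r. r \<noteq> 0 \<longrightarrow> field_times (nord_zero sc lg F' (?A i) (?B i)) (V i) r w = 0)"
        using i(1) field' by (intro bexI[of _ i]) auto
    qed (use generic psi1 psi2 in \<open>auto simp: mutation_sign_def\<close>)
  qed
  show ?thesis
    using lb q arr mutated_pair.opposite_seeds[OF pair] by blast
qed

section \<open>Currents\<close>

definition shift :: "complex \<Rightarrow> 'v monomial \<Rightarrow> 'v monomial" where
  "shift a l = map (\<lambda>(i, c). (i, a * c)) l"

lemma shift_simps [simp]: "shift a [] = []" "shift a ((i, c) # l) = (i, a * c) # shift a l"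
  "shift a (l @ l') = shift a l @ shift a l'"
  by (simp_all add: shift_def)

lemma omit_shift: "omit k (shift a l) = shift a (omit k l)"
  by (induction l) auto

lemma fst_shift: "fst ` set (shift a l) = fst ` set l"
  by (simp add: shift_def image_image case_prod_unfold)

lemma scaled_content_shift: "scaled_content X (shift a l) = image_mset ((*) a) (scaled_content X l)"
  by (induction l) (auto simp: multiset.map_comp o_def mult.assoc intro!: image_mset_cong)

lemma prod_list_shift: "(\<Prod>(i, c)\<leftarrow>shift a l. s i) = (\<Prod>(i, c)\<leftarrow>l. s i)"
  by (induction l) auto

text \<open>Two products of factors 1 + L_j T and 1 + R_j T expanded in parallel, with the same
  choices in both. The third component counts the chosen factors, which is the power of T that
  shifts anything standing further to the right.\<close>

primrec paired_monomials ::
  "complex \<Rightarrow> ('j \<Rightarrow> 'v monomial) \<Rightarrow> ('j \<Rightarrow> 'v monomial) \<Rightarrow> 'j list \<Rightarrow> ('v monomial \<times> 'v monomial \<times> nat) list" where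
  "paired_monomials a L R [] = [([], [], 0)]"
| "paired_monomials a L R (j # js) = paired_monomials a L R js @
     map (\<lambda>(l, l', r). (L j @ shift a l, R j @ shift a l', Suc r)) (paired_monomials a L R js)"

lemma foldr_one_plus:
  "foldr (\<lambda>j. one_plus a (L j)) js [[]] = map (\<lambda>(l, l', r). l) (paired_monomials a L R js)"
  by (induction js) (auto simp: one_plus_def shift_def)

lemma foldr_one_plus_pairs:
  "foldr (\<lambda>j. one_plus a (R j)) js [[], [(k, d)]] =
    concat (map (\<lambda>(l, l', r). [l', l' @ [(k, a ^ r * d)]]) (paired_monomials a L R js))"
proof (induction js)
  case (Cons j js)
  have *: "map (\<lambda>l. R j @ map (\<lambda>(i, c). (i, a * c)) l) (concat (map (\<lambda>(l, l', r). [l', l' @ [(k, a ^ r * d)]]) xs)) =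
    concat (map (\<lambda>(l, l', r). [l', l' @ [(k, a ^ r * d)]]) (map (\<lambda>(l, l', r). (L j @ shift a l, R j @ shift a l', Suc r)) xs))" for xs
    by (induction xs) (auto simp: shift_def mult.assoc)
  show ?case
    unfolding foldr.simps o_apply Cons.IH
    by (simp only: one_plus_def paired_monomials.simps map_append concat_append * )
qed simp

lemma paired_monomials_induct:
  assumes "(l, l', r) \<in> set (paired_monomials a L R js)" "P [] [] 0"
    and "\<And>j l l' r. j \<in> set js \<Longrightarrow> P l l' r \<Longrightarrow> P (L j @ shift a l) (R j @ shift a l') (Suc r)"
  shows "P l l' r"
  using assms(1,3) by (induction js arbitrary: l l' r) (auto simp: assms(2))

text \<open>Telescoping: a block carries the argument b to a b and a word carries it to a^r b.
  Shifting the word by a makes its start fit the end of the block.\<close>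

lemma content_step:
  fixes a b :: complex
  assumes "X + {#b#} = Y + {#a * b#}" "X' + {#b#} = Y' + {#a ^ r * b#}"
  shows "X + image_mset ((*) a) X' + {#b#} = Y + image_mset ((*) a) Y' + {#a ^ Suc r * b#}"
proof -
  have e: "a ^ Suc r * b = a * (a ^ r * b)" by (simp add: mult.assoc)
  have "image_mset ((*) a) (X' + {#b#}) = image_mset ((*) a) (Y' + {#a ^ r * b#})"
    using assms(2) by (rule arg_cong)
  then have "image_mset ((*) a) X' + {#a * b#} = image_mset ((*) a) Y' + {#a ^ Suc r * b#}"
    unfolding e by simp
  then have "(X + {#b#}) + (image_mset ((*) a) X' + {#a * b#}) = (Y + {#a * b#}) + (image_mset ((*) a) Y' + {#a ^ Suc r * b#})"
    by (simp only: assms(1))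
  then show ?thesis unfolding e by simp
qed

context opposite_seeds
begin

lemma in_group: "q \<in> \<Gamma>" "inverse q \<in> \<Gamma>" "a \<in> \<Gamma> \<Longrightarrow> a ^ r * c \<in> \<Gamma> \<longleftrightarrow> c \<in> \<Gamma>"
proof -
  show "q \<in> \<Gamma>" "inverse q \<in> \<Gamma>" using L.q_in L.inverse_in by blast+
  show "a ^ r * c \<in> \<Gamma> \<longleftrightarrow> c \<in> \<Gamma>" if "a \<in> \<Gamma>"
  proof
    assume *: "a ^ r * c \<in> \<Gamma>"
    have "inverse (a ^ r) * (a ^ r * c) \<in> \<Gamma>"
      by (rule L.mult_in[OF L.inverse_in[OF L.power_in[OF that]] *])
    then show "c \<in> \<Gamma>" using L.in_nonzero[OF that] by (simp add: mult.assoc[symmetric])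
  qed (use L.mult_in L.power_in that in blast)
qed

text \<open>The head is Psi(q c z) in the first seed and Psi*(c z) in the second, and each block
  multiplies the argument by a. In the first seed the innermost factor 1 + X_k T supplies the
  partner of each monomial: X_k at the shifted argument turns Psi(q a^r c z) into Psi(a^r c z / q),
  as \<open>sum_of_two\<close> requires.\<close>

lemma current_sum:
  assumes a: "a \<in> \<Gamma>" and c: "c \<in> \<Gamma>" and d: "d \<in> \<Gamma>" and i: "i \<in> verts (quiv \<Sigma>)" "i \<noteq> k"
    and head: "A i = {#q * c#}" "B i = {#}" "A' i = {#}" "B' i = {#c#}" "sg i = \<tau> * sg' i"
    and at_k: "A k = {#x#}" "B k = {#y#}" "sg k = - 1" "d * x = inverse q * c" "d * y = q * c"
    and blocks: "\<And>j. j \<in> set js \<Longrightarrow> admissible (X j) \<and> admissible (Y j) \<and> omit k (X j) = omit k (Y j) \<and>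
      scaled_content B' (X j) + {#c#} = scaled_content A' (X j) + {#a * c#} \<and>
      scaled_content A (Y j) + {#q * c#} = scaled_content B (Y j) + {#a * (q * c)#} \<and>
      (\<Prod>(i, c)\<leftarrow>X j. sg' i) = (\<Prod>(i, c)\<leftarrow>Y j. sg i)"
    and w: "w \<in> S"
  shows "current sc q \<Sigma> (map ((#) (i, 1)) (foldr (\<lambda>j. one_plus a (Y j)) js [[], [(k, d)]])) p w =
    current sc q \<Sigma>' (map ((#) (i, 1)) (foldr (\<lambda>j. one_plus a (X j)) js [[]])) p w"
proof -
  define P where "P l l' r \<longleftrightarrow> admissible l \<and> admissible l' \<and> omit k l = omit k l' \<and>
      scaled_content B' l + {#c#} = scaled_content A' l + {#a ^ r * c#} \<and>
      scaled_content A l' + {#q * c#} = scaled_content B l' + {#a ^ r * (q * c)#} \<and>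
      (\<Prod>(i, c)\<leftarrow>l. sg' i) = (\<Prod>(i, c)\<leftarrow>l'. sg i)" for l l' r
  have sn: "snd ` set (shift a l) \<subseteq> \<Gamma>" if "snd ` set l \<subseteq> \<Gamma>" for l :: "'v monomial"
    using that L.mult_in[OF a] by (auto simp: shift_def)
  have P: "P l l' r" if "(l, l', r) \<in> set (paired_monomials a X Y js)" for l l' r
    using that
  proof (rule paired_monomials_induct)
    show "P [] [] 0" by (simp add: P_def)
    show "P (X j @ shift a l) (Y j @ shift a l') (Suc r)" if "j \<in> set js" "P l l' r" for j l l' r
      using blocks[OF that(1)] that(2) sn[of l] sn[of l'] content_step[of "scaled_content B' (X j)" c _ a "scaled_content B' l" _ r]
        content_step[of "scaled_content A (Y j)" "q * c" _ a "scaled_content A l'" _ r]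
      unfolding P_def
      by (simp add: omit_shift fst_shift scaled_content_shift prod_list_shift image_Un del: power_Suc)
  qed
  have "normal_ordered sc q \<Sigma> ((i, 1) # l') p w + normal_ordered sc q \<Sigma> ((i, 1) # l' @ [(k, a ^ r * d)]) p w =
      normal_ordered sc q \<Sigma>' ((i, 1) # l) p w"
    if "(l, l', r) \<in> set (paired_monomials a X Y js)" for l l' r
  proof (rule sum_of_two[where c = "a ^ r * c"])
    note pl = P[OF that, unfolded P_def]
    show "admissible ((i, 1) # l)" "admissible ((i, 1) # l')" "admissible ((i, 1) # l' @ [(k, a ^ r * d)])"
      "omit k ((i, 1) # l') = omit k ((i, 1) # l)" "omit k ((i, 1) # l' @ [(k, a ^ r * d)]) = omit k ((i, 1) # l)"
      "a ^ r * c \<in> \<Gamma>"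
      using pl i c d a L.one_in L.k_vert by (auto simp: in_group(3))
    show "scaled_content A ((i, 1) # l') = scaled_content B ((i, 1) # l') + {#q * (a ^ r * c)#}"
      using pl head by (simp add: mult.left_commute)
    have e: "a ^ r * d * x = inverse q * (a ^ r * c)" "a ^ r * d * y = q * (a ^ r * c)"
      using at_k(4,5) by (simp_all add: mult.assoc mult.left_commute)
    show "scaled_content A ((i, 1) # l' @ [(k, a ^ r * d)]) =
        scaled_content B ((i, 1) # l' @ [(k, a ^ r * d)]) + {#inverse q * (a ^ r * c)#}"
      using pl head at_k(1-3) by (simp add: mult.left_commute[of _ q c] e)
    show "scaled_content A' ((i, 1) # l) + {#a ^ r * c#} = scaled_content B' ((i, 1) # l)"
      using pl head by simp
    show "(\<Prod>(i, c)\<leftarrow>(i, 1) # l'. sg i) = \<tau> * (\<Prod>(i, c)\<leftarrow>(i, 1) # l. sg' i)"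
      "(\<Prod>(i, c)\<leftarrow>(i, 1) # l' @ [(k, a ^ r * d)]. sg i) = - \<tau> * (\<Prod>(i, c)\<leftarrow>(i, 1) # l. sg' i)"
      using pl head at_k by simp_all
  qed (rule w)
  then have "(\<Sum>l\<leftarrow>concat (map (\<lambda>(l, l', r). [l', l' @ [(k, a ^ r * d)]]) xs). normal_ordered sc q \<Sigma> ((i, 1) # l) p w) =
      (\<Sum>(l, l', r)\<leftarrow>xs. normal_ordered sc q \<Sigma>' ((i, 1) # l) p w)"
    if "set xs \<subseteq> set (paired_monomials a X Y js)" for xs
    using that by (induction xs) (auto simp: add.assoc[symmetric])
  from this[OF order_refl] show ?thesis
    unfolding current_def foldr_one_plus[where R = Y] foldr_one_plus_pairs[where L = X]
    by (simp add: o_def case_prod_unfold)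
qed

end

lemma scaled_content_empty: "\<forall>x\<in>set l. X (fst x) = {#} \<Longrightarrow> scaled_content X l = {#}"
  by (induction l) auto

lemma prod_list_one: "\<forall>x\<in>set l. s (fst x) = 1 \<Longrightarrow> (\<Prod>(i, c)\<leftarrow>l. s i) = (1 :: complex)"
  by (induction l) auto

text \<open>The factor containing X_k alone is the innermost one and acts on 1, so it is replaced by
  the two starting monomials 1 and X_k.\<close>

lemma G_plus_eq_pairs:
  assumes "1 \<le> k" "k \<le> N"
  shows "G_plus q3 N (k - 1) = map ((#) (N + 1, 1)) (foldr (\<lambda>j. one_plus q3 (map (\<lambda>i. (i, 1)) [k..<j+1])) (rev [k+1..<N+1]) [[], [(k, 1)]])"
proof -
  have "rev [k..<N+1] = rev [k+1..<N+1] @ [k]"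
    using assms by (simp add: upt_conv_Cons del: upt_Suc)
  then show ?thesis
    using assms by (simp add: G_plus_def one_plus_def del: upt_Suc) (simp add: one_plus_def)
qed

lemma G_minus_eq_pairs:
  assumes "1 \<le> k"
  shows "G_minus q3 k = map ((#) (0, 1)) (foldr (\<lambda>j. one_plus q3 (map (\<lambda>i. (i, q3 powi (1 - int i))) [j..<k+1])) [1..<k] [[], [(k, q3 powi (1 - int k))]])"
proof -
  have "[1..<k+1] = [1..<k] @ [k]" using assms by simp
  then show ?thesis
    by (simp add: G_minus_def one_plus_def del: upt_Suc) (simp add: one_plus_def)
qed

lemma plus_blocks:
  assumes "j \<in> set (rev [k+1..<N+1])"
  obtains xs where "map (\<lambda>i. (i, 1)) [k+1..<j+1] = (k + 1, 1) # xs"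
    "map (\<lambda>i. (i, 1)) [k..<j+1] = (k, 1) # (k + 1, 1) # xs"
    "\<forall>x\<in>set xs. k + 2 \<le> fst x \<and> fst x \<le> N \<and> snd x = (1 :: complex)" "k < N"
proof
  show "map (\<lambda>i. (i, 1)) [k+1..<j+1] = (k + 1, 1) # map (\<lambda>i. (i, 1)) [k+2..<j+1]"
    "map (\<lambda>i. (i, 1)) [k..<j+1] = (k, 1) # (k + 1, 1) # map (\<lambda>i. (i, 1)) [k+2..<j+1]"
    using assms by (simp_all add: upt_conv_Cons del: upt_Suc)
qed (use assms in auto)

lemma minus_blocks:
  fixes f :: "nat \<Rightarrow> complex"
  assumes "j \<in> set [1..<k]"
  obtains xs where "map (\<lambda>i. (i, f i)) [j..<k] = xs @ [(k - 1, f (k - 1))]"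
    "map (\<lambda>i. (i, f i)) [j..<k+1] = xs @ [(k - 1, f (k - 1)), (k, f k)]"
    "\<forall>x\<in>set xs. 1 \<le> fst x \<and> fst x < k - 1 \<and> snd x = f (fst x)" "1 < k"
proof
  have "j \<le> k - 1" "Suc (k - 1) = k" using assms by auto
  then have "[j..<k] = [j..<k-1] @ [k-1]" by (metis upt_Suc_append)
  moreover have "[j..<k+1] = [j..<k] @ [k]" using \<open>j \<le> k - 1\<close> by simp
  ultimately have "[j..<k] = [j..<k-1] @ [k-1]" "[j..<k+1] = ([j..<k-1] @ [k-1]) @ [k]"
    by simp_all
  then show "map (\<lambda>i. (i, f i)) [j..<k] = map (\<lambda>i. (i, f i)) [j..<k-1] @ [(k - 1, f (k - 1))]"
    "map (\<lambda>i. (i, f i)) [j..<k+1] = map (\<lambda>i. (i, f i)) [j..<k-1] @ [(k - 1, f (k - 1)), (k, f k)]"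
    by (simp_all only: map_append list.map append.assoc append.simps)
qed (use assms in auto)

text \<open>Among the vertices that occur, only \<open>N + 1\<close>, \<open>k\<close> and
  \<open>k + 1\<close> have nonempty contents. The condition \<open>step\<close> says that X_(k+1)
  in the second seed, and X_k X_(k+1) in the first, multiply the argument of the fermion by
  a.\<close>

lemma plus_current_sum:
  fixes \<Sigma> \<Sigma>' :: "(nat, 'w::ab_group_add) seed"
  assumes "opposite_seeds sc \<Gamma> lg F F' q S \<Sigma> \<Sigma>' k sg sg' A B A' B' V v \<tau>"
    and a: "a \<in> \<Gamma>" and c: "c \<in> \<Gamma>" and k: "1 \<le> k" "k \<le> N" and verts: "verts (quiv \<Sigma>) = {0..N+1}"
    and head: "A (N + 1) = {#q * c#}" "B (N + 1) = {#}" "A' (N + 1) = {#}" "B' (N + 1) = {#c#}" "sg (N + 1) = \<tau> * sg' (N + 1)"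
    and at_k: "A k = {#inverse q * c#}" "B k = {#q * c#}" "sg k = - 1"
    and step: "k < N \<Longrightarrow> B' (k + 1) + {#c#} = A' (k + 1) + {#a * c#} \<and>
      A (k + 1) + {#inverse q * c#} = B (k + 1) + {#a * (q * c)#} \<and> sg' (k + 1) = - sg (k + 1)"
    and far: "\<And>i. k + 2 \<le> i \<Longrightarrow> i \<le> N \<Longrightarrow> A i = {#} \<and> B i = {#} \<and> A' i = {#} \<and> B' i = {#} \<and> sg i = 1 \<and> sg' i = 1"
    and w: "w \<in> S"
  shows "current sc q \<Sigma> (G_plus a N (k - 1)) p w = current sc q \<Sigma>' (G_plus a N k) p w"
proof -
  interpret opposite_seeds sc \<Gamma> lg F F' q S \<Sigma> \<Sigma>' k sg sg' A B A' B' V v \<tau> by fact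
  have "current sc q \<Sigma> (map ((#) (N + 1, 1)) (foldr (\<lambda>j. one_plus a (map (\<lambda>i. (i, 1)) [k..<j+1])) (rev [k+1..<N+1]) [[], [(k, 1)]])) p w =
    current sc q \<Sigma>' (map ((#) (N + 1, 1)) (foldr (\<lambda>j. one_plus a (map (\<lambda>i. (i, 1)) [k+1..<j+1])) (rev [k+1..<N+1]) [[]])) p w"
  proof (rule current_sum[OF a c L.one_in _ _ head at_k _ _ _ w])
    fix j assume "j \<in> set (rev [k+1..<N+1])"
    from plus_blocks[OF this] obtain xs where b: "map (\<lambda>i. (i, 1)) [k+1..<j+1] = (k + 1, 1) # xs"
      "map (\<lambda>i. (i, 1)) [k..<j+1] = (k, 1) # (k + 1, 1) # xs"
      and xs: "\<forall>x\<in>set xs. k + 2 \<le> fst x \<and> fst x \<le> N \<and> snd x = (1 :: complex)" and "k < N" .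
    have r: "scaled_content A xs = {#}" "scaled_content B xs = {#}" "scaled_content A' xs = {#}" "scaled_content B' xs = {#}"
      using xs far by (intro scaled_content_empty; blast)+
    have s: "(\<Prod>(i, c)\<leftarrow>xs. sg i) = 1" "(\<Prod>(i, c)\<leftarrow>xs. sg' i) = 1"
      using xs far by (intro prod_list_one; blast)+
    have f: "fst ` set xs \<subseteq> {0..N+1}" "snd ` set xs \<subseteq> \<Gamma>"
      using xs L.one_in by fastforce+
    have one: "image_mset ((*) 1) X = X" for X :: "complex multiset" by (induction X) auto
    let ?X = "map (\<lambda>i. (i, 1 :: complex)) [k+1..<j+1]" and ?Y = "map (\<lambda>i. (i, 1 :: complex)) [k..<j+1]"
    show "admissible ?X \<and> admissible ?Y \<and> omit k ?X = omit k ?Y \<and>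
         scaled_content B' ?X + {#c#} = scaled_content A' ?X + {#a * c#} \<and>
         scaled_content A ?Y + {#q * c#} = scaled_content B ?Y + {#a * (q * c)#} \<and>
         (\<Prod>(i, c)\<leftarrow>?X. sg' i) = (\<Prod>(i, c)\<leftarrow>?Y. sg i)"
      unfolding b verts using f k \<open>k < N\<close> step[OF \<open>k < N\<close>] L.one_in by (simp add: r s at_k one)
  qed (use k verts in simp_all)
  then show ?thesis
    unfolding G_plus_eq_pairs[OF k] by (simp only: G_plus_def)
qed

text \<open>The same mechanism with \<open>k - 1\<close> in the role of \<open>k + 1\<close>. Since
  X_i carries the argument a^(1-i) z here, \<open>k\<close> enters with the factor d and
  \<open>k - 1\<close> with the factor a d.\<close>

lemma minus_current_sum:
  fixes \<Sigma> \<Sigma>' :: "(nat, 'w::ab_group_add) seed"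
  assumes "opposite_seeds sc \<Gamma> lg F F' q S \<Sigma> \<Sigma>' k sg sg' A B A' B' V v \<tau>"
    and a: "a \<in> \<Gamma>" and c: "c \<in> \<Gamma>" and k: "1 \<le> k" "k \<le> N" and verts: "verts (quiv \<Sigma>) = {0..N+1}"
    and head: "A 0 = {#q * c#}" "B 0 = {#}" "A' 0 = {#}" "B' 0 = {#c#}" "sg 0 = \<tau> * sg' 0"
    and d: "d = a powi (1 - int k)"
    and at_k: "A k = {#x#}" "B k = {#y#}" "sg k = - 1" "d * x = inverse q * c" "d * y = q * c"
    and step: "1 < k \<Longrightarrow>
      image_mset ((*) (a * d)) (B' (k - 1)) + {#c#} = image_mset ((*) (a * d)) (A' (k - 1)) + {#a * c#} \<and>
      image_mset ((*) (a * d)) (A (k - 1)) + {#inverse q * c#} = image_mset ((*) (a * d)) (B (k - 1)) + {#a * (q * c)#} \<and>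
      sg' (k - 1) = - sg (k - 1)"
    and far: "\<And>i. 1 \<le> i \<Longrightarrow> i < k - 1 \<Longrightarrow> A i = {#} \<and> B i = {#} \<and> A' i = {#} \<and> B' i = {#} \<and> sg i = 1 \<and> sg' i = 1"
    and w: "w \<in> S"
  shows "current sc q \<Sigma> (G_minus a k) p w = current sc q \<Sigma>' (G_minus a (k - 1)) p w"
proof -
  interpret opposite_seeds sc \<Gamma> lg F F' q S \<Sigma> \<Sigma>' k sg sg' A B A' B' V v \<tau> by fact
  let ?f = "\<lambda>i::nat. a powi (1 - int i)"
  have ck: "?f (k - 1) = a * d"
    using L.in_nonzero[OF a] k by (simp add: d of_nat_diff power_int_diff power2_eq_square)
  have d_in: "d \<in> \<Gamma>" unfolding d by (rule L.power_int_in[OF a])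
  have "current sc q \<Sigma> (map ((#) (0, 1)) (foldr (\<lambda>j. one_plus a (map (\<lambda>i. (i, ?f i)) [j..<k+1])) [1..<k] [[], [(k, d)]])) p w =
    current sc q \<Sigma>' (map ((#) (0, 1)) (foldr (\<lambda>j. one_plus a (map (\<lambda>i. (i, ?f i)) [j..<k])) [1..<k] [[]])) p w"
  proof (rule current_sum[OF a c d_in _ _ head at_k _ w])
    fix j assume "j \<in> set [1..<k]"
    from minus_blocks[OF this, of ?f] obtain xs where b: "map (\<lambda>i. (i, ?f i)) [j..<k] = xs @ [(k - 1, ?f (k - 1))]"
      "map (\<lambda>i. (i, ?f i)) [j..<k+1] = xs @ [(k - 1, ?f (k - 1)), (k, ?f k)]"
      and xs: "\<forall>x\<in>set xs. 1 \<le> fst x \<and> fst x < k - 1 \<and> snd x = ?f (fst x)" and "1 < k" .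
    have r: "scaled_content A xs = {#}" "scaled_content B xs = {#}" "scaled_content A' xs = {#}" "scaled_content B' xs = {#}"
      using xs far by (intro scaled_content_empty; blast)+
    have s: "(\<Prod>(i, c)\<leftarrow>xs. sg i) = 1" "(\<Prod>(i, c)\<leftarrow>xs. sg' i) = 1"
      using xs far by (intro prod_list_one; blast)+
    have f: "fst ` set xs \<subseteq> {0..N+1}" "snd ` set xs \<subseteq> \<Gamma>"
      using xs k L.power_int_in[OF a] by fastforce+
    let ?X = "map (\<lambda>i. (i, ?f i)) [j..<k]" and ?Y = "map (\<lambda>i. (i, ?f i)) [j..<k+1]"
    have k1: "k - Suc 0 \<noteq> k" "k - Suc 0 \<le> Suc N" using k by simp_all
    show "admissible ?X \<and> admissible ?Y \<and> omit k ?X = omit k ?Y \<and>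
         scaled_content B' ?X + {#c#} = scaled_content A' ?X + {#a * c#} \<and>
         scaled_content A ?Y + {#q * c#} = scaled_content B ?Y + {#a * (q * c)#} \<and>
         (\<Prod>(i, c)\<leftarrow>?X. sg' i) = (\<Prod>(i, c)\<leftarrow>?Y. sg i)"
      unfolding b verts ck d[symmetric] using f k k1 \<open>1 < k\<close> step[OF \<open>1 < k\<close>] d_in a
      by (simp add: r s at_k L.mult_in)
  qed (use k verts in simp_all)
  then show ?thesis
    unfolding G_minus_eq_pairs[OF k(1)] d using k by (simp add: G_minus_def)
qed

context
  fixes q q1 q2 q3 :: complex and N k :: nat
  assumes prod: "q1 * q2 * q3 = 1" and sqr: "q ^ 2 = q2"
    and generic: "\<forall>a b c :: int. q1 powi a * q2 powi b * q3 powi c = 1 \<longrightarrow> a = b \<and> b = c"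
    and N: "2 \<le> N" and k: "1 \<le> k" "k \<le> N"
begin

lemmas nonzero = parameters_nonzero[OF prod sqr generic N k]
lemmas q1_eq' = q1_eq[OF prod sqr generic N k]

lemma q_generic: "q powi n = 1 \<Longrightarrow> n = 0"
proof -
  assume "q powi n = 1"
  then have "q2 powi n = 1" by (simp flip: sqr add: power_int_power' power_int_mult mult.commute) (metis power_int_1_left power_int_mult mult.commute power_int_numeral)
  then show ?thesis using generic[rule_format, of 0 n 0] by simp
qed

context
  fixes sc :: "complex \<Rightarrow> 'w \<Rightarrow> 'w::ab_group_add" and S :: "'w set" and \<Sigma> \<Sigma>' :: "(nat, 'w) seed"
  assumes sc: "vector_space sc" and seed: "chiral_seed sc q S \<Sigma>" and mut: "seed_mutation sc q S k \<Sigma> \<Sigma>'"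
begin

lemma down_currents:
  assumes Q: "quiv \<Sigma> = sub_quiver q q1 q3 N k" and w: "w \<in> S"
  shows "current sc q \<Sigma> (G_plus q3 N k) n w = current sc q (seed_gauge sc k (q * q3) \<Sigma>') (G_plus q3 N (k - 1)) n w"
    "current sc q \<Sigma> (G_minus q3 k) n w = current sc q (seed_gauge sc k (q * q3) \<Sigma>') (G_minus q3 (k - 1)) n w"
proof -
  interpret vector_space sc by (rule sc)
  interpret complex_vector_space sc by unfold_locales
  let ?Q = "sub_quiver q q1 q3 N k"
  note dl = down_labels[OF prod sqr generic N k]
  have "eps ?Q (N + 1) k \<noteq> 0" using k by (simp add: eps_def dl)
  then have charged: "\<exists>i\<in>verts (quiv \<Sigma>). eps (quiv \<Sigma>) i k \<noteq> 0"
    by (intro bexI[of _ "N + 1"]) (simp_all add: Q)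
  have mutable: "mutable_at (quiv \<Sigma>) k"
    unfolding Q by (rule sub_quiver_mutable(1)[OF prod sqr generic N k])
  obtain \<Gamma> lg F F' V v where lb: "log_branch \<Gamma> lg" and q_in: "q \<in> \<Gamma>" and arr: "\<forall>(i, j, \<kappa>)\<in>#arrows ?Q. \<kappa> \<in> \<Gamma>"
    and pair: "\<forall>\<alpha>\<in>\<Gamma>. opposite_seeds sc \<Gamma> lg F F' q S \<Sigma> (seed_gauge sc k \<alpha> \<Sigma>') k
      (\<lambda>i. if i = k then - 1 else 1) (mutation_sign ?Q k) (psi_content q ?Q k) (psi_star_content q ?Q k)
      (mutated_psi_content q \<alpha> ?Q k) (mutated_psi_star_content q \<alpha> ?Q k) V v 1"
    using opposite_seeds_exist[OF seed mut mutable _ charged] q_generic unfolding Q by blast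
  interpret logarithm \<Gamma> lg by unfold_locales (rule lb)
  \<comment> \<open>Scale factors lie in \<Gamma> only if they can be built from q and labels of
    arrows; here q3 is itself a label.\<close>
  have "q3 \<in># labels ?Q k (N + 1)" by (simp add: dl)
  then have q3_in: "q3 \<in> \<Gamma>" using arr by (auto simp: labels_def)
  note opp = bspec[OF pair mult_in[OF q_in q3_in]]
  note defs = psi_content_def psi_star_content_def mutated_psi_content_def mutated_psi_star_content_def mutation_sign_def dl
  have nz: "q \<noteq> 0" "q3 \<noteq> 0" using nonzero by blast+
  have e: "q * q1 = inverse q * inverse q3" "inverse q * inverse q3 * inverse q = q1" "inverse q * inverse q3 * q = inverse q3"
    "q * (inverse q * inverse q3) = inverse q3" "q3 * (inverse q * inverse q3) = inverse q" "q3 * inverse q3 = 1"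
    "inverse q * (inverse q * inverse q3) = q1"
    unfolding q1_eq' using nz by (simp_all add: field_simps power2_eq_square)
  \<comment> \<open>The plus current gains the factor with X_k in the mutated seed, so the seeds are
    exchanged. The constant solves q c = 1/q3, the argument of the new Psi at
    \<open>N + 1\<close>.\<close>
  have "current sc q (seed_gauge sc k (q * q3) \<Sigma>') (G_plus q3 N (k - 1)) n w = current sc q \<Sigma> (G_plus q3 N k) n w"
    by (rule plus_current_sum[where c = "inverse q * inverse q3", OF opposite_seeds.swap[OF opp] q3_in _ k])
      (use k w nz q_in q3_in opposite_seeds.verts_eq[OF opp] in \<open>simp_all add: Q defs e inverse_in mult_in\<close>)
  then show "current sc q \<Sigma> (G_plus q3 N k) n w = current sc q (seed_gauge sc k (q * q3) \<Sigma>') (G_plus q3 N (k - 1)) n w" ..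
  \<comment> \<open>The label of the arrow from 0 to \<open>k\<close>: the old Psi at 0 has argument
    q c z.\<close>
  define c where "c = q3 powi (1 - int k)"
  have c_in: "c \<in> \<Gamma>" unfolding c_def by (rule power_int_in[OF q3_in])
  have e': "q3 * c * inverse q3 = c" "q3 * c * (inverse q * inverse q3) = c * inverse q"
    using nz by simp_all
  show "current sc q \<Sigma> (G_minus q3 k) n w = current sc q (seed_gauge sc k (q * q3) \<Sigma>') (G_minus q3 (k - 1)) n w"
    by (rule minus_current_sum[OF opp q3_in c_in k _ _ _ _ _ _ c_def])
      (use k w nz in \<open>simp_all add: Q defs c_def[symmetric] e' mult.commute mult.left_commute, auto\<close>)
qed

lemma up_currents:
  assumes "quiv \<Sigma> = sub_quiver q q1 q3 N (k - 1)" and w: "w \<in> S"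
  shows "current sc q \<Sigma> (G_plus q3 N (k - 1)) n w = current sc q (seed_gauge sc k (q * q1) \<Sigma>') (G_plus q3 N k) n w"
    "current sc q \<Sigma> (G_minus q3 (k - 1)) n w = current sc q (seed_gauge sc k (q * q1) \<Sigma>') (G_minus q3 k) n w"
proof -
  interpret vector_space sc by (rule sc)
  interpret complex_vector_space sc by unfold_locales
  define R where "R = sub_quiver q q1 q3 N (k - 1)"
  have Q: "quiv \<Sigma> = R" and verts: "verts R = {0..N+1}"
    using assms(1) by (simp_all add: R_def)
  note ul = up_labels[OF prod sqr generic N k, folded R_def]
  have "eps R (N + 1) k \<noteq> 0" using k by (simp add: eps_def ul)
  then have charged: "\<exists>i\<in>verts (quiv \<Sigma>). eps (quiv \<Sigma>) i k \<noteq> 0"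
    by (intro bexI[of _ "N + 1"]) (simp_all add: Q verts)
  have mutable: "mutable_at (quiv \<Sigma>) k"
    unfolding Q R_def by (rule sub_quiver_mutable(2)[OF prod sqr generic N k])
  obtain \<Gamma> lg F F' V v where lb: "log_branch \<Gamma> lg" and q_in: "q \<in> \<Gamma>" and arr: "\<forall>(i, j, \<kappa>)\<in>#arrows R. \<kappa> \<in> \<Gamma>"
    and pair: "\<forall>\<alpha>\<in>\<Gamma>. opposite_seeds sc \<Gamma> lg F F' q S \<Sigma> (seed_gauge sc k \<alpha> \<Sigma>') k
      (\<lambda>i. if i = k then - 1 else 1) (mutation_sign R k) (psi_content q R k) (psi_star_content q R k)
      (mutated_psi_content q \<alpha> R k) (mutated_psi_star_content q \<alpha> R k) V v 1"
    using opposite_seeds_exist[OF seed mut mutable _ charged] q_generic unfolding Q by blast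
  interpret logarithm \<Gamma> lg by unfold_locales (rule lb)
  have nz: "q \<noteq> 0" "q3 \<noteq> 0" using nonzero by blast+
  have label_in: "\<kappa> \<in> \<Gamma>" if "\<kappa> \<in># labels R i j" for i j \<kappa>
    using that arr by (auto simp: labels_def)
  \<comment> \<open>For \<open>k\<close> = \<open>N\<close> the arrow from \<open>k + 1\<close> with
    label q3 is absent. Since \<open>N\<close> is at least 2, the arrow from \<open>k\<close> to
    \<open>k - 1\<close> with label q1 exists, and q3 = 1/(q^2 q1).\<close>
  have q3_in: "q3 \<in> \<Gamma>"
  proof (cases "k < N")
    case True
    then show ?thesis by (intro label_in[of q3 "k + 1" k]) (simp add: ul)
  next
    case False
    then have "1 < k" using N k by simp
    then have "q1 \<in> \<Gamma>" by (intro label_in[of q1 k "k - 1"]) (simp add: ul)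
    then have "inverse (q * q * q1) \<in> \<Gamma>" by (intro inverse_in mult_in q_in)
    also have "inverse (q * q * q1) = q3"
      unfolding q1_eq' using nz by (simp add: field_simps power2_eq_square)
    finally show ?thesis .
  qed
  have iq1: "inverse q1 = q * (q * q3)"
    unfolding q1_eq' by (simp add: power2_eq_square mult.assoc)
  have "inverse (q * (q * q3)) \<in> \<Gamma>" by (intro inverse_in mult_in q_in q3_in)
  then have "q1 \<in> \<Gamma>" unfolding iq1[symmetric] by simp
  then have a: "q * q1 \<in> \<Gamma>" by (rule mult_in[OF q_in])
  note opp = bspec[OF pair a]
  note defs = psi_content_def psi_star_content_def mutated_psi_content_def mutated_psi_star_content_def mutation_sign_def ul
  \<comment> \<open>In this direction the factor with X_k belongs to the old seed, so no exchange
    occurs; the constant is 1, the label of the arrow from \<open>N + 1\<close> to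
    \<open>k\<close>.\<close>
  show "current sc q \<Sigma> (G_plus q3 N (k - 1)) n w = current sc q (seed_gauge sc k (q * q1) \<Sigma>') (G_plus q3 N k) n w"
    by (rule plus_current_sum[OF opp q3_in one_in k]) (use k w nz in \<open>simp_all add: Q verts defs mult.commute\<close>)
  define c where "c = q3 powi (1 - int k)"
  have c0: "c \<noteq> 0" using nz by (simp add: c_def)
  have c_in: "c \<in> \<Gamma>" unfolding c_def by (rule power_int_in[OF q3_in])
  have "inverse (q powi (-2) * q3 powi (int k - 2)) = q * (q * (q3 * c))"
    using nz c0 by (simp add: c_def power_int_diff power_int_minus field_simps power2_eq_square)
  then have e: "inverse (q powi (-2)) * inverse (q3 powi (int k - 2)) = q * (q * (q3 * c))" by simp
  have e': "inverse q * (q * x) = x" "inverse q * (y * (q * x)) = y * x"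
    "q * (q * (y * (inverse q * inverse q))) = y" "q * (q * (q * (y * inverse q))) = q * (q * y)" "q * (y * inverse q) = y" for x y
    using nz by (simp_all add: field_simps)
  \<comment> \<open>Now the minus current is the one that gains X_k. The chosen constant times q is
    q^2 q3^(2-k), the inverse label of the arrow from \<open>k\<close> to 0 and so the argument of
    the new Psi at 0.\<close>
  have "current sc q (seed_gauge sc k (q * q1) \<Sigma>') (G_minus q3 k) n w = current sc q \<Sigma> (G_minus q3 (k - 1)) n w"
    by (rule minus_current_sum[where c = "q * (q3 * c)", OF opposite_seeds.swap[OF opp] q3_in _ k _ _ _ _ _ _ c_def])
      (use k w nz q_in q3_in c_in opposite_seeds.verts_eq[OF opp] in
        \<open>simp_all add: Q verts defs mult_in e iq1 e' mult.commute mult.left_commute, auto\<close>)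
  then show "current sc q \<Sigma> (G_minus q3 (k - 1)) n w = current sc q (seed_gauge sc k (q * q1) \<Sigma>') (G_minus q3 k) n w" ..
qed

end

end

theorem theorem4p12:
  fixes sc :: "complex \<Rightarrow> 'w \<Rightarrow> 'w::ab_group_add"
    and q q1 q2 q3 :: complex and N M :: nat
  assumes "vector_space sc"
    and "q1 * q2 * q3 = 1"
    and "\<forall>a b c :: int. q1 powi a * q2 powi b * q3 powi c = 1 \<longrightarrow> a = b \<and> b = c"
    and "q ^ 2 = q2"
    and "N \<ge> 2" and "M \<le> N"
  shows "(M \<noteq> 0 \<longrightarrow>
            mutable_at (sub_quiver q q1 q3 N M) M \<and>
            quiver_gauge M (q * q3) (quiver_mutation q M (sub_quiver q q1 q3 N M))
              = sub_quiver q q1 q3 N (M - 1) \<and>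
            (\<forall>S \<Sigma> \<Sigma>'. chiral_seed sc q S \<Sigma> \<and> quiv \<Sigma> = sub_quiver q q1 q3 N M \<and>
                seed_mutation sc q S M \<Sigma> \<Sigma>' \<longrightarrow>
              (\<forall>w\<in>S. \<forall>n.
                 current sc q \<Sigma> (G_plus q3 N M) n w
                   = current sc q (seed_gauge sc M (q * q3) \<Sigma>') (G_plus q3 N (M - 1)) n w \<and>
                 current sc q \<Sigma> (G_minus q3 M) n w
                   = current sc q (seed_gauge sc M (q * q3) \<Sigma>') (G_minus q3 (M - 1)) n w))) \<and>
         (M \<noteq> N \<longrightarrow>
            mutable_at (sub_quiver q q1 q3 N M) (M + 1) \<and>
            quiver_gauge (M + 1) (q * q1) (quiver_mutation q (M + 1) (sub_quiver q q1 q3 N M))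
              = sub_quiver q q1 q3 N (M + 1) \<and>
            (\<forall>S \<Sigma> \<Sigma>'. chiral_seed sc q S \<Sigma> \<and> quiv \<Sigma> = sub_quiver q q1 q3 N M \<and>
                seed_mutation sc q S (M + 1) \<Sigma> \<Sigma>' \<longrightarrow>
              (\<forall>w\<in>S. \<forall>n.
                 current sc q \<Sigma> (G_plus q3 N M) n w
                   = current sc q (seed_gauge sc (M + 1) (q * q1) \<Sigma>') (G_plus q3 N (M + 1)) n w \<and>
                 current sc q \<Sigma> (G_minus q3 M) n w
                   = current sc q (seed_gauge sc (M + 1) (q * q1) \<Sigma>') (G_minus q3 (M + 1)) n w)))"
proof -
  note par = assms(2,4,3,5)
  have down: "M \<noteq> 0 \<Longrightarrow> 1 \<le> M" and up: "1 \<le> M + 1" "M \<noteq> N \<Longrightarrow> M + 1 \<le> N"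
    using assms(6) by simp_all
  show ?thesis
  proof (intro conjI impI, goal_cases)
    case 1 then show ?case by (rule sub_quiver_mutable(1)[OF par down assms(6)])
  next
    case 2 then show ?case by (rule sub_quiver_mutation(1)[OF par down assms(6)])
  next
    case 3 then show ?case using down_currents[OF par down assms(6,1)] by blast
  next
    case 4 then show ?case using sub_quiver_mutable(2)[OF par up] by simp
  next
    case 5 then show ?case using sub_quiver_mutation(2)[OF par up] by simp
  next
    case 6 then show ?case using up_currents[OF par up assms(1), unfolded add_diff_cancel_right'] by blast
  qed
qed

end
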